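(* Let $(g,f)$ be a homogeneous pair of degree $\alpha\in\mathbb{R}-\{0\}$ on a manifold $M$ with a free $\mathbb{R}_{>0}$-action. Assume that $g$ is positive definite and that the pseudometric $d_g$ induced from $g$ is a metric. Let $v:\mathbb{R}_{>0}\to\mathbb{R}_{>0}$ be a smooth function, let $\overline M$ be the metric completion of $M$ with respect to the metric $d_{(v\circ f)g}$ induced from $(v\circ f)g$, let $l>0$, and let $\overline{M_l}$ be the metric completion of $M_l=f^{-1}(l)$ with respect to the metric induced from the pullback $g_l$ of $g$ to $M_l$. Then the map $$\overline{M_l}\to\left\{[x_k]\in\overline M\ \middle|\ \lim_{k\to\infty}f(x_k)=l\right\},\qquad[y_k]\mapsto[y_k]$$ is a homeomorphism.
   Context: Homogeneous pair: $m:\mathbb{R}_{>0}\times M\to M$ is a smooth free action, $m_\lambda=m(\lambda,\cdot)$, $P_x=\frac{d}{dt}m(e^t,x)|_{t=0}$. For a pseudo-Riemannian metric $g$, a smooth $f:M\to\mathbb{R}_{>0}$ and $\alpha\in\mathbb{R}-\{0\}$, $(g,f)$ is a homogeneous pair of degree $\alpha$ if $m_\lambda^*g=\lambda^\alpha g$, $m_\lambda^*f=\lambda^\alpha f$ for all $\lambda>0$ and $g(P,\cdot)=df$. The pseudometric induced from a Riemannian metric is the infimum of lengths of piecewise smooth paths. The metric completion of a metric space $(Z,d)$ is the set of Cauchy sequences in $Z$ modulo $\{z_k\}\sim\{z_k'\}\Leftrightarrow\lim_{k\to\infty}d(z_k,z_k')=0$, with metric $d([z_k],[z_k'])=\lim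 d(z_k,z_k')$; $[z_k]$ denotes the class of $\{z_k\}$. *)

theory Defs
  imports "HOL-Analysis.Analysis"
begin

section \<open>Smooth maps between subsets of Euclidean spaces\<close>

primrec Ck_on :: "nat \<Rightarrow> 'b::euclidean_space set \<Rightarrow> ('b \<Rightarrow> 'c::euclidean_space) \<Rightarrow> bool" where
  "Ck_on 0 U F \<longleftrightarrow> continuous_on U F"
| "Ck_on (Suc k) U F \<longleftrightarrow> (\<forall>x\<in>U. F differentiable (at x)) \<and>
     (\<forall>v. Ck_on k U (\<lambda>x. frechet_derivative F (at x) v))"

text \<open>The set \<open>S\<close> is arbitrary: smoothness means local extendability to a smooth map on an open
  set. This one notion serves for open sets, for relatively open subsets of linear subspaces and
  for closed intervals.\<close>

definition smooth_on :: "'b::euclidean_space set \<Rightarrow> ('b \<Rightarrow> 'c::euclidean_space) \<Rightarrow> bool" where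
  "smooth_on S f \<longleftrightarrow> (\<forall>x\<in>S. \<exists>U F. open U \<and> x \<in> U \<and> (\<forall>k. Ck_on k U F) \<and> (\<forall>y\<in>S \<inter> U. F y = f y))"

text \<open>Directional derivative. Below, \<open>F\<close> is only meaningful on a relatively open subset of a linear
  subspace \<open>V\<close>, and only directions \<open>v \<in> V\<close> are used; then \<open>dir_deriv F y v\<close> is the value of the
  differential of \<open>F\<close> at \<open>y\<close> on \<open>v\<close>.\<close>

definition dir_deriv :: "('b::euclidean_space \<Rightarrow> 'c::euclidean_space) \<Rightarrow> 'b \<Rightarrow> 'b \<Rightarrow> 'c" where
  "dir_deriv F y v = vector_derivative (\<lambda>t::real. F (y + t *\<^sub>R v)) (at 0)"


section \<open>Smooth manifolds\<close>

text \<open>A chart of an \<open>n\<close>-dimensional manifold maps an open set onto an open subset of an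
  \<open>n\<close>-dimensional linear subspace \<open>cspace\<close> of the ambient space \<open>'e\<close>. Thus the dimension is a
  natural number rather than a type, and a manifold and its submanifolds have charts of the same
  type.\<close>

record ('a, 'e) chart =
  cdom :: "'a set"
  cmap :: "'a \<Rightarrow> 'e"
  cspace :: "'e set"

record ('a, 'e) manifold =
  mtop :: "'a topology"
  mdim :: nat
  atlas :: "('a, 'e) chart set"

abbreviation pts :: "('a, 'e) manifold \<Rightarrow> 'a set" where
  "pts M \<equiv> topspace (mtop M)"

definition cinv :: "('a, 'e) chart \<Rightarrow> 'e \<Rightarrow> 'a" where
  "cinv c = inv_into (cdom c) (cmap c)"

definition is_chart :: "('a, 'e::euclidean_space) manifold \<Rightarrow> ('a, 'e) chart \<Rightarrow> bool" where
  "is_chart M c \<longleftrightarrow>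
     openin (mtop M) (cdom c) \<and>
     subspace (cspace c) \<and> dim (cspace c) = mdim M \<and>
     openin (top_of_set (cspace c)) (cmap c ` cdom c) \<and>
     homeomorphic_map (subtopology (mtop M) (cdom c)) (top_of_set (cmap c ` cdom c)) (cmap c)"

definition smooth_transition :: "('a, 'e::euclidean_space) chart \<Rightarrow> ('a, 'e) chart \<Rightarrow> bool" where
  "smooth_transition c d \<longleftrightarrow> smooth_on (cmap c ` (cdom c \<inter> cdom d)) (cmap d \<circ> cinv c)"

definition smooth_manifold :: "('a, 'e::euclidean_space) manifold \<Rightarrow> bool" where
  "smooth_manifold M \<longleftrightarrow>
     Hausdorff_space (mtop M) \<and> second_countable (mtop M) \<and>
     (\<forall>c\<in>atlas M. is_chart M c) \<and>
     (\<Union>c\<in>atlas M. cdom c) = pts M \<and>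
     (\<forall>c\<in>atlas M. \<forall>d\<in>atlas M. smooth_transition c d)"

definition max_atlas :: "('a, 'e::euclidean_space) manifold \<Rightarrow> ('a, 'e) chart set" where
  "max_atlas M = {c. is_chart M c \<and> (\<forall>d\<in>atlas M. smooth_transition c d \<and> smooth_transition d c)}"

text \<open>The embedded submanifold structure of dimension \<open>k\<close> on a subset \<open>S\<close>, given by slice charts.\<close>

definition submanifold :: "('a, 'e::euclidean_space) manifold \<Rightarrow> 'a set \<Rightarrow> nat \<Rightarrow> ('a, 'e) manifold" where
  "submanifold M S k =
     \<lparr>mtop = subtopology (mtop M) S,
      mdim = k,
      atlas = {\<lparr>cdom = cdom c \<inter> S, cmap = cmap c, cspace = W\<rparr> | c W.
                 c \<in> max_atlas M \<and> subspace W \<and> W \<subseteq> cspace c \<and> dim W = k \<and>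
                 cmap c ` (cdom c \<inter> S) = cmap c ` cdom c \<inter> W}\<rparr>"

definition prod_manifold ::
    "('a, 'e) manifold \<Rightarrow> ('b, 'f) manifold \<Rightarrow> ('a \<times> 'b, 'e \<times> 'f) manifold" where
  "prod_manifold M N =
     \<lparr>mtop = prod_topology (mtop M) (mtop N),
      mdim = mdim M + mdim N,
      atlas = {\<lparr>cdom = cdom c \<times> cdom d, cmap = map_prod (cmap c) (cmap d),
                cspace = cspace c \<times> cspace d\<rparr> | c d. c \<in> atlas M \<and> d \<in> atlas N}\<rparr>"

definition Rpos :: "(real, real) manifold" where
  "Rpos = \<lparr>mtop = top_of_set {0<..}, mdim = 1,
           atlas = {\<lparr>cdom = {0<..}, cmap = (\<lambda>x. x), cspace = UNIV\<rparr>}\<rparr>"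

definition smooth_map ::
    "('a, 'e::euclidean_space) manifold \<Rightarrow> ('b, 'f::euclidean_space) manifold \<Rightarrow> ('a \<Rightarrow> 'b) \<Rightarrow> bool" where
  "smooth_map M N h \<longleftrightarrow>
     continuous_map (mtop M) (mtop N) h \<and>
     (\<forall>c\<in>atlas M. \<forall>d\<in>atlas N.
        smooth_on (cmap c ` {x \<in> cdom c. h x \<in> cdom d}) (cmap d \<circ> h \<circ> cinv c))"


section \<open>Tangent vectors\<close>

text \<open>A tangent vector at \<open>x\<close> is a family of coordinate vectors, one for each chart around \<open>x\<close>, that
  transforms by the derivatives of the chart transitions. Components at all other charts are set to
  zero, so that equality of tangent vectors is equality of functions, and the vector space
  operations are pointwise.\<close>

type_synonym ('a, 'e) tvec = "('a, 'e) chart \<Rightarrow> 'e"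

definition tangent_space :: "('a, 'e::euclidean_space) manifold \<Rightarrow> 'a \<Rightarrow> ('a, 'e) tvec set" where
  "tangent_space M x =
     {\<xi>. (\<forall>c\<in>atlas M. x \<in> cdom c \<longrightarrow> \<xi> c \<in> cspace c) \<and>
         (\<forall>c\<in>atlas M. \<forall>d\<in>atlas M. x \<in> cdom c \<and> x \<in> cdom d \<longrightarrow>
            \<xi> d = dir_deriv (cmap d \<circ> cinv c) (cmap c x) (\<xi> c)) \<and>
         (\<forall>c. \<not> (c \<in> atlas M \<and> x \<in> cdom c) \<longrightarrow> \<xi> c = 0)}"

definition coord_vector ::
    "('a, 'e::euclidean_space) manifold \<Rightarrow> ('a, 'e) chart \<Rightarrow> 'e \<Rightarrow> 'a \<Rightarrow> ('a, 'e) tvec" where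
  "coord_vector M c u x =
     (\<lambda>d. if d \<in> atlas M \<and> x \<in> cdom d then dir_deriv (cmap d \<circ> cinv c) (cmap c x) u else 0)"

text \<open>The value of \<open>differential M f x \<xi>\<close> does not depend on the chosen chart when \<open>f\<close> is smooth near
  \<open>x\<close> and \<open>\<xi>\<close> is tangent at \<open>x\<close>.\<close>

definition differential ::
    "('a, 'e::euclidean_space) manifold \<Rightarrow> ('a \<Rightarrow> 'c::euclidean_space) \<Rightarrow> 'a \<Rightarrow> ('a, 'e) tvec \<Rightarrow> 'c" where
  "differential M f x \<xi> =
     (let c = (SOME c. c \<in> atlas M \<and> x \<in> cdom c) in dir_deriv (f \<circ> cinv c) (cmap c x) (\<xi> c))"

definition pushforward ::
    "('a, 'e::euclidean_space) manifold \<Rightarrow> ('b, 'f::euclidean_space) manifold \<Rightarrow> ('a \<Rightarrow> 'b) \<Rightarrow>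
     'a \<Rightarrow> ('a, 'e) tvec \<Rightarrow> ('b, 'f) tvec" where
  "pushforward M N h x \<xi> =
     (\<lambda>d. if d \<in> atlas N \<and> h x \<in> cdom d then differential M (cmap d \<circ> h) x \<xi> else 0)"

definition velocity :: "('a, 'e::euclidean_space) manifold \<Rightarrow> (real \<Rightarrow> 'a) \<Rightarrow> real \<Rightarrow> ('a, 'e) tvec" where
  "velocity M \<gamma> t =
     (\<lambda>c. if c \<in> atlas M \<and> \<gamma> t \<in> cdom c then vector_derivative (cmap c \<circ> \<gamma>) (at t) else 0)"


section \<open>Metrics\<close>

type_synonym ('a, 'e) metric_tensor = "'a \<Rightarrow> ('a, 'e) tvec \<Rightarrow> ('a, 'e) tvec \<Rightarrow> real"

definition pseudo_riemannian :: "('a, 'e::euclidean_space) manifold \<Rightarrow> ('a, 'e) metric_tensor \<Rightarrow> bool" where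
  "pseudo_riemannian M g \<longleftrightarrow>
     (\<forall>x\<in>pts M.
        (\<forall>\<xi>\<in>tangent_space M x. \<forall>\<zeta>\<in>tangent_space M x. \<forall>\<eta>\<in>tangent_space M x. \<forall>a b.
           g x (\<lambda>c. a *\<^sub>R \<xi> c + b *\<^sub>R \<zeta> c) \<eta> = a * g x \<xi> \<eta> + b * g x \<zeta> \<eta>) \<and>
        (\<forall>\<xi>\<in>tangent_space M x. \<forall>\<eta>\<in>tangent_space M x. g x \<xi> \<eta> = g x \<eta> \<xi>) \<and>
        (\<forall>\<xi>\<in>tangent_space M x. (\<forall>\<eta>\<in>tangent_space M x. g x \<xi> \<eta> = 0) \<longrightarrow> \<xi> = (\<lambda>c. 0))) \<and>
     (\<forall>c\<in>atlas M. \<forall>u\<in>cspace c. \<forall>w\<in>cspace c.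
        smooth_on (cmap c ` cdom c)
          (\<lambda>y. g (cinv c y) (coord_vector M c u (cinv c y)) (coord_vector M c w (cinv c y))))"

definition positive_definite :: "('a, 'e::euclidean_space) manifold \<Rightarrow> ('a, 'e) metric_tensor \<Rightarrow> bool" where
  "positive_definite M g \<longleftrightarrow>
     (\<forall>x\<in>pts M. \<forall>\<xi>\<in>tangent_space M x. \<xi> \<noteq> (\<lambda>c. 0) \<longrightarrow> g x \<xi> \<xi> > 0)"

definition pullback ::
    "('a, 'e::euclidean_space) manifold \<Rightarrow> ('b, 'f::euclidean_space) manifold \<Rightarrow> ('a \<Rightarrow> 'b) \<Rightarrow>
     ('b, 'f) metric_tensor \<Rightarrow> ('a, 'e) metric_tensor" where
  "pullback M N h g = (\<lambda>x \<xi> \<eta>. g (h x) (pushforward M N h x \<xi>) (pushforward M N h x \<eta>))"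


section \<open>Homogeneous pairs\<close>

definition free_smooth_action ::
    "('a, 'e::euclidean_space) manifold \<Rightarrow> (real \<Rightarrow> 'a \<Rightarrow> 'a) \<Rightarrow> bool" where
  "free_smooth_action M m \<longleftrightarrow>
     smooth_map (prod_manifold Rpos M) M (\<lambda>(r, x). m r x) \<and>
     (\<forall>x\<in>pts M. m 1 x = x) \<and>
     (\<forall>r>0. \<forall>s>0. \<forall>x\<in>pts M. m r (m s x) = m (r * s) x) \<and>
     (\<forall>r>0. \<forall>x\<in>pts M. m r x = x \<longrightarrow> r = 1)"

definition euler_field ::
    "('a, 'e::euclidean_space) manifold \<Rightarrow> (real \<Rightarrow> 'a \<Rightarrow> 'a) \<Rightarrow> 'a \<Rightarrow> ('a, 'e) tvec" where
  "euler_field M m x = velocity M (\<lambda>t. m (exp t) x) 0"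

definition homogeneous_pair ::
    "('a, 'e::euclidean_space) manifold \<Rightarrow> (real \<Rightarrow> 'a \<Rightarrow> 'a) \<Rightarrow> real \<Rightarrow>
     ('a, 'e) metric_tensor \<Rightarrow> ('a \<Rightarrow> real) \<Rightarrow> bool" where
  "homogeneous_pair M m \<alpha> g f \<longleftrightarrow>
     pseudo_riemannian M g \<and> smooth_map M Rpos f \<and> \<alpha> \<noteq> 0 \<and>
     (\<forall>r>0. \<forall>x\<in>pts M. \<forall>\<xi>\<in>tangent_space M x. \<forall>\<eta>\<in>tangent_space M x.
        pullback M M (m r) g x \<xi> \<eta> = r powr \<alpha> * g x \<xi> \<eta>) \<and>
     (\<forall>r>0. \<forall>x\<in>pts M. f (m r x) = r powr \<alpha> * f x) \<and>
     (\<forall>x\<in>pts M. \<forall>\<xi>\<in>tangent_space M x. g x (euler_field M m x) \<xi> = differential M f x \<xi>)"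


section \<open>The induced distance\<close>

definition smooth_path_on :: "('a, 'e::euclidean_space) manifold \<Rightarrow> real set \<Rightarrow> (real \<Rightarrow> 'a) \<Rightarrow> bool" where
  "smooth_path_on M I \<gamma> \<longleftrightarrow>
     continuous_map (top_of_set I) (mtop M) \<gamma> \<and>
     (\<forall>c\<in>atlas M. smooth_on {t\<in>I. \<gamma> t \<in> cdom c} (cmap c \<circ> \<gamma>))"

definition piecewise_smooth_path :: "('a, 'e::euclidean_space) manifold \<Rightarrow> (real \<Rightarrow> 'a) \<Rightarrow> bool" where
  "piecewise_smooth_path M \<gamma> \<longleftrightarrow>
     (\<exists>(n::nat) p. p 0 = 0 \<and> p n = 1 \<and>
        (\<forall>i<n. p i < p (Suc i) \<and> smooth_path_on M {p i..p (Suc i)} \<gamma>))"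

text \<open>The velocity is not meaningful at the end points and at the finitely many break points of the
  path; this does not affect the integral.\<close>

definition path_length ::
    "('a, 'e::euclidean_space) manifold \<Rightarrow> ('a, 'e) metric_tensor \<Rightarrow> (real \<Rightarrow> 'a) \<Rightarrow> real" where
  "path_length M g \<gamma> = integral {0..1} (\<lambda>t. sqrt (g (\<gamma> t) (velocity M \<gamma> t) (velocity M \<gamma> t)))"

definition pseudo_dist ::
    "('a, 'e::euclidean_space) manifold \<Rightarrow> ('a, 'e) metric_tensor \<Rightarrow> 'a \<Rightarrow> 'a \<Rightarrow> ennreal" where
  "pseudo_dist M g x y =
     (INF \<gamma>\<in>{\<gamma>. piecewise_smooth_path M \<gamma> \<and> \<gamma> 0 = x \<and> \<gamma> 1 = y}. ennreal (path_length M g \<gamma>))"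

definition rdist ::
    "('a, 'e::euclidean_space) manifold \<Rightarrow> ('a, 'e) metric_tensor \<Rightarrow> 'a \<Rightarrow> 'a \<Rightarrow> real" where
  "rdist M g x y = enn2real (pseudo_dist M g x y)"

definition induces_metric :: "('a, 'e::euclidean_space) manifold \<Rightarrow> ('a, 'e) metric_tensor \<Rightarrow> bool" where
  "induces_metric M g \<longleftrightarrow>
     (\<forall>x\<in>pts M. \<forall>y\<in>pts M. pseudo_dist M g x y < \<infinity>) \<and> Metric_space (pts M) (rdist M g)"


section \<open>Metric completion\<close>

definition cauchy_seqs :: "'a set \<Rightarrow> ('a \<Rightarrow> 'a \<Rightarrow> real) \<Rightarrow> (nat \<Rightarrow> 'a) set" where
  "cauchy_seqs Z d = {z. Metric_space.MCauchy Z d z}"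

definition cauchy_rel :: "'a set \<Rightarrow> ('a \<Rightarrow> 'a \<Rightarrow> real) \<Rightarrow> ((nat \<Rightarrow> 'a) \<times> (nat \<Rightarrow> 'a)) set" where
  "cauchy_rel Z d =
     {(z, z'). z \<in> cauchy_seqs Z d \<and> z' \<in> cauchy_seqs Z d \<and> (\<lambda>k. d (z k) (z' k)) \<longlonglongrightarrow> 0}"

definition cauchy_class :: "'a set \<Rightarrow> ('a \<Rightarrow> 'a \<Rightarrow> real) \<Rightarrow> (nat \<Rightarrow> 'a) \<Rightarrow> (nat \<Rightarrow> 'a) set" where
  "cauchy_class Z d z = cauchy_rel Z d `` {z}"

definition completion :: "'a set \<Rightarrow> ('a \<Rightarrow> 'a \<Rightarrow> real) \<Rightarrow> (nat \<Rightarrow> 'a) set set" where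
  "completion Z d = cauchy_seqs Z d // cauchy_rel Z d"

text \<open>The locale \<^locale>\<open>Metric_space\<close> constrains the distance function outside the carrier as well,
  hence the value \<open>0\<close> there.\<close>

definition completion_dist ::
    "'a set \<Rightarrow> ('a \<Rightarrow> 'a \<Rightarrow> real) \<Rightarrow> (nat \<Rightarrow> 'a) set \<Rightarrow> (nat \<Rightarrow> 'a) set \<Rightarrow> real" where
  "completion_dist Z d X Y =
     (if X \<in> completion Z d \<and> Y \<in> completion Z d
      then (THE r. \<exists>z\<in>X. \<exists>z'\<in>Y. (\<lambda>k. d (z k) (z' k)) \<longlonglongrightarrow> r) else 0)"

definition completion_topology :: "'a set \<Rightarrow> ('a \<Rightarrow> 'a \<Rightarrow> real) \<Rightarrow> (nat \<Rightarrow> 'a) set topology" where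
  "completion_topology Z d = Metric_space.mtopology (completion Z d) (completion_dist Z d)"


section \<open>Level sets\<close>

definition level_manifold ::
    "('a, 'e::euclidean_space) manifold \<Rightarrow> ('a \<Rightarrow> real) \<Rightarrow> real \<Rightarrow> ('a, 'e) manifold" where
  "level_manifold M f l = submanifold M {x \<in> pts M. f x = l} (mdim M - 1)"

definition level_metric ::
    "('a, 'e::euclidean_space) manifold \<Rightarrow> ('a \<Rightarrow> real) \<Rightarrow> real \<Rightarrow> ('a, 'e) metric_tensor \<Rightarrow>
     ('a, 'e) metric_tensor" where
  "level_metric M f l g = pullback (level_manifold M f l) M (\<lambda>x. x) g"

end

theory Submission
  imports Defs
begin

text \<open>
  Write \<open>P\<close> for the Euler field. Since \<open>g(P, \<sqdot>) = df\<close>, the field \<open>P\<close> is orthogonal to the level sets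
  of \<open>f\<close>, and \<open>g(P, P) = df(P) = \<alpha> f\<close>. So \<open>(M, g)\<close> is a cone: let \<open>\<pi>\<close> move each point along its orbit
  to the level set \<open>M\<^sub>l\<close>. For a path \<open>\<gamma>\<close> in \<open>M\<close>,
  \<open>|\<gamma>'|\<^sup>2 = ((f \<circ> \<gamma>)')\<^sup>2 / (\<alpha> f) + (f / l) |(\<pi> \<circ> \<gamma>)'|\<^sup>2\<close>.
  Discarding one of the two nonnegative summands gives \<open>euler_cauchy_schwarz\<close> and
  \<open>level_proj_speed\<close>. These two estimates carry the proof.

  The first one controls \<open>f\<close>. Take \<open>w\<close> with \<open>w'(s) = sqrt (v(s) / (\<alpha> s))\<close>. Then \<open>w \<circ> f\<close> is
  1-Lipschitz for the distance \<open>d\<^sub>v\<close> of \<open>(v \<circ> f) g\<close> (\<open>radial_bound\<close>), so a path that starts on \<open>M\<^sub>l\<close>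
  and is short for \<open>(v \<circ> f) g\<close> stays where \<open>l / 2 \<le> f \<le> 2 l\<close> (\<open>short_paths_in_band\<close>). In this band \<open>v\<close>
  lies between positive constants. Hence \<open>d\<^sub>v\<close> is locally comparable to the distance of \<open>g\<close>, and in
  particular it separates points.

  The second one compares \<open>d\<^sub>v\<close> with the distance \<open>d\<^sub>l\<close> of the level set: projecting a short path to
  \<open>M\<^sub>l\<close> lengthens it at most by a constant factor, so \<open>d\<^sub>l \<le> K d\<^sub>v\<close> on pairs of points of \<open>M\<^sub>l\<close> with
  \<open>d\<^sub>v < d\<close> (\<open>local_comparison\<close>). Conversely \<open>d\<^sub>v \<le> sqrt (v(l)) d\<^sub>l\<close>, since paths in \<open>M\<^sub>l\<close> are paths in
  \<open>M\<close> (\<open>ambient_le_level\<close>). Therefore the two distances have the same Cauchy sequences and the same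
  null sequences on \<open>M\<^sub>l\<close>, and the completion of \<open>M\<^sub>l\<close> embeds into that of \<open>M\<close>. The image consists of all
  classes \<open>[x\<^sub>k]\<close> with \<open>f(x\<^sub>k) \<longlonglongrightarrow> l\<close>, because the orbit segment from \<open>x\<^sub>k\<close> to \<open>\<pi>(x\<^sub>k)\<close> has length tending
  to \<open>0\<close> (\<open>level_proj_close\<close>).

  All estimates are statements about velocities of paths, so the manifold theory consists of
  the chain rule for paths, the product rule for a path moved by the action, and the
  integrability of the speed. The level set enters through its slice charts. These exist because
  \<open>df(P) \<noteq> 0\<close>, and they show that smooth paths of the level manifold are the smooth paths of \<open>M\<close> in
  \<open>M\<^sub>l\<close>, with the same speed.
\<close>



section \<open>Maps of class C^k on open sets\<close>

lemma Ck_on_subset: "Ck_on k U F \<Longrightarrow> V \<subseteq> U \<Longrightarrow> Ck_on k V F"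
  by (induction k arbitrary: F) (auto intro: continuous_on_subset)

lemma Ck_on_cong:
  assumes "open U" "\<And>x. x \<in> U \<Longrightarrow> F x = G x" "Ck_on k U F"
  shows "Ck_on k U G"
  using assms(2,3)
proof (induction k arbitrary: F G)
  case 0
  then show ?case by (metis Ck_on.simps(1) continuous_on_cong)
next
  case (Suc k)
  have der: "(G has_derivative frechet_derivative F (at x)) (at x)" if "x \<in> U" for x
  proof -
    have "(F has_derivative frechet_derivative F (at x)) (at x)"
      using Suc.prems(2) that by (simp add: frechet_derivative_works)
    then show ?thesis
      using has_derivative_transform_within_open[OF _ \<open>open U\<close> that] Suc.prems(1) by blast
  qed
  have "Ck_on k U (\<lambda>x. frechet_derivative G (at x) v)" for v
  proof (rule Suc.IH)
    show "frechet_derivative F (at x) v = frechet_derivative G (at x) v" if "x \<in> U" for x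
      using frechet_derivative_at[OF der[OF that]] by simp
    show "Ck_on k U (\<lambda>x. frechet_derivative F (at x) v)"
      using Suc.prems(2) by simp
  qed
  then show ?case
    using der by (auto simp: differentiable_def)
qed

text \<open>The recursion refers to the canonical derivative; here any explicit formula for the derivative
  may be used instead.\<close>

lemma Ck_on_SucI:
  assumes "open U" "\<And>x. x \<in> U \<Longrightarrow> (F has_derivative F' x) (at x)" "\<And>v. Ck_on k U (\<lambda>x. F' x v)"
  shows "Ck_on (Suc k) U F"
proof -
  have "Ck_on k U (\<lambda>x. frechet_derivative F (at x) v)" for v
    by (rule Ck_on_cong[OF assms(1) _ assms(3)[of v]])
      (metis assms(2) frechet_derivative_at)
  then show ?thesis
    using assms(2) by (auto simp: differentiable_def)
qed

lemma Ck_on_has_derivative: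
  "Ck_on (Suc k) U F \<Longrightarrow> x \<in> U \<Longrightarrow> (F has_derivative frechet_derivative F (at x)) (at x)"
  by (simp add: frechet_derivative_works)

lemma Ck_on_imp_continuous_on: "Ck_on k U F \<Longrightarrow> continuous_on U F"
proof (cases k)
  case (Suc n)
  moreover assume "Ck_on k U F"
  ultimately have "\<forall>x\<in>U. isCont F x"
    by (simp add: differentiable_imp_continuous_within)
  then show ?thesis by (rule continuous_at_imp_continuous_on)
qed auto

lemma Ck_on_SucD: "Ck_on (Suc k) U F \<Longrightarrow> Ck_on k U F"
proof (induction k arbitrary: F)
  case 0
  then show ?case using Ck_on_imp_continuous_on by (metis Ck_on.simps(1))
next
  case (Suc k)
  then show ?case by (metis Ck_on.simps(2))
qed

lemma Ck_on_const: "open U \<Longrightarrow> Ck_on k U (\<lambda>x. c)"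
proof (induction k arbitrary: c)
  case (Suc k)
  then show ?case by (intro Ck_on_SucI[where F'="\<lambda>x v. 0"]) auto
qed auto

lemma Ck_on_bounded_linear:
  assumes "bounded_linear L" "open U" "Ck_on k U F"
  shows "Ck_on k U (\<lambda>x. L (F x))"
  using assms(3)
proof (induction k arbitrary: F)
  case 0
  then show ?case using assms(1) by (simp add: bounded_linear.continuous_on)
next
  case (Suc k)
  show ?case
  proof (rule Ck_on_SucI[OF assms(2)])
    show "((\<lambda>x. L (F x)) has_derivative (\<lambda>v. L (frechet_derivative F (at x) v))) (at x)" if "x \<in> U" for x
      using bounded_linear.has_derivative[OF assms(1) Ck_on_has_derivative[OF Suc.prems that]] .
    show "Ck_on k U (\<lambda>x. L (frechet_derivative F (at x) v))" for v
      using Suc by simp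
  qed
qed

lemma Ck_on_id: "open U \<Longrightarrow> Ck_on k U (\<lambda>x. x)"
proof (cases k)
  case (Suc n)
  assume "open U"
  then show ?thesis unfolding Suc
    by (intro Ck_on_SucI[where F'="\<lambda>x v. v"]) (auto intro: Ck_on_const)
qed auto

lemma Ck_on_add:
  assumes "open U" "Ck_on k U F" "Ck_on k U G"
  shows "Ck_on k U (\<lambda>x. F x + G x)"
  using assms(2,3)
proof (induction k arbitrary: F G)
  case 0
  then show ?case by (simp add: continuous_on_add)
next
  case (Suc k)
  show ?case
  proof (rule Ck_on_SucI[OF assms(1)])
    show "((\<lambda>x. F x + G x) has_derivative
        (\<lambda>v. frechet_derivative F (at x) v + frechet_derivative G (at x) v)) (at x)" if "x \<in> U" for x
      using Ck_on_has_derivative[OF Suc.prems(1) that] Ck_on_has_derivative[OF Suc.prems(2) that]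
      by (rule has_derivative_add)
  qed (use Suc in auto)
qed

lemma Ck_on_sum:
  assumes "open U" "finite I" "\<And>i. i \<in> I \<Longrightarrow> Ck_on k U (F i)"
  shows "Ck_on k U (\<lambda>x. \<Sum>i\<in>I. F i x)"
  using assms(2,3) by (induction I rule: finite_induct) (auto intro!: Ck_on_const Ck_on_add assms(1))

lemma Ck_on_scaleR:
  fixes F :: "'b::euclidean_space \<Rightarrow> real"
  assumes "open U" "Ck_on k U F" "Ck_on k U G"
  shows "Ck_on k U (\<lambda>x. F x *\<^sub>R G x)"
  using assms(2,3)
proof (induction k arbitrary: F G)
  case 0
  then show ?case by (simp add: continuous_on_scaleR)
next
  case (Suc k)
  show ?case
  proof (rule Ck_on_SucI[OF assms(1)])
    show "((\<lambda>x. F x *\<^sub>R G x) has_derivative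
        (\<lambda>v. F x *\<^sub>R frechet_derivative G (at x) v + frechet_derivative F (at x) v *\<^sub>R G x)) (at x)"
      if "x \<in> U" for x
      using Ck_on_has_derivative[OF Suc.prems(1) that] Ck_on_has_derivative[OF Suc.prems(2) that]
      by (rule has_derivative_scaleR)
    have "Ck_on k U F" "Ck_on k U G"
      using Suc.prems Ck_on_SucD by blast+
    then show "Ck_on k U (\<lambda>x. F x *\<^sub>R frechet_derivative G (at x) v + frechet_derivative F (at x) v *\<^sub>R G x)" for v
      using Suc by (auto intro!: Ck_on_add assms(1))
  qed
qed

lemma Ck_on_mult:
  fixes F G :: "'b::euclidean_space \<Rightarrow> real"
  assumes "open U" "Ck_on k U F" "Ck_on k U G"
  shows "Ck_on k U (\<lambda>x. F x * G x)"
  using Ck_on_scaleR[OF assms] by simp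

lemma Ck_on_diff:
  assumes "open U" "Ck_on k U F" "Ck_on k U G"
  shows "Ck_on k U (\<lambda>x. F x - G x)"
  using Ck_on_add[OF assms(1,2) Ck_on_bounded_linear[OF _ assms(1,3), of uminus]]
  by (simp add: bounded_linear_minus bounded_linear_ident)

lemma Ck_on_Pair:
  assumes "open U" "Ck_on k U F" "Ck_on k U G"
  shows "Ck_on k U (\<lambda>x. (F x, G x))"
  using assms(2,3)
proof (induction k arbitrary: F G)
  case 0
  then show ?case by (simp add: continuous_on_Pair)
next
  case (Suc k)
  show ?case
  proof (rule Ck_on_SucI[OF assms(1)])
    show "((\<lambda>x. (F x, G x)) has_derivative
        (\<lambda>v. (frechet_derivative F (at x) v, frechet_derivative G (at x) v))) (at x)" if "x \<in> U" for x
      using Ck_on_has_derivative[OF Suc.prems(1) that] Ck_on_has_derivative[OF Suc.prems(2) that]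
      by (rule has_derivative_Pair)
  qed (use Suc in auto)
qed

lemma Ck_on_compose:
  assumes "open U" "open V" "F ` U \<subseteq> V" "Ck_on k U F" "Ck_on k V G"
  shows "Ck_on k U (\<lambda>x. G (F x))"
  using assms(4,5)
proof (induction k arbitrary: G)
  case 0
  then show ?case using continuous_on_compose2[OF _ _ assms(3)] by auto
next
  case (Suc k)
  have FV: "F x \<in> V" if "x \<in> U" for x using that assms(3) by blast
  let ?DF = "\<lambda>x. frechet_derivative F (at x)" and ?DG = "\<lambda>y. frechet_derivative G (at y)"
  show ?case
  proof (rule Ck_on_SucI[OF assms(1)])
    fix x assume x: "x \<in> U"
    have dF: "(F has_derivative ?DF x) (at x)" using Suc.prems(1) x by (rule Ck_on_has_derivative)
    have dG: "(G has_derivative ?DG (F x)) (at (F x))" using Suc.prems(2) FV[OF x] by (rule Ck_on_has_derivative)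
    \<comment> \<open>The derivative of \<open>G\<close> is only controlled in constant directions, so the varying direction
       is expanded in the standard basis.\<close>
    have "?DG (F x) (?DF x v) = (\<Sum>b\<in>Basis. (?DF x v \<bullet> b) *\<^sub>R ?DG (F x) b)" for v
    proof -
      have lin: "linear (?DG (F x))" using dG has_derivative_linear by blast
      show ?thesis
        by (subst (1) euclidean_representation[of "?DF x v", symmetric])
          (simp add: linear_sum[OF lin] linear_scale[OF lin])
    qed
    then show "((\<lambda>x. G (F x)) has_derivative (\<lambda>v. \<Sum>b\<in>Basis. (?DF x v \<bullet> b) *\<^sub>R ?DG (F x) b)) (at x)"
      using diff_chain_at[OF dF dG] by (simp add: o_def)
  next
    fix v
    show "Ck_on k U (\<lambda>x. \<Sum>b\<in>Basis. (?DF x v \<bullet> b) *\<^sub>R ?DG (F x) b)"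
      using Suc.prems Ck_on_SucD[OF Suc.prems(1)]
      by (intro Ck_on_sum[OF assms(1)] Ck_on_scaleR[OF assms(1)] Suc.IH
          Ck_on_bounded_linear[OF bounded_linear_inner_left assms(1)]) auto
  qed
qed

lemma Ck_on_inverse: "Ck_on k (- {0}) (inverse :: real \<Rightarrow> real)"
proof (induction k)
  case 0
  then show ?case by (auto intro!: continuous_intros)
next
  case (Suc k)
  have o: "open (- {0::real})" by auto
  show ?case
  proof (rule Ck_on_SucI[OF o])
    show "(inverse has_derivative (\<lambda>v. - (inverse x * v * inverse x))) (at x)" if "x \<in> - {0}" for x :: real
      using that by (intro has_derivative_inverse') auto
    show "Ck_on k (- {0}) (\<lambda>x. - (inverse x * v * inverse x))" for v :: real
      using Ck_on_mult[OF o Ck_on_mult[OF o Suc Suc] Ck_on_const[OF o, of _ "-v"]]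
      by (rule Ck_on_cong[OF o, rotated]) simp
  qed
qed

lemma Ck_on_powr: "Ck_on k {0<..} (\<lambda>x::real. x powr a)"
proof (induction k arbitrary: a)
  case 0
  then show ?case by (auto intro!: continuous_intros)
next
  case (Suc k)
  have o: "open {0::real<..}" by auto
  show ?case
  proof (rule Ck_on_SucI[OF o])
    show "((\<lambda>x. x powr a) has_derivative (\<lambda>v. v * (a * x powr (a - 1)))) (at x)" if "x \<in> {0<..}" for x :: real
      using has_real_derivative_powr[of x a] that
      by (simp add: has_field_derivative_def mult_commute_abs)
    show "Ck_on k {0<..} (\<lambda>x. v * (a * x powr (a - 1)))" for v :: real
      by (intro Ck_on_mult o Ck_on_const Suc)
  qed
qed

lemma Ck_on_exp: "Ck_on k UNIV (exp :: real \<Rightarrow> real)"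
proof (induction k)
  case 0
  then show ?case by (auto intro!: continuous_intros)
next
  case (Suc k)
  show ?case
  proof (rule Ck_on_SucI[OF open_UNIV])
    show "(exp has_derivative (\<lambda>v. v * exp x)) (at x)" for x :: real
      using DERIV_exp[of x] by (simp add: has_field_derivative_def mult_commute_abs)
    show "Ck_on k UNIV (\<lambda>x. v * exp x)" for v :: real
      by (intro Ck_on_mult open_UNIV Ck_on_const Suc)
  qed
qed


section \<open>Smooth maps on arbitrary sets\<close>

lemma smooth_onI_open:
  assumes "open U" "S \<subseteq> U" "\<And>k. Ck_on k U f"
  shows "smooth_on S f"
  using assms unfolding smooth_on_def by blast

lemma smooth_onD:
  "smooth_on S f \<Longrightarrow> x \<in> S \<Longrightarrow>
    \<exists>U F. open U \<and> x \<in> U \<and> (\<forall>k. Ck_on k U F) \<and> (\<forall>y\<in>S \<inter> U. F y = f y)"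
  unfolding smooth_on_def by (rule bspec)

lemma smooth_on_subset:
  assumes "smooth_on S f" "T \<subseteq> S"
  shows "smooth_on T f"
  unfolding smooth_on_def
proof
  fix x assume "x \<in> T"
  then have "x \<in> S" using assms(2) by blast
  then obtain U F where "open U" "x \<in> U" "\<forall>k. Ck_on k U F" "\<forall>y\<in>S \<inter> U. F y = f y"
    using smooth_onD[OF assms(1)] by blast
  then show "\<exists>U F. open U \<and> x \<in> U \<and> (\<forall>k. Ck_on k U F) \<and> (\<forall>y\<in>T \<inter> U. F y = f y)"
    using assms(2) by (intro exI[of _ U] exI[of _ F]) auto
qed

lemma smooth_on_cong:
  assumes "smooth_on S f" "\<And>x. x \<in> S \<Longrightarrow> f x = g x"
  shows "smooth_on S g"
  unfolding smooth_on_def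
proof
  fix x assume "x \<in> S"
  then obtain U F where "open U" "x \<in> U" "\<forall>k. Ck_on k U F" "\<forall>y\<in>S \<inter> U. F y = f y"
    using smooth_onD[OF assms(1)] by blast
  then show "\<exists>U F. open U \<and> x \<in> U \<and> (\<forall>k. Ck_on k U F) \<and> (\<forall>y\<in>S \<inter> U. F y = g y)"
    using assms(2) by (intro exI[of _ U] exI[of _ F]) auto
qed

lemma smooth_on_local:
  assumes "\<And>x. x \<in> S \<Longrightarrow> \<exists>T. openin (top_of_set S) T \<and> x \<in> T \<and> smooth_on T f"
  shows "smooth_on S f"
  unfolding smooth_on_def
proof
  fix x assume "x \<in> S"
  then obtain T where T: "openin (top_of_set S) T" "x \<in> T" "smooth_on T f" using assms by blast
  then obtain V where V: "open V" "T = S \<inter> V" by (auto simp: openin_open)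
  obtain U F where "open U" "x \<in> U" "\<forall>k. Ck_on k U F" "\<forall>y\<in>T \<inter> U. F y = f y"
    using smooth_onD[OF T(3,2)] by blast
  then show "\<exists>U F. open U \<and> x \<in> U \<and> (\<forall>k. Ck_on k U F) \<and> (\<forall>y\<in>S \<inter> U. F y = f y)"
    using V T(2) by (intro exI[of _ "U \<inter> V"] exI[of _ F]) (auto intro: Ck_on_subset)
qed

lemma smooth_on_compose:
  assumes f: "smooth_on S f" and h: "smooth_on T h" and sub: "f ` S \<subseteq> T"
  shows "smooth_on S (h \<circ> f)"
  unfolding smooth_on_def
proof
  fix x assume x: "x \<in> S"
  obtain U F where U: "open U" "x \<in> U" "\<forall>k. Ck_on k U F" "\<forall>y\<in>S \<inter> U. F y = f y"
    using smooth_onD[OF f x] by blast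
  have "f x \<in> T" using sub x by blast
  obtain V H where V: "open V" "f x \<in> V" "\<forall>k. Ck_on k V H" "\<forall>y\<in>T \<inter> V. H y = h y"
    using smooth_onD[OF h \<open>f x \<in> T\<close>] by blast
  define U' where "U' = U \<inter> F -` V"
  have "continuous_on U F" using U(3) Ck_on_imp_continuous_on by blast
  then have oU': "open U'" unfolding U'_def using U(1) V(1) by (simp add: continuous_on_open_vimage Int_commute)
  have "Ck_on k U' (\<lambda>x. H (F x))" for k
    by (rule Ck_on_compose[OF oU' V(1) _ Ck_on_subset[OF U(3)[rule_format]] V(3)[rule_format]]) (auto simp: U'_def)
  moreover have "\<forall>y\<in>S \<inter> U'. H (F y) = (h \<circ> f) y"
  proof
    fix y assume y: "y \<in> S \<inter> U'"
    then have "F y = f y" "F y \<in> V" "f y \<in> T" using U(4) sub by (auto simp: U'_def)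
    then show "H (F y) = (h \<circ> f) y" using V(4) by simp
  qed
  moreover have "x \<in> U'" using U V x by (auto simp: U'_def)
  ultimately show "\<exists>U F. open U \<and> x \<in> U \<and> (\<forall>k. Ck_on k U F) \<and> (\<forall>y\<in>S \<inter> U. F y = (h \<circ> f) y)"
    using oU' by blast
qed

lemma smooth_on_Pair:
  assumes f: "smooth_on S f" and h: "smooth_on S h"
  shows "smooth_on S (\<lambda>x. (f x, h x))"
  unfolding smooth_on_def
proof
  fix x assume x: "x \<in> S"
  obtain U F where U: "open U" "x \<in> U" "\<forall>k. Ck_on k U F" "\<forall>y\<in>S \<inter> U. F y = f y"
    using smooth_onD[OF f x] by blast
  obtain V H where V: "open V" "x \<in> V" "\<forall>k. Ck_on k V H" "\<forall>y\<in>S \<inter> V. H y = h y"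
    using smooth_onD[OF h x] by blast
  have "Ck_on k (U \<inter> V) (\<lambda>x. (F x, H x))" for k
    using U(1,3) V(1,3) by (intro Ck_on_Pair) (auto intro: Ck_on_subset)
  then show "\<exists>U F. open U \<and> x \<in> U \<and> (\<forall>k. Ck_on k U F) \<and> (\<forall>y\<in>S \<inter> U. F y = (f y, h y))"
    using U V by (intro exI[of _ "U \<inter> V"] exI[of _ "\<lambda>x. (F x, H x)"]) auto
qed

lemma smooth_on_has_derivative:
  assumes "smooth_on S f" "x \<in> S"
  shows "\<exists>D. (f has_derivative D) (at x within S)"
proof -
  obtain U F where U: "open U" "x \<in> U" "\<forall>k. Ck_on k U F" "\<forall>y\<in>S \<inter> U. F y = f y"
    using smooth_onD[OF assms] by blast
  have "(F has_derivative frechet_derivative F (at x)) (at x within S)"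
    using Ck_on_has_derivative[OF U(3)[rule_format] U(2)] has_derivative_at_withinI by blast
  moreover have "\<forall>\<^sub>F y in at x within S. F y = f y"
    unfolding eventually_at_topological using U by (intro exI[of _ U]) auto
  ultimately have "(f has_derivative frechet_derivative F (at x)) (at x within S)"
    by (rule has_derivative_transform_eventually) (use U(2,4) assms(2) in auto)
  then show ?thesis by (intro exI[of _ "frechet_derivative F (at x)"])
qed

lemma smooth_on_imp_continuous_on:
  assumes "smooth_on S f"
  shows "continuous_on S f"
  unfolding continuous_on_eq_continuous_within
proof
  fix x assume "x \<in> S"
  from smooth_on_has_derivative[OF assms this]
  show "continuous (at x within S) f"
    by (elim exE) (rule has_derivative_continuous)
qed

lemma smooth_on_const: "smooth_on S (\<lambda>x. c)"
  by (rule smooth_onI_open[of UNIV]) (auto intro: Ck_on_const)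


section \<open>Directional derivatives on open subsets of linear subspaces\<close>

lemma has_vector_derivative_eventually_cong:
  assumes "(h has_vector_derivative d) (at t)" "\<forall>\<^sub>F s in nhds t. h s = k s"
  shows "(k has_vector_derivative d) (at t)"
proof -
  obtain T where "open T" "t \<in> T" "\<And>s. s \<in> T \<Longrightarrow> h s = k s"
    using assms(2) unfolding eventually_nhds by blast
  then show ?thesis using has_vector_derivative_transform_within_open assms(1) by blast
qed

lemma path_chain_within:
  assumes D: "(G has_derivative D) (at y within A)"
    and k: "(k has_vector_derivative w) (at t)" "k t = y" "\<forall>\<^sub>F s in nhds t. k s \<in> A"
  shows "((\<lambda>s. G (k s)) has_vector_derivative D w) (at t)"
proof -
  obtain T where T: "open T" "t \<in> T" "\<And>s. s \<in> T \<Longrightarrow> k s \<in> A"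
    using k(3) unfolding eventually_nhds by blast
  have "(k has_derivative (\<lambda>s. s *\<^sub>R w)) (at t within T)"
    using k(1) has_derivative_at_withinI unfolding has_vector_derivative_def by blast
  moreover have "(G has_derivative D) (at (k t) within k ` T)"
    unfolding k(2) by (rule has_derivative_subset[OF D]) (use T(3) in blast)
  ultimately have "(G \<circ> k has_derivative D \<circ> (\<lambda>s. s *\<^sub>R w)) (at t within T)"
    by (rule diff_chain_within)
  then have "(G \<circ> k has_derivative D \<circ> (\<lambda>s. s *\<^sub>R w)) (at t)"
    using at_within_open[OF T(2,1)] by simp
  moreover have "D \<circ> (\<lambda>s. s *\<^sub>R w) = (\<lambda>s. s *\<^sub>R D w)"
    using has_derivative_linear[OF D] by (auto simp: linear_scale)
  ultimately show ?thesis
    unfolding has_vector_derivative_def by (simp add: o_def)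
qed

lemma eventually_in_relatively_open:
  assumes "openin (top_of_set V) A" "k t \<in> A" "isCont k t" "\<forall>\<^sub>F s in nhds t. k s \<in> V"
  shows "\<forall>\<^sub>F s in nhds t. k s \<in> A"
proof -
  obtain T where T: "open T" "A = V \<inter> T" using assms(1) by (auto simp: openin_open)
  have "\<forall>\<^sub>F s in at t. k s \<in> T"
    using assms(2,3) T by (auto simp: isCont_def tendsto_def)
  then have "\<forall>\<^sub>F s in nhds t. k s \<in> T"
    using assms(2) T by (auto simp: eventually_at_filter elim: eventually_mono)
  then show ?thesis
    using assms(4) by eventually_elim (use T in auto)
qed

text \<open>Straight lines through \<open>y\<close> in a direction of \<open>V\<close> stay in \<open>A\<close> for a short time. So directional
  derivatives only see the values on \<open>A\<close> and agree with the differential of any local extension.\<close>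

lemma smooth_on_dir_deriv:
  assumes G: "smooth_on A G" and A: "openin (top_of_set V) A" "subspace V" "y \<in> A"
  shows "\<exists>D. (G has_derivative D) (at y within A) \<and> (\<forall>w\<in>V. dir_deriv G y w = D w)"
proof -
  obtain D where D: "(G has_derivative D) (at y within A)"
    using smooth_on_has_derivative[OF G A(3)] by (elim exE)
  have yV: "y \<in> V" using A openin_imp_subset by blast
  have "dir_deriv G y w = D w" if "w \<in> V" for w
  proof -
    have V: "y + s *\<^sub>R w \<in> V" for s
      using that yV A(2) by (simp add: subspace_add subspace_scale)
    have "((\<lambda>s. y + s *\<^sub>R w) has_vector_derivative w) (at 0)"
      by (auto intro!: derivative_eq_intros simp: has_vector_derivative_def)
    moreover have "\<forall>\<^sub>F s in nhds 0. y + s *\<^sub>R w \<in> A"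
      by (rule eventually_in_relatively_open[OF A(1)]) (use A(3) V in auto)
    ultimately have "((\<lambda>s. G (y + s *\<^sub>R w)) has_vector_derivative D w) (at 0)"
      by (intro path_chain_within[OF D]) auto
    then show ?thesis
      unfolding dir_deriv_def by (rule vector_derivative_at)
  qed
  with D show ?thesis by (intro exI[of _ D]) auto
qed

lemma dir_deriv_linear:
  assumes "smooth_on A G" "openin (top_of_set V) A" "subspace V" "y \<in> A" "u \<in> V" "w \<in> V"
  shows "dir_deriv G y (a *\<^sub>R u + b *\<^sub>R w) = a *\<^sub>R dir_deriv G y u + b *\<^sub>R dir_deriv G y w"
proof -
  obtain D where D: "(G has_derivative D) (at y within A)" "\<forall>w\<in>V. dir_deriv G y w = D w"
    using smooth_on_dir_deriv[OF assms(1-4)] by (elim exE conjE)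
  have "a *\<^sub>R u + b *\<^sub>R w \<in> V"
    using assms by (simp add: subspace_add subspace_scale)
  moreover have "linear D" using D(1) by (rule has_derivative_linear)
  ultimately show ?thesis using D(2) assms(5,6) by (simp add: linear_add linear_scale)
qed

text \<open>Every functional that vanishes on \<open>V\<close> is constant along the curve.\<close>

lemma vector_derivative_in_subspace:
  fixes k :: "real \<Rightarrow> 'e::euclidean_space"
  assumes k: "(k has_vector_derivative w) (at t)" "\<forall>\<^sub>F s in nhds t. k s \<in> V" and V: "subspace V"
  shows "w \<in> V"
proof -
  have "w \<bullet> u = 0" if u: "u \<in> V\<^sup>\<bottom>" for u
  proof -
    have "((\<lambda>s. k s \<bullet> u) has_vector_derivative w \<bullet> u) (at t)"
      using bounded_linear.has_vector_derivative[OF bounded_linear_inner_left k(1)] .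
    moreover have "((\<lambda>s. k s \<bullet> u) has_vector_derivative 0) (at t)"
    proof -
      have ev: "\<forall>\<^sub>F s in nhds t. k s \<bullet> u = 0"
        using k(2) by eventually_elim (use u in \<open>auto simp: orthogonal_comp_def orthogonal_def inner_commute\<close>)
      show ?thesis
        by (rule has_vector_derivative_eventually_cong[of "\<lambda>_. 0"]) (use ev in \<open>auto elim: eventually_mono\<close>)
    qed
    ultimately show ?thesis by (rule vector_derivative_unique_at)
  qed
  then have "w \<in> (V\<^sup>\<bottom>)\<^sup>\<bottom>"
    by (auto simp: orthogonal_comp_def orthogonal_def inner_commute)
  then show ?thesis using orthogonal_comp_self[OF V] by simp
qed

text \<open>Directional derivatives are defined along straight lines. Being values of one linear map, they
  also give the derivative along curves.\<close>

lemma path_chain: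
  assumes G: "smooth_on A G" and A: "openin (top_of_set V) A" "subspace V" "y \<in> A"
    and k: "(k has_vector_derivative w) (at t)" "k t = y" "\<forall>\<^sub>F s in nhds t. k s \<in> A"
  shows "w \<in> V" "((\<lambda>s. G (k s)) has_vector_derivative dir_deriv G y w) (at t)"
proof -
  have "\<forall>\<^sub>F s in nhds t. k s \<in> V"
    using k(3) by eventually_elim (use A(1) openin_imp_subset in blast)
  then show w: "w \<in> V" using vector_derivative_in_subspace k(1) A(2) by blast
  obtain D where D: "(G has_derivative D) (at y within A)" "\<forall>w\<in>V. dir_deriv G y w = D w"
    using smooth_on_dir_deriv[OF G A] by (elim exE conjE)
  show "((\<lambda>s. G (k s)) has_vector_derivative dir_deriv G y w) (at t)"
    using path_chain_within[OF D(1) k] D(2) w by simp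
qed

lemma smooth_on_real_has_vector_derivative:
  fixes h :: "real \<Rightarrow> 'c::euclidean_space"
  assumes "smooth_on J h" "open J" "t \<in> J"
  shows "(h has_vector_derivative vector_derivative h (at t)) (at t)"
proof -
  obtain D where "(h has_derivative D) (at t within J)"
    using smooth_on_has_derivative[OF assms(1,3)] by (elim exE)
  then have "(h has_derivative D) (at t)" using at_within_open[OF assms(3,2)] by simp
  then have "h differentiable (at t)" by (auto simp: differentiable_def)
  then show ?thesis by (simp add: vector_derivative_works)
qed


section \<open>Charts\<close>

lemma
  assumes "is_chart M c"
  shows is_chart_openin: "openin (mtop M) (cdom c)"
    and is_chart_subspace: "subspace (cspace c)"
    and is_chart_openin_image: "openin (top_of_set (cspace c)) (cmap c ` cdom c)"
    and is_chart_homeomorphic: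
      "homeomorphic_map (subtopology (mtop M) (cdom c)) (top_of_set (cmap c ` cdom c)) (cmap c)"
  using assms by (auto simp: is_chart_def)

lemma is_chart_subset: "is_chart M c \<Longrightarrow> cdom c \<subseteq> pts M"
  by (simp add: is_chart_def openin_subset)

lemma is_chart_inj_on: "is_chart M c \<Longrightarrow> inj_on (cmap c) (cdom c)"
  using is_chart_homeomorphic[of M c] is_chart_subset[of M c]
  by (simp add: homeomorphic_eq_everything_map Int_absorb1)

lemma cinv_cmap [simp]: "is_chart M c \<Longrightarrow> x \<in> cdom c \<Longrightarrow> cinv c (cmap c x) = x"
  unfolding cinv_def using is_chart_inj_on inv_into_f_f by fast

lemma cmap_cinv: "y \<in> cmap c ` cdom c \<Longrightarrow> cmap c (cinv c y) = y"
  and cinv_in: "y \<in> cmap c ` cdom c \<Longrightarrow> cinv c y \<in> cdom c"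
  unfolding cinv_def by (simp_all add: f_inv_into_f inv_into_into)

lemma cmap_continuous:
  "is_chart M c \<Longrightarrow> continuous_map (subtopology (mtop M) (cdom c)) euclidean (cmap c)"
  using is_chart_homeomorphic[of M c] continuous_map_in_subtopology
  by (metis homeomorphic_imp_continuous_map)

lemma cinv_continuous:
  assumes c: "is_chart M c"
  shows "continuous_map (top_of_set (cmap c ` cdom c)) (mtop M) (cinv c)"
proof -
  obtain h where h: "homeomorphic_maps (subtopology (mtop M) (cdom c)) (top_of_set (cmap c ` cdom c)) (cmap c) h"
    using is_chart_homeomorphic[OF c] homeomorphic_map_maps by blast
  have "h y = cinv c y" if "y \<in> topspace (top_of_set (cmap c ` cdom c))" for y
  proof -
    have "h y \<in> cdom c" "cmap c (h y) = y"
      using h that is_chart_subset[OF c]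
      by (auto simp: homeomorphic_maps_def continuous_map_def)
    then show ?thesis using cinv_cmap[OF c] by metis
  qed
  then have "continuous_map (top_of_set (cmap c ` cdom c)) (subtopology (mtop M) (cdom c)) (cinv c)"
    using h continuous_map_eq unfolding homeomorphic_maps_def by blast
  then show ?thesis by (simp add: continuous_map_in_subtopology)
qed

lemma openin_cmap_image:
  assumes c: "is_chart M c" and U: "openin (mtop M) U" "U \<subseteq> cdom c"
  shows "openin (top_of_set (cspace c)) (cmap c ` U)"
proof -
  have "openin (top_of_set (cmap c ` cdom c)) (cmap c ` U)"
    using is_chart_homeomorphic[OF c] U
    by (metis homeomorphic_imp_open_map open_map_def openin_subset_topspace_eq openin_subtopology_Int2
        inf.absorb_iff2)
  then show ?thesis using is_chart_openin_image[OF c] openin_trans by blast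
qed

lemma max_atlas_is_chart: "c \<in> max_atlas M \<Longrightarrow> is_chart M c"
  by (simp add: max_atlas_def)

locale smooth_mfd =
  fixes M :: "('a, 'e::euclidean_space) manifold"
  assumes mfd: "smooth_manifold M"
begin

lemma atlas_subset_max_atlas: "atlas M \<subseteq> max_atlas M"
  using mfd by (auto simp: smooth_manifold_def max_atlas_def)

lemma atlas_is_chart: "c \<in> atlas M \<Longrightarrow> is_chart M c"
  using mfd by (simp add: smooth_manifold_def)

lemma chart_at:
  assumes "x \<in> pts M"
  obtains c where "c \<in> atlas M" "x \<in> cdom c"
proof -
  have "x \<in> (\<Union>c\<in>atlas M. cdom c)" using assms mfd by (simp add: smooth_manifold_def)
  then show ?thesis using that by blast
qed

lemma transition_smooth:
  assumes "c \<in> max_atlas M \<and> d \<in> atlas M \<or> c \<in> atlas M \<and> d \<in> max_atlas M"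
  shows "smooth_on (cmap c ` (cdom c \<inter> cdom d)) (cmap d \<circ> cinv c)"
  using assms by (auto simp: max_atlas_def smooth_transition_def)

lemma transition_domain:
  assumes "c \<in> max_atlas M" "d \<in> max_atlas M"
  shows "openin (top_of_set (cspace c)) (cmap c ` (cdom c \<inter> cdom d))"
  using assms by (intro openin_cmap_image[where M=M] openin_Int is_chart_openin max_atlas_is_chart) auto


section \<open>Smooth paths and their velocities\<close>

lemma path_in_pts: "smooth_path_on M I \<gamma> \<Longrightarrow> t \<in> I \<Longrightarrow> \<gamma> t \<in> pts M"
  by (auto simp: smooth_path_on_def continuous_map_def)

lemma smooth_path_on_subset:
  assumes "smooth_path_on M I \<gamma>" "J \<subseteq> I"
  shows "smooth_path_on M J \<gamma>"
proof -
  have "continuous_map (top_of_set J) (mtop M) \<gamma>"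
    using assms continuous_map_from_subtopology_mono unfolding smooth_path_on_def by blast
  moreover have "smooth_on {t\<in>J. \<gamma> t \<in> cdom c} (cmap c \<circ> \<gamma>)" if "c \<in> atlas M" for c
    by (rule smooth_on_subset[of "{t\<in>I. \<gamma> t \<in> cdom c}"])
      (use assms that in \<open>auto simp: smooth_path_on_def\<close>)
  ultimately show ?thesis by (auto simp: smooth_path_on_def)
qed

lemma openin_path_preimage:
  assumes "continuous_map (top_of_set I) (mtop M) \<gamma>" "openin (mtop M) U"
  shows "openin (top_of_set I) {t\<in>I. \<gamma> t \<in> U}"
  using openin_continuous_map_preimage[OF assms] by simp

lemma smooth_on_change_chart:
  assumes sm: "smooth_on J (cmap c \<circ> \<gamma>)" "\<gamma> ` J \<subseteq> cdom c \<inter> cdom d"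
    and cd: "c \<in> max_atlas M \<and> d \<in> atlas M \<or> c \<in> atlas M \<and> d \<in> max_atlas M"
  shows "smooth_on J (cmap d \<circ> \<gamma>)"
proof (rule smooth_on_cong)
  show "smooth_on J ((cmap d \<circ> cinv c) \<circ> (cmap c \<circ> \<gamma>))"
    by (rule smooth_on_compose[OF sm(1) transition_smooth[OF cd]]) (use sm(2) in auto)
  have "is_chart M c" using cd max_atlas_is_chart atlas_is_chart by blast
  then show "((cmap d \<circ> cinv c) \<circ> (cmap c \<circ> \<gamma>)) s = (cmap d \<circ> \<gamma>) s" if "s \<in> J" for s
    using that sm(2) cinv_cmap by auto
qed

text \<open>One chart of the maximal atlas around each time suffices, since the transitions are smooth.\<close>

lemma smooth_path_onI:
  assumes cont: "continuous_map (top_of_set I) (mtop M) \<gamma>"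
    and loc: "\<And>t. t \<in> I \<Longrightarrow> \<exists>c\<in>max_atlas M. \<exists>J. openin (top_of_set I) J \<and> t \<in> J \<and>
      \<gamma> ` J \<subseteq> cdom c \<and> smooth_on J (cmap c \<circ> \<gamma>)"
  shows "smooth_path_on M I \<gamma>"
  unfolding smooth_path_on_def
proof (intro conjI ballI cont)
  fix d assume d: "d \<in> atlas M"
  show "smooth_on {t\<in>I. \<gamma> t \<in> cdom d} (cmap d \<circ> \<gamma>)"
  proof (rule smooth_on_local)
    fix t assume t: "t \<in> {t\<in>I. \<gamma> t \<in> cdom d}"
    then obtain c J where c: "c \<in> max_atlas M" and J: "openin (top_of_set I) J" "t \<in> J"
      "\<gamma> ` J \<subseteq> cdom c" "smooth_on J (cmap c \<circ> \<gamma>)"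
      using loc by blast
    define T where "T = J \<inter> {t\<in>I. \<gamma> t \<in> cdom d}"
    have "openin (top_of_set {t\<in>I. \<gamma> t \<in> cdom d}) T"
      using J(1) unfolding T_def openin_open by auto
    moreover have "smooth_on T (cmap d \<circ> \<gamma>)"
      by (rule smooth_on_change_chart[OF smooth_on_subset[OF J(4)]]) (use c d J(3) T_def in auto)
    ultimately show "\<exists>T. openin (top_of_set {t\<in>I. \<gamma> t \<in> cdom d}) T \<and> t \<in> T \<and> smooth_on T (cmap d \<circ> \<gamma>)"
      using t J(2) by (intro exI[of _ T]) (auto simp: T_def)
  qed
qed

text \<open>Slice charts only belong to the maximal atlas; this lemma makes paths smooth in them.\<close>

lemma smooth_path_on_chart:
  assumes g: "smooth_path_on M I \<gamma>" and c: "c \<in> max_atlas M"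
  shows "smooth_on {t\<in>I. \<gamma> t \<in> cdom c} (cmap c \<circ> \<gamma>)"
proof (rule smooth_on_local)
  fix t assume t: "t \<in> {t\<in>I. \<gamma> t \<in> cdom c}"
  obtain d where d: "d \<in> atlas M" "\<gamma> t \<in> cdom d"
    using chart_at path_in_pts[OF g] t by blast
  define T where "T = {t\<in>I. \<gamma> t \<in> cdom d} \<inter> {t\<in>I. \<gamma> t \<in> cdom c}"
  have "openin (top_of_set I) {t\<in>I. \<gamma> t \<in> cdom d}"
    using g is_chart_openin[OF atlas_is_chart[OF d(1)]]
    by (intro openin_path_preimage) (auto simp: smooth_path_on_def)
  then have "openin (top_of_set {t\<in>I. \<gamma> t \<in> cdom c}) T"
    unfolding T_def openin_open by auto
  moreover have "smooth_on T (cmap c \<circ> \<gamma>)"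
    by (rule smooth_on_change_chart[OF smooth_on_subset[of "{t\<in>I. \<gamma> t \<in> cdom d}"]])
      (use g c d T_def in \<open>auto simp: smooth_path_on_def\<close>)
  ultimately show "\<exists>T. openin (top_of_set {t\<in>I. \<gamma> t \<in> cdom c}) T \<and> t \<in> T \<and> smooth_on T (cmap c \<circ> \<gamma>)"
    using t d by (intro exI[of _ T]) (auto simp: T_def)
qed

lemma smooth_path_eventually_in:
  assumes g: "smooth_path_on M I \<gamma>" "open I" "t \<in> I" and U: "openin (mtop M) U" "\<gamma> t \<in> U"
  shows "\<forall>\<^sub>F s in nhds t. \<gamma> s \<in> U"
proof -
  have "openin (top_of_set I) {s\<in>I. \<gamma> s \<in> U}"
    using openin_path_preimage U(1) g(1) by (auto simp: smooth_path_on_def)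
  then have "open {s\<in>I. \<gamma> s \<in> U}" using g(2) openin_open_eq by blast
  then show ?thesis
    using g(3) U(2) unfolding eventually_nhds by (intro exI[of _ "{s\<in>I. \<gamma> s \<in> U}"]) auto
qed

lemma smooth_path_has_vector_derivative:
  assumes g: "smooth_path_on M I \<gamma>" "open I" "t \<in> I" and c: "c \<in> max_atlas M" "\<gamma> t \<in> cdom c"
  shows "((\<lambda>s. cmap c (\<gamma> s)) has_vector_derivative vector_derivative (cmap c \<circ> \<gamma>) (at t)) (at t)"
proof -
  have "openin (top_of_set I) {s\<in>I. \<gamma> s \<in> cdom c}"
    using g(1) is_chart_openin[OF max_atlas_is_chart[OF c(1)]]
    by (intro openin_path_preimage) (auto simp: smooth_path_on_def)
  then have "open {s\<in>I. \<gamma> s \<in> cdom c}" using g(2) openin_open_eq by blast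
  from smooth_on_real_has_vector_derivative[OF smooth_path_on_chart[OF g(1) c(1)] this]
  show ?thesis using g(3) c(2) by (simp add: o_def)
qed

lemma velocity_has_vector_derivative:
  assumes g: "smooth_path_on M I \<gamma>" "open I" "t \<in> I" and c: "c \<in> atlas M" "\<gamma> t \<in> cdom c"
  shows "((\<lambda>s. cmap c (\<gamma> s)) has_vector_derivative velocity M \<gamma> t c) (at t)"
  using smooth_path_has_vector_derivative[OF g] c atlas_subset_max_atlas
  by (auto simp: velocity_def)

text \<open>The common source of the transformation rule for velocities and of the derivative of a
  function along a path. The set \<open>U\<close> allows \<open>G\<close> to be a second chart with a different domain.\<close>

lemma path_chain_chart:
  assumes g: "smooth_path_on M I \<gamma>" "open I" "t \<in> I" and c: "c \<in> max_atlas M"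
    and U: "openin (mtop M) U" "U \<subseteq> cdom c" "\<gamma> t \<in> U" and G: "smooth_on (cmap c ` U) (G \<circ> cinv c)"
  shows "vector_derivative (cmap c \<circ> \<gamma>) (at t) \<in> cspace c"
    "((\<lambda>s. G (\<gamma> s)) has_vector_derivative
      dir_deriv (G \<circ> cinv c) (cmap c (\<gamma> t)) (vector_derivative (cmap c \<circ> \<gamma>) (at t))) (at t)"
proof -
  note ch = max_atlas_is_chart[OF c]
  have ev: "\<forall>\<^sub>F s in nhds t. \<gamma> s \<in> U" using smooth_path_eventually_in[OF g U(1,3)] .
  have k: "((\<lambda>s. cmap c (\<gamma> s)) has_vector_derivative vector_derivative (cmap c \<circ> \<gamma>) (at t)) (at t)"
    using smooth_path_has_vector_derivative[OF g c] U by blast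
  have ev': "\<forall>\<^sub>F s in nhds t. cmap c (\<gamma> s) \<in> cmap c ` U"
    using ev by eventually_elim auto
  note pc = path_chain[OF G openin_cmap_image[OF ch U(1,2)] is_chart_subspace[OF ch] _ k refl ev']
  show "vector_derivative (cmap c \<circ> \<gamma>) (at t) \<in> cspace c" using pc(1) U(3) by blast
  have eq: "\<forall>\<^sub>F s in nhds t. (G \<circ> cinv c) (cmap c (\<gamma> s)) = G (\<gamma> s)"
    using ev by eventually_elim (use U(2) cinv_cmap[OF ch] in auto)
  show "((\<lambda>s. G (\<gamma> s)) has_vector_derivative
      dir_deriv (G \<circ> cinv c) (cmap c (\<gamma> t)) (vector_derivative (cmap c \<circ> \<gamma>) (at t))) (at t)"
    using has_vector_derivative_eventually_cong[OF pc(2) eq] U(3) by blast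
qed

lemma velocity_in_cspace:
  assumes "smooth_path_on M I \<gamma>" "open I" "t \<in> I" "c \<in> atlas M" "\<gamma> t \<in> cdom c"
  shows "velocity M \<gamma> t c \<in> cspace c"
  using path_chain_chart(1)[OF assms(1-3), of c "cdom c" "\<lambda>_. 0::real"] assms(4,5)
    atlas_subset_max_atlas is_chart_openin[OF atlas_is_chart] smooth_on_const
  by (auto simp: velocity_def o_def)

lemma velocity_transform:
  assumes g: "smooth_path_on M I \<gamma>" "open I" "t \<in> I" and c: "c \<in> atlas M" "\<gamma> t \<in> cdom c"
    and d: "d \<in> atlas M" "\<gamma> t \<in> cdom d"
  shows "velocity M \<gamma> t d = dir_deriv (cmap d \<circ> cinv c) (cmap c (\<gamma> t)) (velocity M \<gamma> t c)"
proof -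
  have "((\<lambda>s. cmap d (\<gamma> s)) has_vector_derivative
      dir_deriv (cmap d \<circ> cinv c) (cmap c (\<gamma> t)) (vector_derivative (cmap c \<circ> \<gamma>) (at t))) (at t)"
    using c d atlas_subset_max_atlas
    by (intro path_chain_chart(2)[OF g, of _ "cdom c \<inter> cdom d"] transition_smooth openin_Int
        is_chart_openin[OF atlas_is_chart]) auto
  then show ?thesis
    using c d by (simp add: velocity_def o_def vector_derivative_at)
qed

lemma velocity_in_tangent_space:
  assumes "smooth_path_on M I \<gamma>" "open I" "t \<in> I"
  shows "velocity M \<gamma> t \<in> tangent_space M (\<gamma> t)"
  unfolding tangent_space_def mem_Collect_eq
proof (intro conjI ballI allI impI)
  show "velocity M \<gamma> t c = 0" if "\<not> (c \<in> atlas M \<and> \<gamma> t \<in> cdom c)" for c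
    using that by (auto simp: velocity_def)
qed (use velocity_in_cspace[OF assms] velocity_transform[OF assms] in blast)+

lemma velocity_eq_coord_vector:
  assumes "smooth_path_on M I \<gamma>" "open I" "t \<in> I" "c \<in> atlas M" "\<gamma> t \<in> cdom c"
  shows "velocity M \<gamma> t = coord_vector M c (velocity M \<gamma> t c) (\<gamma> t)"
proof
  fix d
  show "velocity M \<gamma> t d = coord_vector M c (velocity M \<gamma> t c) (\<gamma> t) d"
  proof (cases "d \<in> atlas M \<and> \<gamma> t \<in> cdom d")
    case True
    then show ?thesis using velocity_transform[OF assms] by (simp add: coord_vector_def)
  next
    case False
    then have "velocity M \<gamma> t d = 0" "\<And>u. coord_vector M c u (\<gamma> t) d = 0"
      by (auto simp: velocity_def coord_vector_def)
    then show ?thesis by simp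
  qed
qed

lemma coord_vector_linear:
  assumes c: "c \<in> atlas M" "x \<in> cdom c" and uw: "u \<in> cspace c" "w \<in> cspace c"
  shows "coord_vector M c (a *\<^sub>R u + b *\<^sub>R w) x = (\<lambda>d. a *\<^sub>R coord_vector M c u x d + b *\<^sub>R coord_vector M c w x d)"
proof
  fix d
  have "dir_deriv (cmap d \<circ> cinv c) (cmap c x) (a *\<^sub>R u + b *\<^sub>R w) =
      a *\<^sub>R dir_deriv (cmap d \<circ> cinv c) (cmap c x) u + b *\<^sub>R dir_deriv (cmap d \<circ> cinv c) (cmap c x) w"
    if "d \<in> atlas M" "x \<in> cdom d"
    using c that atlas_subset_max_atlas
    by (intro dir_deriv_linear[OF transition_smooth transition_domain is_chart_subspace[OF atlas_is_chart] _ uw]) auto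
  then show "coord_vector M c (a *\<^sub>R u + b *\<^sub>R w) x d = a *\<^sub>R coord_vector M c u x d + b *\<^sub>R coord_vector M c w x d"
    by (simp add: coord_vector_def)
qed

text \<open>Coordinate vectors are velocities, hence facts about velocities such as
  \<open>velocity_in_tangent_space\<close> apply to them.\<close>

lemma coordinate_line:
  assumes c: "c \<in> atlas M" "x \<in> cdom c" and u: "u \<in> cspace c"
  defines "k \<equiv> \<lambda>s. cinv c (cmap c x + s *\<^sub>R u)"
  shows "\<exists>I. open I \<and> 0 \<in> I \<and> smooth_path_on M I k" "k 0 = x" "velocity M k 0 = coord_vector M c u x"
proof -
  note ch = atlas_is_chart[OF c(1)]
  let ?A = "cmap c ` cdom c"
  show k0: "k 0 = x" by (simp add: k_def cinv_cmap[OF ch c(2)])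
  show "velocity M k 0 = coord_vector M c u x"
    by (rule ext) (auto simp: velocity_def coord_vector_def k0 dir_deriv_def k_def o_def cinv_cmap[OF ch c(2)])
  have V: "cmap c x + s *\<^sub>R u \<in> cspace c" for s
    using is_chart_subspace[OF ch] u c(2) openin_imp_subset[OF is_chart_openin_image[OF ch]]
    by (intro subspace_add subspace_scale) auto
  have "\<forall>\<^sub>F s in nhds 0. cmap c x + s *\<^sub>R u \<in> ?A"
    by (rule eventually_in_relatively_open[OF is_chart_openin_image[OF ch]]) (use c V in auto)
  then obtain I where I: "open I" "0 \<in> I" "\<And>s. s \<in> I \<Longrightarrow> cmap c x + s *\<^sub>R u \<in> ?A"
    unfolding eventually_nhds by blast
  have "smooth_path_on M I k"
  proof (rule smooth_path_onI)
    show "continuous_map (top_of_set I) (mtop M) k"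
      unfolding k_def
      by (rule continuous_map_compose[OF _ cinv_continuous[OF ch], unfolded o_def])
        (use I(3) in \<open>auto simp: continuous_map_in_subtopology intro!: continuous_intros\<close>)
    have "smooth_on I (cmap c \<circ> k)"
    proof (rule smooth_on_cong)
      show "smooth_on I (\<lambda>s. cmap c x + s *\<^sub>R u)"
        by (rule smooth_onI_open[OF open_UNIV])
          (auto intro!: Ck_on_add Ck_on_scaleR Ck_on_const Ck_on_id)
    qed (simp add: k_def cmap_cinv I(3))
    moreover have "k ` I \<subseteq> cdom c" using I(3) by (auto simp: k_def cinv_in)
    ultimately show "\<exists>c\<in>max_atlas M. \<exists>J. openin (top_of_set I) J \<and> t \<in> J \<and>
      k ` J \<subseteq> cdom c \<and> smooth_on J (cmap c \<circ> k)" if "t \<in> I" for t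
      using c atlas_subset_max_atlas that by (intro bexI[of _ c] exI[of _ I]) auto
  qed
  with I show "\<exists>I. open I \<and> 0 \<in> I \<and> smooth_path_on M I k" by blast
qed

lemma coord_vector_in_tangent_space:
  assumes "c \<in> atlas M" "x \<in> cdom c" "u \<in> cspace c"
  shows "coord_vector M c u x \<in> tangent_space M x"
  using coordinate_line[OF assms] velocity_in_tangent_space by metis

lemma
  fixes h :: "'a \<Rightarrow> 'c::euclidean_space"
  assumes h: "\<And>c. c \<in> atlas M \<Longrightarrow> smooth_on (cmap c ` cdom c) (h \<circ> cinv c)"
  shows function_along_path_has_vector_derivative: "smooth_path_on M I \<gamma> \<Longrightarrow> open I \<Longrightarrow> t \<in> I \<Longrightarrow>
      ((\<lambda>s. h (\<gamma> s)) has_vector_derivative differential M h (\<gamma> t) (velocity M \<gamma> t)) (at t)"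
    and smooth_on_function_along_path: "smooth_path_on M J \<gamma> \<Longrightarrow> smooth_on J (\<lambda>s. h (\<gamma> s))"
proof -
  assume g: "smooth_path_on M I \<gamma>" "open I" "t \<in> I"
  let ?c = "SOME c. c \<in> atlas M \<and> \<gamma> t \<in> cdom c"
  have c: "?c \<in> atlas M \<and> \<gamma> t \<in> cdom ?c"
    by (rule someI_ex) (use chart_at[OF path_in_pts[OF g(1,3)]] in blast)
  then show "((\<lambda>s. h (\<gamma> s)) has_vector_derivative differential M h (\<gamma> t) (velocity M \<gamma> t)) (at t)"
    using path_chain_chart(2)[OF g, of ?c "cdom ?c" h] h atlas_subset_max_atlas is_chart_openin[OF atlas_is_chart]
    by (auto simp: differential_def velocity_def Let_def)
next
  assume g: "smooth_path_on M J \<gamma>"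
  show "smooth_on J (\<lambda>s. h (\<gamma> s))"
  proof (rule smooth_on_local)
    fix t assume t: "t \<in> J"
    obtain c where c: "c \<in> atlas M" "\<gamma> t \<in> cdom c" using chart_at path_in_pts[OF g t] by blast
    have "smooth_on {s\<in>J. \<gamma> s \<in> cdom c} (\<lambda>s. h (\<gamma> s))"
    proof (rule smooth_on_cong)
      show "smooth_on {s\<in>J. \<gamma> s \<in> cdom c} ((h \<circ> cinv c) \<circ> (cmap c \<circ> \<gamma>))"
        by (rule smooth_on_compose[OF _ h[OF c(1)]]) (use g c in \<open>auto simp: smooth_path_on_def\<close>)
    qed (use cinv_cmap[OF atlas_is_chart[OF c(1)]] in auto)
    moreover have "openin (top_of_set J) {s\<in>J. \<gamma> s \<in> cdom c}"
      using openin_path_preimage is_chart_openin[OF atlas_is_chart[OF c(1)]] g by (auto simp: smooth_path_on_def)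
    ultimately show "\<exists>T. openin (top_of_set J) T \<and> t \<in> T \<and> smooth_on T (\<lambda>s. h (\<gamma> s))"
      using t c by (intro exI[of _ "{s\<in>J. \<gamma> s \<in> cdom c}"]) auto
  qed
qed

end


section \<open>Tangent spaces and symmetric bilinear forms\<close>

lemma
  assumes "\<xi> \<in> tangent_space M x"
  shows tangent_in_cspace: "c \<in> atlas M \<Longrightarrow> x \<in> cdom c \<Longrightarrow> \<xi> c \<in> cspace c"
    and tangent_transform: "c \<in> atlas M \<Longrightarrow> x \<in> cdom c \<Longrightarrow> d \<in> atlas M \<Longrightarrow> x \<in> cdom d \<Longrightarrow>
      \<xi> d = dir_deriv (cmap d \<circ> cinv c) (cmap c x) (\<xi> c)"
    and tangent_outside: "\<not> (c \<in> atlas M \<and> x \<in> cdom c) \<Longrightarrow> \<xi> c = 0"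
  using assms unfolding tangent_space_def mem_Collect_eq by blast+

context smooth_mfd
begin

lemma tangent_space_lincomb:
  assumes x: "\<xi> \<in> tangent_space M x" and z: "\<zeta> \<in> tangent_space M x"
  shows "(\<lambda>c. a *\<^sub>R \<xi> c + b *\<^sub>R \<zeta> c) \<in> tangent_space M x"
  unfolding tangent_space_def mem_Collect_eq
proof (intro conjI ballI allI impI)
  show "a *\<^sub>R \<xi> c + b *\<^sub>R \<zeta> c \<in> cspace c" if "c \<in> atlas M" "x \<in> cdom c" for c
    using is_chart_subspace[OF atlas_is_chart[OF that(1)]] that x z
    by (intro subspace_add subspace_scale tangent_in_cspace)
  show "a *\<^sub>R \<xi> d + b *\<^sub>R \<zeta> d = dir_deriv (cmap d \<circ> cinv c) (cmap c x) (a *\<^sub>R \<xi> c + b *\<^sub>R \<zeta> c)"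
    if cd: "c \<in> atlas M" "d \<in> atlas M" "x \<in> cdom c \<and> x \<in> cdom d" for c d
  proof -
    have "\<xi> c \<in> cspace c" "\<zeta> c \<in> cspace c"
      using cd tangent_in_cspace[OF x] tangent_in_cspace[OF z] by auto
    then have "dir_deriv (cmap d \<circ> cinv c) (cmap c x) (a *\<^sub>R \<xi> c + b *\<^sub>R \<zeta> c) =
        a *\<^sub>R dir_deriv (cmap d \<circ> cinv c) (cmap c x) (\<xi> c) + b *\<^sub>R dir_deriv (cmap d \<circ> cinv c) (cmap c x) (\<zeta> c)"
      using cd atlas_subset_max_atlas
      by (intro dir_deriv_linear[OF transition_smooth transition_domain is_chart_subspace[OF atlas_is_chart]]) auto
    moreover have "\<xi> d = dir_deriv (cmap d \<circ> cinv c) (cmap c x) (\<xi> c)"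
      using cd tangent_transform[OF x] by blast
    moreover have "\<zeta> d = dir_deriv (cmap d \<circ> cinv c) (cmap c x) (\<zeta> c)"
      using cd tangent_transform[OF z] by blast
    ultimately show ?thesis by simp
  qed
  show "a *\<^sub>R \<xi> c + b *\<^sub>R \<zeta> c = 0" if "\<not> (c \<in> atlas M \<and> x \<in> cdom c)" for c
    using tangent_outside[OF x that] tangent_outside[OF z that] by simp
qed

lemma constant_path: "x \<in> pts M \<Longrightarrow> smooth_path_on M I (\<lambda>s. x)"
  by (auto simp: smooth_path_on_def o_def smooth_on_const)

lemma velocity_constant_path: "velocity M (\<lambda>s. x) t = (\<lambda>c. 0)"
  by (auto simp: velocity_def o_def)

end

lemma pseudo_riemannian_square:
  assumes g: "pseudo_riemannian M g" and x: "x \<in> pts M" "\<xi> \<in> tangent_space M x" "\<zeta> \<in> tangent_space M x"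
    and T: "(\<lambda>c. a *\<^sub>R \<xi> c + b *\<^sub>R \<zeta> c) \<in> tangent_space M x" (is "?\<eta> \<in> _")
  shows "g x ?\<eta> ?\<eta> = a\<^sup>2 * g x \<xi> \<xi> + 2 * a * b * g x \<xi> \<zeta> + b\<^sup>2 * g x \<zeta> \<zeta>"
proof -
  have lin: "g x ?\<eta> \<theta> = a * g x \<xi> \<theta> + b * g x \<zeta> \<theta>" if "\<theta> \<in> tangent_space M x" for \<theta>
    using g x that unfolding pseudo_riemannian_def by blast
  have sym: "g x \<theta> \<theta>' = g x \<theta>' \<theta>" if "\<theta> \<in> tangent_space M x" "\<theta>' \<in> tangent_space M x" for \<theta> \<theta>'
    using g x that unfolding pseudo_riemannian_def by blast
  have "g x ?\<eta> ?\<eta> = a * g x ?\<eta> \<xi> + b * g x ?\<eta> \<zeta>"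
    using lin[OF T] sym[OF T x(2)] sym[OF T x(3)] by simp
  also have "\<dots> = a * (a * g x \<xi> \<xi> + b * g x \<zeta> \<xi>) + b * (a * g x \<xi> \<zeta> + b * g x \<zeta> \<zeta>)"
    by (simp add: lin x)
  finally show ?thesis
    using sym[OF x(2,3)] by (simp add: power2_eq_square algebra_simps)
qed


section \<open>Moving a path by the action\<close>

locale smooth_action = smooth_mfd M for M :: "('a, 'e::euclidean_space) manifold" +
  fixes m :: "real \<Rightarrow> 'a \<Rightarrow> 'a"
  assumes action: "free_smooth_action M m"
begin

lemma action_one: "x \<in> pts M \<Longrightarrow> m 1 x = x"
  and action_mult: "r > 0 \<Longrightarrow> s > 0 \<Longrightarrow> x \<in> pts M \<Longrightarrow> m r (m s x) = m (r * s) x"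
  using action by (auto simp: free_smooth_action_def)

lemma action_continuous:
  "continuous_map (prod_topology (top_of_set {0<..}) (mtop M)) (mtop M) (\<lambda>(r, x). m r x)"
  using action by (simp add: free_smooth_action_def smooth_map_def prod_manifold_def Rpos_def)

lemma action_in_pts:
  assumes "r > 0" "x \<in> pts M"
  shows "m r x \<in> pts M"
proof -
  have "(r, x) \<in> topspace (prod_topology (top_of_set {0<..}) (mtop M))" using assms by simp
  from funcset_mem[OF continuous_map_funspace[OF action_continuous] this] show ?thesis by simp
qed

text \<open>The domain of the action in coordinates: the point is read in the chart \<open>c\<close>, its image in \<open>d\<close>.\<close>

definition action_domain :: "('a, 'e) chart \<Rightarrow> ('a, 'e) chart \<Rightarrow> (real \<times> 'e) set" where
  "action_domain c d = {p. fst p > 0 \<and> snd p \<in> cmap c ` cdom c \<and> m (fst p) (cinv c (snd p)) \<in> cdom d}"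

lemma action_domain_open:
  assumes "c \<in> atlas M" "d \<in> atlas M"
  shows "openin (top_of_set (UNIV \<times> cspace c)) (action_domain c d)"
proof -
  note ch = atlas_is_chart[OF assms(1)] and dh = atlas_is_chart[OF assms(2)]
  let ?O = "cmap c ` cdom c"
  have "continuous_map (prod_topology (top_of_set {0<..}) (top_of_set ?O)) (mtop M)
      ((\<lambda>(r, x). m r x) \<circ> (\<lambda>p. (fst p, cinv c (snd p))))"
    by (intro continuous_map_compose[OF _ action_continuous] continuous_map_pairedI continuous_map_fst
        continuous_map_compose[OF continuous_map_snd cinv_continuous[OF ch], unfolded o_def])
  then have "continuous_map (top_of_set ({0<..} \<times> ?O)) (mtop M) (\<lambda>p. m (fst p) (cinv c (snd p)))"
    by (simp add: o_def prod_topology_subtopology_eu)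
  from openin_continuous_map_preimage[OF this is_chart_openin[OF dh]]
  have "openin (top_of_set ({0<..} \<times> ?O)) {p \<in> {0<..} \<times> ?O. m (fst p) (cinv c (snd p)) \<in> cdom d}"
    by simp
  moreover have "{p \<in> {0<..} \<times> ?O. m (fst p) (cinv c (snd p)) \<in> cdom d} = action_domain c d"
    by (auto simp: action_domain_def)
  moreover have "openin (top_of_set (UNIV \<times> cspace c)) ({0::real<..} \<times> ?O)"
    by (intro openin_Times is_chart_openin_image[OF ch]) auto
  ultimately show ?thesis using openin_trans by metis
qed

lemma action_smooth:
  assumes "c \<in> atlas M" "d \<in> atlas M"
  shows "smooth_on (action_domain c d) (\<lambda>p. cmap d (m (fst p) (cinv c (snd p))))"
proof -
  note ch = atlas_is_chart[OF assms(1)]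
  define c' :: "(real \<times> 'a, real \<times> 'e) chart"
    where "c' = \<lparr>cdom = {0<..} \<times> cdom c, cmap = map_prod (\<lambda>x. x) (cmap c), cspace = UNIV \<times> cspace c\<rparr>"
  have "c' \<in> atlas (prod_manifold Rpos M)"
    using assms(1) by (auto simp: c'_def prod_manifold_def Rpos_def)
  then have sm: "smooth_on (cmap c' ` {p \<in> cdom c'. (case p of (r, x) \<Rightarrow> m r x) \<in> cdom d})
      (cmap d \<circ> (\<lambda>(r, x). m r x) \<circ> cinv c')"
    using action assms(2) by (auto simp: free_smooth_action_def smooth_map_def)
  have cinv': "cinv c' (r, cmap c x) = (r, x)" if "r > 0" "x \<in> cdom c" for r x
  proof -
    have "inj_on (cmap c') (cdom c')"
      using is_chart_inj_on[OF ch] by (auto simp: c'_def inj_on_def)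
    moreover have "(r, x) \<in> cdom c'" "(r, cmap c x) = cmap c' (r, x)" using that by (auto simp: c'_def)
    ultimately show ?thesis unfolding cinv_def by (metis inv_into_f_f)
  qed
  have sub: "action_domain c d \<subseteq> cmap c' ` {p \<in> cdom c'. (case p of (r, x) \<Rightarrow> m r x) \<in> cdom d}"
  proof
    fix p assume p: "p \<in> action_domain c d"
    then have "p = cmap c' (fst p, cinv c (snd p))" "cinv c (snd p) \<in> cdom c"
      by (auto simp: c'_def action_domain_def prod_eq_iff cinv_cmap[OF ch])
    then show "p \<in> cmap c' ` {p \<in> cdom c'. (case p of (r, x) \<Rightarrow> m r x) \<in> cdom d}"
      using p by (intro image_eqI[of _ _ "(fst p, cinv c (snd p))"]) (auto simp: action_domain_def c'_def)
  qed
  show ?thesis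
  proof (rule smooth_on_cong[OF smooth_on_subset[OF sm sub]])
    fix p assume "p \<in> action_domain c d"
    then show "(cmap d \<circ> (\<lambda>(r, x). m r x) \<circ> cinv c') p = cmap d (m (fst p) (cinv c (snd p)))"
      by (cases p) (auto simp: action_domain_def cinv' cinv_cmap[OF ch])
  qed
qed

lemma moved_path:
  assumes g: "smooth_path_on M I \<gamma>" and r: "smooth_on I r" "\<And>t. t \<in> I \<Longrightarrow> r t > 0"
  shows "smooth_path_on M I (\<lambda>t. m (r t) (\<gamma> t))"
proof (rule smooth_path_onI)
  have cg: "continuous_map (top_of_set I) (mtop M) \<gamma>" using g by (simp add: smooth_path_on_def)
  have "continuous_map (top_of_set I) (top_of_set {0<..}) r"
    using smooth_on_imp_continuous_on[OF r(1)] r(2) by (auto simp: continuous_map_in_subtopology)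
  with cg have "continuous_map (top_of_set I) (mtop M) ((\<lambda>(r, x). m r x) \<circ> (\<lambda>t. (r t, \<gamma> t)))"
    by (intro continuous_map_compose[OF _ action_continuous]) (simp add: continuous_map_paired)
  then show cont: "continuous_map (top_of_set I) (mtop M) (\<lambda>t. m (r t) (\<gamma> t))" by (simp add: o_def)
  fix t assume t: "t \<in> I"
  obtain c where c: "c \<in> atlas M" "\<gamma> t \<in> cdom c" using chart_at path_in_pts[OF g t] by blast
  obtain d where d: "d \<in> atlas M" "m (r t) (\<gamma> t) \<in> cdom d"
    using chart_at action_in_pts[OF r(2)[OF t] path_in_pts[OF g t]] by blast
  define J where "J = {t\<in>I. \<gamma> t \<in> cdom c} \<inter> {t\<in>I. m (r t) (\<gamma> t) \<in> cdom d}"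
  have J: "openin (top_of_set I) J"
    unfolding J_def by (intro openin_Int openin_path_preimage cg cont is_chart_openin[OF atlas_is_chart] c d)
  have "smooth_on J (cmap d \<circ> (\<lambda>t. m (r t) (\<gamma> t)))"
  proof (rule smooth_on_cong)
    show "smooth_on J ((\<lambda>p. cmap d (m (fst p) (cinv c (snd p)))) \<circ> (\<lambda>t. (r t, (cmap c \<circ> \<gamma>) t)))"
    proof (rule smooth_on_compose[OF smooth_on_Pair action_smooth[OF c(1) d(1)]])
      show "smooth_on J r" using r(1) by (rule smooth_on_subset) (auto simp: J_def)
      show "smooth_on J (cmap c \<circ> \<gamma>)"
        by (rule smooth_on_subset[of "{t\<in>I. \<gamma> t \<in> cdom c}"])
          (use g c in \<open>auto simp: J_def smooth_path_on_def\<close>)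
      show "(\<lambda>t. (r t, (cmap c \<circ> \<gamma>) t)) ` J \<subseteq> action_domain c d"
        using r(2) cinv_cmap[OF atlas_is_chart[OF c(1)]] by (auto simp: J_def action_domain_def)
    qed
  qed (use cinv_cmap[OF atlas_is_chart[OF c(1)]] in \<open>auto simp: J_def\<close>)
  then show "\<exists>c\<in>max_atlas M. \<exists>J. openin (top_of_set I) J \<and> t \<in> J \<and>
      (\<lambda>t. m (r t) (\<gamma> t)) ` J \<subseteq> cdom c \<and> smooth_on J (cmap c \<circ> (\<lambda>t. m (r t) (\<gamma> t)))"
    using J t c d atlas_subset_max_atlas
    by (intro bexI[of _ d] exI[of _ J] conjI) (auto simp: J_def)
qed

text \<open>Group element and point are treated as one variable. The product rule below then is the
  linearity of a single differential.\<close>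

lemma velocity_moved_path_component:
  assumes g: "smooth_path_on M I \<gamma>" "open I" "t \<in> I"
    and r: "(r has_vector_derivative r') (at t)" "r t > 0"
    and c: "c \<in> atlas M" "\<gamma> t \<in> cdom c" and d: "d \<in> atlas M" "m (r t) (\<gamma> t) \<in> cdom d"
  shows "velocity M (\<lambda>s. m (r s) (\<gamma> s)) t d =
    dir_deriv (\<lambda>p. cmap d (m (fst p) (cinv c (snd p)))) (r t, cmap c (\<gamma> t)) (r', velocity M \<gamma> t c)"
proof -
  note ch = atlas_is_chart[OF c(1)]
  have cx: "cinv c (cmap c (\<gamma> t)) = \<gamma> t" using cinv_cmap[OF ch c(2)] .
  have p: "(r t, cmap c (\<gamma> t)) \<in> action_domain c d"
    using r(2) c d cx by (auto simp: action_domain_def)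
  have k: "((\<lambda>s. (r s, cmap c (\<gamma> s))) has_vector_derivative (r', velocity M \<gamma> t c)) (at t)"
    by (intro has_vector_derivative_Pair r(1) velocity_has_vector_derivative[OF g c])
  have evc: "\<forall>\<^sub>F s in nhds t. \<gamma> s \<in> cdom c"
    by (rule smooth_path_eventually_in[OF g is_chart_openin[OF ch] c(2)])
  have ev: "\<forall>\<^sub>F s in nhds t. (r s, cmap c (\<gamma> s)) \<in> action_domain c d"
  proof (rule eventually_in_relatively_open[OF action_domain_open[OF c(1) d(1)],
        where k="\<lambda>s. (r s, cmap c (\<gamma> s))"])
    show "(r t, cmap c (\<gamma> t)) \<in> action_domain c d" by (rule p)
    show "isCont (\<lambda>s. (r s, cmap c (\<gamma> s))) t"
      using k has_vector_derivative_continuous by blast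
    show "\<forall>\<^sub>F s in nhds t. (r s, cmap c (\<gamma> s)) \<in> UNIV \<times> cspace c"
      using evc by eventually_elim (use openin_imp_subset[OF is_chart_openin_image[OF ch]] in auto)
  qed
  have "((\<lambda>s. cmap d (m (fst (r s, cmap c (\<gamma> s))) (cinv c (snd (r s, cmap c (\<gamma> s))))))
      has_vector_derivative
      dir_deriv (\<lambda>p. cmap d (m (fst p) (cinv c (snd p)))) (r t, cmap c (\<gamma> t)) (r', velocity M \<gamma> t c)) (at t)"
    by (rule path_chain(2)[OF action_smooth[OF c(1) d(1)] action_domain_open[OF c(1) d(1)] _ p k refl ev])
      (intro subspace_Times subspace_UNIV is_chart_subspace[OF ch])
  then have "((\<lambda>s. cmap d (m (r s) (\<gamma> s))) has_vector_derivative
      dir_deriv (\<lambda>p. cmap d (m (fst p) (cinv c (snd p)))) (r t, cmap c (\<gamma> t)) (r', velocity M \<gamma> t c)) (at t)"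
    by (rule has_vector_derivative_eventually_cong)
      (use evc in \<open>eventually_elim, simp add: cinv_cmap[OF ch]\<close>)
  then show ?thesis
    using d by (simp add: velocity_def o_def vector_derivative_at)
qed

text \<open>The product rule: the differential of the action is linear in the pair of increments of group
  element and point, and an increment of the group element alone moves the point along its orbit,
  that is, in the direction of the Euler field.\<close>

lemma velocity_moved_path:
  assumes g: "smooth_path_on M I \<gamma>" "open I" "t \<in> I"
    and r: "(r has_vector_derivative r') (at t)" "r t > 0"
  shows "velocity M (\<lambda>s. m (r s) (\<gamma> s)) t =
    (\<lambda>d. 1 *\<^sub>R velocity M (\<lambda>s. m (r t) (\<gamma> s)) t d + (r' / r t) *\<^sub>R euler_field M m (m (r t) (\<gamma> t)) d)"
proof
  fix d
  have x: "\<gamma> t \<in> pts M" using path_in_pts g by blast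
  define y where "y = m (r t) (\<gamma> t)"
  show "velocity M (\<lambda>s. m (r s) (\<gamma> s)) t d =
    1 *\<^sub>R velocity M (\<lambda>s. m (r t) (\<gamma> s)) t d + (r' / r t) *\<^sub>R euler_field M m (m (r t) (\<gamma> t)) d"
  proof (cases "d \<in> atlas M \<and> y \<in> cdom d")
    case True
    then have d: "d \<in> atlas M" "m (r t) (\<gamma> t) \<in> cdom d" by (auto simp: y_def)
    obtain c where c: "c \<in> atlas M" "\<gamma> t \<in> cdom c" using chart_at x by blast
    note ch = atlas_is_chart[OF c(1)]
    let ?G = "\<lambda>p. cmap d (m (fst p) (cinv c (snd p)))" and ?p = "(r t, cmap c (\<gamma> t))"
    let ?\<xi> = "velocity M \<gamma> t c"
    have 1: "velocity M (\<lambda>s. m (r s) (\<gamma> s)) t d = dir_deriv ?G ?p (r', ?\<xi>)"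
      by (rule velocity_moved_path_component[OF g r c d])
    have 2: "velocity M (\<lambda>s. m (r t) (\<gamma> s)) t d = dir_deriv ?G ?p (0, ?\<xi>)"
      by (rule velocity_moved_path_component[OF g, of "\<lambda>_. r t"]) (use r(2) c d in auto)
    have "velocity M (\<lambda>s. m (r t * exp s) (\<gamma> t)) 0 d = dir_deriv ?G (r t * exp 0, cmap c (\<gamma> t)) (r t, velocity M (\<lambda>s. \<gamma> t) 0 c)"
      by (rule velocity_moved_path_component[OF constant_path[OF x] open_UNIV UNIV_I _ _ c])
        (use r(2) d in \<open>auto simp: has_real_derivative_iff_has_vector_derivative[symmetric] intro!: derivative_eq_intros\<close>)
    moreover have "(\<lambda>s. m (r t * exp s) (\<gamma> t)) = (\<lambda>s. m (exp s) (m (r t) (\<gamma> t)))"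
      using action_mult[OF _ r(2) x] by (auto simp: mult.commute)
    ultimately have 3: "euler_field M m (m (r t) (\<gamma> t)) d = dir_deriv ?G ?p (r t, 0)"
      by (simp add: euler_field_def velocity_constant_path)
    have p: "?p \<in> action_domain c d"
      using r(2) c d cinv_cmap[OF ch c(2)] by (auto simp: action_domain_def)
    have "dir_deriv ?G ?p (1 *\<^sub>R (0, ?\<xi>) + (r' / r t) *\<^sub>R (r t, 0)) =
        1 *\<^sub>R dir_deriv ?G ?p (0, ?\<xi>) + (r' / r t) *\<^sub>R dir_deriv ?G ?p (r t, 0)"
      using velocity_in_cspace[OF g c] subspace_0[OF is_chart_subspace[OF ch]]
      by (intro dir_deriv_linear[OF action_smooth[OF c(1) d(1)] action_domain_open[OF c(1) d(1)] _ p]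
          subspace_Times subspace_UNIV is_chart_subspace[OF ch]) auto
    then show ?thesis
      unfolding 1 2 3 using r(2) by simp
  next
    case False
    then have "velocity M (\<lambda>s. m (r s) (\<gamma> s)) t d = 0" "velocity M (\<lambda>s. m (r t) (\<gamma> s)) t d = 0"
      by (auto simp: velocity_def y_def)
    moreover have "euler_field M m y d = 0"
      using False action_one[OF action_in_pts[OF r(2) x]] by (auto simp: euler_field_def velocity_def y_def)
    ultimately show ?thesis by (simp add: y_def)
  qed
qed

lemma flow_path: "x \<in> pts M \<Longrightarrow> smooth_path_on M I (\<lambda>s. m (exp (a * s)) x)"
  by (intro moved_path constant_path smooth_onI_open[OF open_UNIV])
    (auto intro!: Ck_on_compose[OF open_UNIV open_UNIV _ _ Ck_on_exp] Ck_on_mult Ck_on_const Ck_on_id)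

lemma velocity_flow_path:
  assumes "x \<in> pts M"
  shows "velocity M (\<lambda>s. m (exp (a * s)) x) t = (\<lambda>d. a *\<^sub>R euler_field M m (m (exp (a * t)) x) d)"
proof -
  have "((\<lambda>s. exp (a * s)) has_vector_derivative a * exp (a * t)) (at t)"
    by (auto simp: has_real_derivative_iff_has_vector_derivative[symmetric] intro!: derivative_eq_intros)
  from velocity_moved_path[OF constant_path[OF assms] open_UNIV UNIV_I this]
  show ?thesis by (simp add: velocity_constant_path)
qed

lemma euler_field_in_tangent_space:
  assumes "x \<in> pts M"
  shows "euler_field M m x \<in> tangent_space M x"
  using velocity_in_tangent_space[OF flow_path[OF assms, of UNIV 1] open_UNIV UNIV_I, of 0]
  by (simp add: euler_field_def action_one[OF assms])

text \<open>The homogeneity of the metric is a statement about pushforwards; this turns it into one about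
  the speed of paths.\<close>

lemma velocity_pushforward:
  assumes g: "smooth_path_on M I \<gamma>" "open I" "t \<in> I" and r: "r > 0"
  shows "velocity M (\<lambda>s. m r (\<gamma> s)) t = pushforward M M (m r) (\<gamma> t) (velocity M \<gamma> t)"
proof
  fix d
  have x: "\<gamma> t \<in> pts M" using path_in_pts g by blast
  let ?c = "SOME c. c \<in> atlas M \<and> \<gamma> t \<in> cdom c"
  have c: "?c \<in> atlas M \<and> \<gamma> t \<in> cdom ?c"
    by (rule someI_ex) (use chart_at[OF x] in blast)
  note ch = atlas_is_chart[OF c[THEN conjunct1]]
  show "velocity M (\<lambda>s. m r (\<gamma> s)) t d = pushforward M M (m r) (\<gamma> t) (velocity M \<gamma> t) d"
  proof (cases "d \<in> atlas M \<and> m r (\<gamma> t) \<in> cdom d")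
    case True
    have 1: "velocity M (\<lambda>s. m r (\<gamma> s)) t d = dir_deriv (\<lambda>p. cmap d (m (fst p) (cinv ?c (snd p))))
       (r, cmap ?c (\<gamma> t)) (0, velocity M \<gamma> t ?c)"
      using c True r by (intro velocity_moved_path_component[OF g]) auto
    have "dir_deriv (\<lambda>p. cmap d (m (fst p) (cinv ?c (snd p)))) (r, cmap ?c (\<gamma> t)) (0, velocity M \<gamma> t ?c) =
      dir_deriv (cmap d \<circ> m r \<circ> cinv ?c) (cmap ?c (\<gamma> t)) (velocity M \<gamma> t ?c)"
      by (simp add: dir_deriv_def)
    then show ?thesis
      using 1 True by (simp add: pushforward_def differential_def Let_def)
  next
    case False
    then show ?thesis by (auto simp: velocity_def pushforward_def)
  qed
qed

end


section \<open>Speed is integrable along smooth paths\<close>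

text \<open>Lengths for \<open>g\<close> itself (factor \<open>1\<close>) and for \<open>(v \<circ> f) g\<close> are treated together.\<close>

definition conformal_weight :: "('a, 'e::euclidean_space) manifold \<Rightarrow> ('a \<Rightarrow> real) \<Rightarrow> bool" where
  "conformal_weight M \<rho> \<longleftrightarrow> continuous_map (mtop M) euclideanreal \<rho> \<and> (\<forall>x\<in>pts M. \<rho> x > 0)"

lemma bilinear_sum:
  fixes q :: "'v::real_vector \<Rightarrow> 'v \<Rightarrow> real"
  assumes V: "subspace V" and fin: "finite B" and B: "B \<subseteq> V"
    and lin: "\<And>u u' w a b. u \<in> V \<Longrightarrow> u' \<in> V \<Longrightarrow> w \<in> V \<Longrightarrow> q (a *\<^sub>R u + b *\<^sub>R u') w = a * q u w + b * q u' w"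
    and sym: "\<And>u w. u \<in> V \<Longrightarrow> w \<in> V \<Longrightarrow> q u w = q w u"
  shows "q (\<Sum>i\<in>B. a i *\<^sub>R i) (\<Sum>j\<in>B. b j *\<^sub>R j) = (\<Sum>i\<in>B. \<Sum>j\<in>B. a i * b j * q i j)"
proof -
  have *: "q (\<Sum>i\<in>C. c i *\<^sub>R i) w = (\<Sum>i\<in>C. c i * q i w)" if "C \<subseteq> B" "w \<in> V" for C c w
  proof -
    have "finite C" using that(1) fin by (rule finite_subset)
    then show ?thesis using that(1)
    proof (induction C rule: finite_induct)
      case empty
      show ?case using lin[of 0 0 w 0 0] V that(2) by (simp add: subspace_0)
    next
      case (insert i C)
      have "(\<Sum>i\<in>C. c i *\<^sub>R i) \<in> V"
        using insert.prems B V by (intro subspace_sum subspace_scale) auto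
      then show ?case
        using lin[of i "\<Sum>i\<in>C. c i *\<^sub>R i" w "c i" 1] insert B that(2) by auto
    qed
  qed
  have inV: "(\<Sum>j\<in>B. b j *\<^sub>R j) \<in> V" using B V by (intro subspace_sum subspace_scale) auto
  have "q (\<Sum>i\<in>B. a i *\<^sub>R i) (\<Sum>j\<in>B. b j *\<^sub>R j) = (\<Sum>i\<in>B. a i * q (\<Sum>j\<in>B. b j *\<^sub>R j) i)"
    using *[OF order_refl inV] sym[OF inV] B by (auto intro!: sum.cong)
  also have "\<dots> = (\<Sum>i\<in>B. \<Sum>j\<in>B. a i * b j * q i j)"
  proof (rule sum.cong[OF refl])
    fix i assume i: "i \<in> B"
    have "q (\<Sum>j\<in>B. b j *\<^sub>R j) i = (\<Sum>j\<in>B. b j * q j i)"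
      using *[OF order_refl] i B by blast
    also have "\<dots> = (\<Sum>j\<in>B. b j * q i j)"
      by (rule sum.cong[OF refl]) (use sym i B in auto)
    finally show "a i * q (\<Sum>j\<in>B. b j *\<^sub>R j) i = (\<Sum>j\<in>B. a i * b j * q i j)"
      by (simp add: sum_distrib_left mult.assoc)
  qed
  finally show ?thesis .
qed

lemma ennreal_less_add: "x < top \<Longrightarrow> e > 0 \<Longrightarrow> x < x + ennreal e"
  by (cases x) (auto simp: ennreal_less_iff simp flip: ennreal_plus)

lemma integral_le_open_interval:
  fixes h k :: "real \<Rightarrow> real"
  assumes "h integrable_on {a..b}" "k integrable_on {a..b}" "\<And>t. a < t \<Longrightarrow> t < b \<Longrightarrow> h t \<le> k t"
  shows "integral {a..b} h \<le> integral {a..b} k"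
  unfolding integral_open_interval_real
  by (rule integral_le) (use assms in \<open>auto simp: integrable_on_open_interval_real\<close>)

lemma integral_cong_open_interval:
  fixes h k :: "real \<Rightarrow> real"
  assumes "\<And>t. a < t \<Longrightarrow> t < b \<Longrightarrow> h t = k t"
  shows "integral {a..b} h = integral {a..b} k"
  unfolding integral_open_interval_real by (rule integral_cong) (use assms in auto)

locale riemannian = smooth_mfd M for M :: "('a, 'e::euclidean_space) manifold" +
  fixes g :: "('a, 'e) metric_tensor"
  assumes pseudo_riem: "pseudo_riemannian M g" and pos: "positive_definite M g"
begin

definition speed :: "('a \<Rightarrow> real) \<Rightarrow> (real \<Rightarrow> 'a) \<Rightarrow> real \<Rightarrow> real" where
  "speed \<rho> \<gamma> t = sqrt (\<rho> (\<gamma> t) * g (\<gamma> t) (velocity M \<gamma> t) (velocity M \<gamma> t))"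

lemma metric_nonneg:
  assumes "x \<in> pts M" "\<xi> \<in> tangent_space M x"
  shows "g x \<xi> \<xi> \<ge> 0"
proof (cases "\<xi> = (\<lambda>c. 0)")
  case True
  with pseudo_riemannian_square[OF pseudo_riem assms(1,2,2), of 0 0] assms show ?thesis by simp
next
  case False
  then show ?thesis using pos assms unfolding positive_definite_def by (meson less_imp_le)
qed

text \<open>The Gram matrix of the coordinate vectors determines the metric; its entries are the
  functions whose smoothness is known.\<close>

lemma metric_coefficients:
  assumes c: "c \<in> atlas M" "x \<in> cdom c" and B: "B \<subseteq> cspace c" "finite B"
  shows "g x (coord_vector M c (\<Sum>i\<in>B. a i *\<^sub>R i) x) (coord_vector M c (\<Sum>j\<in>B. b j *\<^sub>R j) x) =
    (\<Sum>i\<in>B. \<Sum>j\<in>B. a i * b j * g x (coord_vector M c i x) (coord_vector M c j x))"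
proof (rule bilinear_sum[OF is_chart_subspace[OF atlas_is_chart[OF c(1)]] B(2,1)])
  have x: "x \<in> pts M" using c is_chart_subset[OF atlas_is_chart] by blast
  note T = coord_vector_in_tangent_space[OF c]
  show "g x (coord_vector M c u x) (coord_vector M c w x) = g x (coord_vector M c w x) (coord_vector M c u x)"
    if "u \<in> cspace c" "w \<in> cspace c" for u w
    using pseudo_riem x T[OF that(1)] T[OF that(2)] unfolding pseudo_riemannian_def by blast
  show "g x (coord_vector M c (a *\<^sub>R u + b *\<^sub>R u') x) (coord_vector M c w x) =
      a * g x (coord_vector M c u x) (coord_vector M c w x) + b * g x (coord_vector M c u' x) (coord_vector M c w x)"
    if "u \<in> cspace c" "u' \<in> cspace c" "w \<in> cspace c" for u u' w a b
    using pseudo_riem x T that unfolding coord_vector_linear[OF c that(1,2)] pseudo_riemannian_def by blast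
qed

text \<open>The velocity is junk at the end points, but in a chart the speed extends continuously to them
  because a smooth path extends to a neighbourhood.\<close>

lemma speed_continuous_extension:
  assumes \<rho>: "continuous_map (mtop M) euclideanreal \<rho>" and \<gamma>: "smooth_path_on M {a..b} \<gamma>"
    and x: "x \<in> {a..b}"
  shows "\<exists>W h. open W \<and> x \<in> W \<and> continuous_on ({a..b} \<inter> W) h \<and> (\<forall>t\<in>{a<..<b} \<inter> W. speed \<rho> \<gamma> t = h t)"
proof -
  obtain c where c: "c \<in> atlas M" "\<gamma> x \<in> cdom c" using chart_at path_in_pts[OF \<gamma> x] by blast
  note ch = atlas_is_chart[OF c(1)]
  define T where "T = {t\<in>{a..b}. \<gamma> t \<in> cdom c}"
  have cont: "continuous_map (top_of_set {a..b}) (mtop M) \<gamma>" and sm: "smooth_on T (cmap c \<circ> \<gamma>)"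
    using \<gamma> c by (auto simp: smooth_path_on_def T_def)
  have "x \<in> T" using x c by (simp add: T_def)
  then obtain U F where U: "open U" "x \<in> U" "\<forall>k. Ck_on k U F" "\<forall>t\<in>T \<inter> U. F t = (cmap c \<circ> \<gamma>) t"
    using smooth_onD[OF sm] by blast
  have "openin (top_of_set {a..b}) T"
    unfolding T_def by (rule openin_path_preimage[OF cont is_chart_openin[OF ch]])
  then obtain V where V: "open V" "T = {a..b} \<inter> V" by (auto simp: openin_open)
  define W where "W = U \<inter> V"
  define F' where "F' = (\<lambda>t. frechet_derivative F (at t) 1)"
  have F': "(F has_vector_derivative F' t) (at t)" if "t \<in> U" for t
  proof -
    have d: "(F has_derivative frechet_derivative F (at t)) (at t)"
      using Ck_on_has_derivative U(3) that by blast
    then have "frechet_derivative F (at t) s = s *\<^sub>R F' t" for s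
      using linear_scale[OF has_derivative_linear[OF d], of s 1] by (simp add: F'_def)
    then have "frechet_derivative F (at t) = (\<lambda>s. s *\<^sub>R F' t)" by (rule ext)
    with d show ?thesis unfolding has_vector_derivative_def by simp
  qed
  have "Ck_on 1 U F" using U(3) by blast
  then have contF': "continuous_on U F'" by (simp add: F'_def)
  obtain B where B: "B \<subseteq> cspace c" "pairwise orthogonal B" "\<And>i. i \<in> B \<Longrightarrow> norm i = 1"
    "independent B" "span B = cspace c"
    using orthonormal_basis_subspace[OF is_chart_subspace[OF ch]] by metis
  have finB: "finite B" using B(4) by (rule independent_imp_finite)
  define q where "q = (\<lambda>i j y. g (cinv c y) (coord_vector M c i (cinv c y)) (coord_vector M c j (cinv c y)))"
  have contq: "continuous_on (cmap c ` cdom c) (q i j)" if "i \<in> B" "j \<in> B" for i j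
    using pseudo_riem c(1) B(1) that unfolding q_def pseudo_riemannian_def
    by (blast intro: smooth_on_imp_continuous_on)
  define h where "h = (\<lambda>t. sqrt (\<rho> (\<gamma> t) * (\<Sum>i\<in>B. \<Sum>j\<in>B. (F' t \<bullet> i) * (F' t \<bullet> j) * q i j (cmap c (\<gamma> t)))))"
  have sub: "{a..b} \<inter> W = T \<inter> U" by (auto simp: W_def V)
  have 1: "continuous_on (T \<inter> U) (\<lambda>t. \<rho> (\<gamma> t))"
  proof -
    have "continuous_map (top_of_set {a..b}) euclideanreal (\<rho> \<circ> \<gamma>)"
      by (rule continuous_map_compose[OF cont \<rho>])
    then have "continuous_on {a..b} (\<lambda>t. \<rho> (\<gamma> t))" by (simp add: o_def)
    then show ?thesis by (rule continuous_on_subset) (auto simp: T_def)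
  qed
  have 2: "continuous_on (T \<inter> U) (\<lambda>t. q i j (cmap c (\<gamma> t)))" if "i \<in> B" "j \<in> B" for i j
  proof (rule continuous_on_compose2[OF contq[OF that]])
    show "continuous_on (T \<inter> U) (\<lambda>t. cmap c (\<gamma> t))"
      using smooth_on_imp_continuous_on[OF sm] continuous_on_subset by (fastforce simp: o_def)
  qed (auto simp: T_def)
  have "continuous_on (T \<inter> U) h"
    unfolding h_def
    by (intro continuous_on_real_sqrt continuous_on_mult continuous_on_sum continuous_on_inner
        continuous_on_const 1 2 continuous_on_subset[OF contF']) auto
  moreover have "speed \<rho> \<gamma> t = h t" if t: "t \<in> {a<..<b} \<inter> W" for t
  proof -
    let ?I = "{a<..<b} \<inter> W"
    have "smooth_path_on M ?I \<gamma>" by (rule smooth_path_on_subset[OF \<gamma>]) auto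
    moreover have "open ?I" using U(1) V(1) by (simp add: W_def open_Int)
    ultimately have I: "smooth_path_on M ?I \<gamma>" "open ?I" "t \<in> ?I" using t by auto
    have IT: "?I \<subseteq> T \<inter> U" unfolding sub[symmetric] by auto
    then have ct: "\<gamma> t \<in> cdom c" using t by (auto simp: T_def)
    have "((\<lambda>s. cmap c (\<gamma> s)) has_vector_derivative F' t) (at t)"
    proof (rule has_vector_derivative_transform_within_open[OF F' I(2,3)])
      show "t \<in> U" using IT I(3) by blast
      show "F s = cmap c (\<gamma> s)" if "s \<in> ?I" for s
        using U(4) subsetD[OF IT that] by simp
    qed
    then have vel: "velocity M \<gamma> t c = F' t"
      using c ct by (simp add: velocity_def vector_derivative_at o_def)
    then have "F' t \<in> span B" using velocity_in_cspace[OF I c(1) ct] B(5) by simp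
    then have F'_eq: "(\<Sum>i\<in>B. (F' t \<bullet> i) *\<^sub>R i) = F' t"
      using orthonormal_basis_expand[OF B(2,3) _ finB] by blast
    have "velocity M \<gamma> t = coord_vector M c (F' t) (\<gamma> t)"
      using velocity_eq_coord_vector[OF I c(1) ct] vel by simp
    then have "g (\<gamma> t) (velocity M \<gamma> t) (velocity M \<gamma> t) =
        (\<Sum>i\<in>B. \<Sum>j\<in>B. (F' t \<bullet> i) * (F' t \<bullet> j) * q i j (cmap c (\<gamma> t)))"
      using metric_coefficients[OF c(1) ct B(1) finB, of "\<lambda>i. F' t \<bullet> i" "\<lambda>i. F' t \<bullet> i"]
      by (simp add: F'_eq q_def cinv_cmap[OF ch ct])
    then show ?thesis by (simp add: speed_def h_def)
  qed
  moreover have "open W" "x \<in> W"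
    using U(1,2) V \<open>x \<in> T\<close> by (auto simp: W_def)
  ultimately show ?thesis
    unfolding sub[symmetric] by (intro exI[of _ W] exI[of _ h]) blast
qed

lemma smooth_path_speed_integrable:
  assumes \<rho>: "continuous_map (mtop M) euclideanreal \<rho>" and \<gamma>: "smooth_path_on M {a..b} \<gamma>"
  shows "speed \<rho> \<gamma> integrable_on {a..b}"
proof -
  have "\<exists>d>0. \<forall>u v. x \<in> cbox u v \<and> cbox u v \<subseteq> ball x d \<and> cbox u v \<subseteq> cbox a b \<longrightarrow>
      speed \<rho> \<gamma> integrable_on cbox u v" if x: "x \<in> cbox a b" for x
  proof -
    obtain W h where W: "open W" "x \<in> W" "continuous_on ({a..b} \<inter> W) h" "\<forall>t\<in>{a<..<b} \<inter> W. speed \<rho> \<gamma> t = h t"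
      using speed_continuous_extension[OF \<rho> \<gamma>, of x] x by auto
    obtain d where d: "d > 0" "ball x d \<subseteq> W" using W(1,2) open_contains_ball by blast
    have "speed \<rho> \<gamma> integrable_on cbox u v" if uv: "cbox u v \<subseteq> ball x d" "cbox u v \<subseteq> cbox a b" for u v
    proof (rule integrable_spike_finite[of "{a, b}"])
      show "h integrable_on cbox u v"
        by (rule integrable_continuous[OF continuous_on_subset[OF W(3)]]) (use uv d in auto)
      show "speed \<rho> \<gamma> t = h t" if "t \<in> cbox u v - {a, b}" for t
      proof -
        have "t \<in> cbox a b" "t \<in> W" using that uv d(2) by blast+
        then show ?thesis using W(4) that by auto
      qed
    qed auto
    then show ?thesis using d(1) by blast
  qed
  then show ?thesis using integrable_on_little_subintervals[of a b "speed \<rho> \<gamma>"] by simp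
qed


section \<open>Piecewise smooth paths\<close>

text \<open>The inductive form of piecewise smoothness, for arbitrary parameter intervals. Statements about
  lengths are proved for smooth pieces and extended by induction.\<close>

inductive pw_smooth :: "(real \<Rightarrow> 'a) \<Rightarrow> real \<Rightarrow> real \<Rightarrow> bool" for \<gamma> where
  piece: "a < b \<Longrightarrow> smooth_path_on M {a..b} \<gamma> \<Longrightarrow> pw_smooth \<gamma> a b"
| append: "pw_smooth \<gamma> a b \<Longrightarrow> pw_smooth \<gamma> b c \<Longrightarrow> pw_smooth \<gamma> a c"

lemma pw_smooth_less: "pw_smooth \<gamma> a b \<Longrightarrow> a < b"
  by (induction rule: pw_smooth.induct) auto

lemma piecewise_smooth_path_iff: "piecewise_smooth_path M \<gamma> \<longleftrightarrow> pw_smooth \<gamma> 0 1"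
proof
  assume "piecewise_smooth_path M \<gamma>"
  then obtain n :: nat and p where p: "p 0 = 0" "p n = 1"
      "\<And>i. i < n \<Longrightarrow> p i < p (Suc i) \<and> smooth_path_on M {p i..p (Suc i)} \<gamma>"
    unfolding piecewise_smooth_path_def by blast
  have "pw_smooth \<gamma> (p 0) (p (Suc k))" if "Suc k \<le> n" for k
    using that
  proof (induction k)
    case 0
    then show ?case using p(3)[of 0] by (auto intro: pw_smooth.piece)
  next
    case (Suc k)
    then show ?case using p(3)[of "Suc k"] by (auto intro: pw_smooth.append pw_smooth.piece)
  qed
  moreover have "n \<noteq> 0" using p by (metis zero_neq_one)
  ultimately show "pw_smooth \<gamma> 0 1" using p by (metis not0_implies_Suc order_refl)
next
  have "\<exists>(n::nat) p. p 0 = a \<and> p n = b \<and> (\<forall>i<n. p i < p (Suc i) \<and> smooth_path_on M {p i..p (Suc i)} \<gamma>)"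
    if "pw_smooth \<gamma> a b" for a b
    using that
  proof (induction rule: pw_smooth.induct)
    case (piece a b)
    then show ?case by (intro exI[of _ 1] exI[of _ "\<lambda>i. if i = 0 then a else b"]) auto
  next
    case (append a b c)
    then obtain n n' :: nat and p p' where
      p: "p 0 = a" "p n = b" "\<forall>i<n. p i < p (Suc i) \<and> smooth_path_on M {p i..p (Suc i)} \<gamma>" and
      p': "p' 0 = b" "p' n' = c" "\<forall>i<n'. p' i < p' (Suc i) \<and> smooth_path_on M {p' i..p' (Suc i)} \<gamma>"
      by auto
    have "(if i \<le> n then p i else p' (i - n)) < (if Suc i \<le> n then p (Suc i) else p' (Suc i - n)) \<and>
      smooth_path_on M {if i \<le> n then p i else p' (i - n)..if Suc i \<le> n then p (Suc i) else p' (Suc i - n)} \<gamma>"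
      if i: "i < n + n'" for i
    proof -
      consider "i < n" | "i = n" "n' > 0" | "i > n" "i - n < n'" using i by linarith
      then show ?thesis
      proof cases
        case 1
        then show ?thesis using p(3) by auto
      next
        case 2
        then show ?thesis using p(2) p'(1) p'(3)[rule_format, of 0] by auto
      next
        case 3
        then show ?thesis using p'(3)[rule_format, of "i - n"] by (auto simp: Suc_diff_le)
      qed
    qed
    then show ?case
      using p(1,2) p'(1,2)
      by (intro exI[of _ "n + n'"] exI[of _ "\<lambda>i. if i \<le> n then p i else p' (i - n)"]) auto
  qed
  then show "pw_smooth \<gamma> 0 1 \<Longrightarrow> piecewise_smooth_path M \<gamma>"
    unfolding piecewise_smooth_path_def by blast
qed

lemma pw_smooth_restrict:
  "pw_smooth \<gamma> a b \<Longrightarrow> a < t \<Longrightarrow> t < b \<Longrightarrow> pw_smooth \<gamma> a t \<and> pw_smooth \<gamma> t b"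
proof (induction rule: pw_smooth.induct)
  case (piece a b)
  then have "smooth_path_on M {a..t} \<gamma>" "smooth_path_on M {t..b} \<gamma>"
    by (auto intro: smooth_path_on_subset)
  then show ?case using piece by (auto intro: pw_smooth.piece)
next
  case (append a b c)
  consider "t < b" | "t = b" | "t > b" by linarith
  then show ?case using append by cases (auto intro: pw_smooth.append)
qed

lemma pw_smooth_in_pts: "pw_smooth \<gamma> a b \<Longrightarrow> t \<in> {a..b} \<Longrightarrow> \<gamma> t \<in> pts M"
proof (induction rule: pw_smooth.induct)
  case (piece a b)
  then show ?case using path_in_pts by blast
next
  case (append a b c)
  then show ?case by (cases "t \<le> b") auto
qed

lemma pw_smooth_map:
  assumes "pw_smooth \<gamma> a b" "\<And>I. I \<subseteq> {a..b} \<Longrightarrow> smooth_path_on M I \<gamma> \<Longrightarrow> smooth_path_on M I \<beta>"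
  shows "pw_smooth \<beta> a b"
  using assms
proof (induction rule: pw_smooth.induct)
  case (append a b c)
  have "a < b" "b < c" using append pw_smooth_less by auto
  then have "pw_smooth \<beta> a b" "pw_smooth \<beta> b c"
    by (auto intro!: append.IH append.prems)
  then show ?case by (rule pw_smooth.append)
qed (auto intro: pw_smooth.piece)

lemma smooth_path_on_cong:
  assumes "smooth_path_on M I \<gamma>" "\<And>t. t \<in> I \<Longrightarrow> \<gamma> t = \<beta> t"
  shows "smooth_path_on M I \<beta>"
  unfolding smooth_path_on_def
proof (intro conjI ballI)
  show "continuous_map (top_of_set I) (mtop M) \<beta>"
    using assms continuous_map_eq[of "top_of_set I" "mtop M" \<gamma> \<beta>] by (simp add: smooth_path_on_def)
  fix c assume "c \<in> atlas M"
  moreover have "{t \<in> I. \<gamma> t \<in> cdom c} = {t \<in> I. \<beta> t \<in> cdom c}" using assms(2) by auto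
  ultimately have "smooth_on {t \<in> I. \<beta> t \<in> cdom c} (cmap c \<circ> \<gamma>)"
    using assms(1) by (auto simp: smooth_path_on_def)
  then show "smooth_on {t \<in> I. \<beta> t \<in> cdom c} (cmap c \<circ> \<beta>)"
    by (rule smooth_on_cong) (use assms(2) in auto)
qed

lemma smooth_path_on_affine:
  assumes \<gamma>: "smooth_path_on M I \<gamma>" and J: "\<And>t. t \<in> J \<Longrightarrow> p * t + q \<in> I"
  shows "smooth_path_on M J (\<lambda>t. \<gamma> (p * t + q))"
  unfolding smooth_path_on_def
proof (intro conjI ballI)
  have "continuous_map (top_of_set J) (top_of_set I) (\<lambda>t. p * t + q)"
    using J by (auto simp: continuous_map_in_subtopology intro!: continuous_intros)
  then show "continuous_map (top_of_set J) (mtop M) (\<lambda>t. \<gamma> (p * t + q))"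
    using \<gamma> continuous_map_compose[of "top_of_set J" "top_of_set I" "\<lambda>t. p * t + q" "mtop M" \<gamma>]
    by (simp add: smooth_path_on_def o_def)
  fix c assume "c \<in> atlas M"
  then have "smooth_on {t \<in> I. \<gamma> t \<in> cdom c} (cmap c \<circ> \<gamma>)" using \<gamma> by (simp add: smooth_path_on_def)
  then have "smooth_on {t \<in> J. \<gamma> (p * t + q) \<in> cdom c} ((cmap c \<circ> \<gamma>) \<circ> (\<lambda>t. p * t + q))"
  proof (rule smooth_on_compose[rotated])
    show "smooth_on {t \<in> J. \<gamma> (p * t + q) \<in> cdom c} (\<lambda>t. p * t + q)"
      by (rule smooth_onI_open[OF open_UNIV]) (auto intro!: Ck_on_add Ck_on_mult Ck_on_const Ck_on_id)
  qed (use J in auto)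
  then show "smooth_on {t \<in> J. \<gamma> (p * t + q) \<in> cdom c} (cmap c \<circ> (\<lambda>t. \<gamma> (p * t + q)))"
    by (simp add: o_def)
qed

lemma velocity_affine:
  assumes \<gamma>: "smooth_path_on M I \<gamma>" "open I" "p * t + q \<in> I"
  shows "velocity M (\<lambda>s. \<gamma> (p * s + q)) t = (\<lambda>c. p *\<^sub>R velocity M \<gamma> (p * t + q) c)"
proof
  fix c
  show "velocity M (\<lambda>s. \<gamma> (p * s + q)) t c = p *\<^sub>R velocity M \<gamma> (p * t + q) c"
  proof (cases "c \<in> atlas M \<and> \<gamma> (p * t + q) \<in> cdom c")
    case True
    have "((\<lambda>s. p * s + q) has_vector_derivative p) (at t)"
      by (auto simp: has_real_derivative_iff_has_vector_derivative[symmetric] intro!: derivative_eq_intros)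
    from vector_diff_chain_at[OF this velocity_has_vector_derivative[OF \<gamma>]] True
    have "((\<lambda>s. cmap c (\<gamma> (p * s + q))) has_vector_derivative p *\<^sub>R velocity M \<gamma> (p * t + q) c) (at t)"
      by (simp add: o_def)
    then show ?thesis
      using True by (simp add: velocity_def[of M "\<lambda>s. \<gamma> (p * s + q)"] vector_derivative_at o_def)
  next
    case False
    then show ?thesis by (auto simp: velocity_def)
  qed
qed

lemma speed_affine:
  assumes \<gamma>: "smooth_path_on M I \<gamma>" "open I" "p * t + q \<in> I"
  shows "speed \<rho> (\<lambda>s. \<gamma> (p * s + q)) t = \<bar>p\<bar> * speed \<rho> \<gamma> (p * t + q)"
proof -
  let ?x = "\<gamma> (p * t + q)" and ?\<xi> = "velocity M \<gamma> (p * t + q)"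
  have x: "?x \<in> pts M" "?\<xi> \<in> tangent_space M ?x"
    using path_in_pts[OF \<gamma>(1,3)] velocity_in_tangent_space[OF \<gamma>] by auto
  have "g ?x (\<lambda>c. p *\<^sub>R ?\<xi> c) (\<lambda>c. p *\<^sub>R ?\<xi> c) = p\<^sup>2 * g ?x ?\<xi> ?\<xi>"
    using pseudo_riemannian_square[OF pseudo_riem x(1,2,2) tangent_space_lincomb[OF x(2,2)], of p 0] by simp
  then show ?thesis
    by (simp add: speed_def velocity_affine[OF \<gamma>] real_sqrt_mult)
qed

lemma speed_nonneg:
  assumes "conformal_weight M \<rho>" "smooth_path_on M I \<gamma>" "open I" "t \<in> I"
  shows "speed \<rho> \<gamma> t \<ge> 0"
  using assms(1) path_in_pts[OF assms(2,4)] metric_nonneg velocity_in_tangent_space[OF assms(2-4)]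
  by (auto simp: speed_def conformal_weight_def less_imp_le)

lemma speed_cong:
  assumes "\<forall>\<^sub>F s in nhds t. \<gamma> s = \<beta> s"
  shows "speed \<rho> \<gamma> t = speed \<rho> \<beta> t"
proof -
  have t: "\<gamma> t = \<beta> t" using assms eventually_nhds_x_imp_x by blast
  have "velocity M \<gamma> t c = velocity M \<beta> t c" for c
  proof -
    have "\<forall>\<^sub>F s in nhds t. (cmap c \<circ> \<gamma>) s = (cmap c \<circ> \<beta>) s" "\<forall>\<^sub>F s in nhds t. (cmap c \<circ> \<beta>) s = (cmap c \<circ> \<gamma>) s"
      using assms by (auto elim: eventually_mono)
    then have "((cmap c \<circ> \<gamma>) has_vector_derivative w) (at t) \<longleftrightarrow> ((cmap c \<circ> \<beta>) has_vector_derivative w) (at t)" for w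
      using has_vector_derivative_eventually_cong by metis
    then show ?thesis using t by (simp add: velocity_def vector_derivative_def)
  qed
  then have "velocity M \<gamma> t = velocity M \<beta> t" by (rule ext)
  with t show ?thesis by (simp add: speed_def)
qed

definition len :: "('a \<Rightarrow> real) \<Rightarrow> (real \<Rightarrow> 'a) \<Rightarrow> real \<Rightarrow> real \<Rightarrow> real" where
  "len \<rho> \<gamma> a b = integral {a..b} (speed \<rho> \<gamma>)"

lemma pw_smooth_speed_integrable:
  assumes "conformal_weight M \<rho>" "pw_smooth \<gamma> a b"
  shows "speed \<rho> \<gamma> integrable_on {a..b}"
  using assms(2)
proof (induction rule: pw_smooth.induct)
  case (piece a b)
  then show ?case
    using smooth_path_speed_integrable assms(1) by (simp add: conformal_weight_def)
next
  case (append a b c)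
  then show ?case
    using Henstock_Kurzweil_Integration.integrable_combine[of a b c] pw_smooth_less by (meson less_imp_le)
qed

lemma len_append:
  assumes "conformal_weight M \<rho>" "pw_smooth \<gamma> a b" "pw_smooth \<gamma> b c"
  shows "len \<rho> \<gamma> a c = len \<rho> \<gamma> a b + len \<rho> \<gamma> b c"
  unfolding len_def
  using Henstock_Kurzweil_Integration.integral_combine[OF _ _
      pw_smooth_speed_integrable[OF assms(1) pw_smooth.append[OF assms(2,3)]], of b]
    pw_smooth_less[OF assms(2)] pw_smooth_less[OF assms(3)] by simp

text \<open>End points are negligible for the integral, so the pointwise estimate is asked on open pieces,
  where velocities are meaningful.\<close>

lemma len_mono:
  assumes w: "conformal_weight M \<rho>" "conformal_weight M \<sigma>" and "pw_smooth \<gamma> a b" "pw_smooth \<beta> a b"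
    and "\<And>I t. I \<subseteq> {a..b} \<Longrightarrow> open I \<Longrightarrow> smooth_path_on M I \<gamma> \<Longrightarrow> t \<in> I \<Longrightarrow> speed \<rho> \<beta> t \<le> K * speed \<sigma> \<gamma> t"
  shows "len \<rho> \<beta> a b \<le> K * len \<sigma> \<gamma> a b"
  using assms(3-)
proof (induction rule: pw_smooth.induct)
  case (piece a b)
  have "integral {a..b} (speed \<rho> \<beta>) \<le> integral {a..b} (\<lambda>t. K * speed \<sigma> \<gamma> t)"
  proof (rule integral_le_open_interval)
    show "(\<lambda>t. K * speed \<sigma> \<gamma> t) integrable_on {a..b}"
      using pw_smooth_speed_integrable[OF w(2) pw_smooth.piece[OF piece(1,2)]]
      by (rule integrable_on_mult_right)
    show "speed \<rho> \<beta> t \<le> K * speed \<sigma> \<gamma> t" if "a < t" "t < b" for t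
      by (rule piece(4)[of "{a<..<b}"]) (use that piece(2) in \<open>auto intro: smooth_path_on_subset\<close>)
  qed (rule pw_smooth_speed_integrable[OF w(1) piece(3)])
  then show ?case by (simp add: len_def)
next
  case (append a b c)
  have ab: "a < b" "b < c" using append pw_smooth_less by auto
  note \<beta> = pw_smooth_restrict[OF append.prems(1) ab]
  have sub: "{a..b} \<subseteq> {a..c}" "{b..c} \<subseteq> {a..c}" using ab by auto
  have "len \<rho> \<beta> a b \<le> K * len \<sigma> \<gamma> a b"
    by (rule append.IH(1)[OF conjunct1[OF \<beta>]]) (rule append.prems(2)[OF order_trans[OF _ sub(1)]])
  moreover have "len \<rho> \<beta> b c \<le> K * len \<sigma> \<gamma> b c"
    by (rule append.IH(2)[OF conjunct2[OF \<beta>]]) (rule append.prems(2)[OF order_trans[OF _ sub(2)]])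
  ultimately show ?case
    using len_append[OF w(1), of \<beta> a b c] len_append[OF w(2) append.hyps(1,2)] \<beta> by (simp add: distrib_left)
qed

lemma len_nonneg:
  assumes "conformal_weight M \<rho>" "pw_smooth \<gamma> a b"
  shows "len \<rho> \<gamma> a b \<ge> 0"
  using assms(2)
proof (induction rule: pw_smooth.induct)
  case (piece a b)
  have "integral {a..b} (\<lambda>t. 0) \<le> integral {a..b} (speed \<rho> \<gamma>)"
  proof (rule integral_le_open_interval)
    show "0 \<le> speed \<rho> \<gamma> t" if "a < t" "t < b" for t
      by (rule speed_nonneg[OF assms(1), of "{a<..<b}"]) (use that piece in \<open>auto intro: smooth_path_on_subset\<close>)
  qed (use pw_smooth_speed_integrable[OF assms(1) pw_smooth.piece[OF piece]] in auto)
  then show ?case by (simp add: len_def)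
next
  case (append a b c)
  then show ?case using len_append[OF assms(1) append.hyps(1,2)] by simp
qed

lemma len_initial_le:
  assumes "conformal_weight M \<rho>" "pw_smooth \<gamma> a b" "a < t" "t \<le> b"
  shows "len \<rho> \<gamma> a t \<le> len \<rho> \<gamma> a b"
proof (cases "t = b")
  case False
  then have "pw_smooth \<gamma> a t" "pw_smooth \<gamma> t b" using pw_smooth_restrict[OF assms(2,3)] assms(4) by auto
  then show ?thesis using len_append[OF assms(1), of \<gamma> a t b] len_nonneg[OF assms(1), of \<gamma> t b] by simp
qed simp

lemma pw_smooth_affine:
  assumes "pw_smooth \<gamma> a b" "p > 0"
  shows "pw_smooth (\<lambda>t. \<gamma> (p * t + q)) ((a - q) / p) ((b - q) / p)"
  using assms(1)
proof (induction rule: pw_smooth.induct)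
  case (piece a b)
  have "smooth_path_on M {(a - q) / p..(b - q) / p} (\<lambda>t. \<gamma> (p * t + q))"
    by (rule smooth_path_on_affine[OF piece(2)]) (use assms(2) in \<open>auto simp: field_simps\<close>)
  then show ?case using piece(1) assms(2) by (auto intro!: pw_smooth.piece divide_strict_right_mono)
qed (auto intro: pw_smooth.append)

lemma pw_smooth_reverse:
  assumes "pw_smooth \<gamma> a b"
  shows "pw_smooth (\<lambda>t. \<gamma> (q - t)) (q - b) (q - a)"
  using assms
proof (induction rule: pw_smooth.induct)
  case (piece a b)
  have "smooth_path_on M {q - b..q - a} (\<lambda>t. \<gamma> (-1 * t + q))"
    by (rule smooth_path_on_affine[OF piece(2)]) auto
  then show ?case using piece(1) by (auto intro!: pw_smooth.piece)
qed (auto intro: pw_smooth.append)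

lemma len_affine_piece:
  assumes w: "conformal_weight M \<rho>" and \<gamma>: "smooth_path_on M {a..b} \<gamma>" "a < b" and p: "p \<noteq> 0"
    and im: "(\<lambda>t. p * t + q) ` {a'..b'} = {a..b}"
  shows "len \<rho> (\<lambda>t. \<gamma> (p * t + q)) a' b' = len \<rho> \<gamma> a b"
proof -
  have inv: "(\<lambda>x. (1 / p) *\<^sub>R x + - ((1 / p) *\<^sub>R q)) ` cbox a b = {a'..b'}"
    unfolding box_real im[symmetric] using p by (auto simp: image_image field_simps intro!: image_eqI)
  have "(speed \<rho> \<gamma> has_integral len \<rho> \<gamma> a b) (cbox a b)"
    using pw_smooth_speed_integrable[OF w pw_smooth.piece[OF \<gamma>(2,1)]] by (simp add: len_def integrable_integral)
  from has_integral_affinity[OF this p, of q]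
  have "((\<lambda>t. speed \<rho> \<gamma> (p * t + q)) has_integral (1 / \<bar>p\<bar>) * len \<rho> \<gamma> a b) {a'..b'}"
    unfolding inv by simp
  then have "((\<lambda>t. \<bar>p\<bar> * speed \<rho> \<gamma> (p * t + q)) has_integral \<bar>p\<bar> * ((1 / \<bar>p\<bar>) * len \<rho> \<gamma> a b)) {a'..b'}"
    by (rule has_integral_mult_right)
  from integral_unique[OF this]
  have "integral {a'..b'} (\<lambda>t. \<bar>p\<bar> * speed \<rho> \<gamma> (p * t + q)) = len \<rho> \<gamma> a b"
    using p by simp
  moreover have "integral {a'..b'} (speed \<rho> (\<lambda>t. \<gamma> (p * t + q))) = integral {a'..b'} (\<lambda>t. \<bar>p\<bar> * speed \<rho> \<gamma> (p * t + q))"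
  proof (rule integral_cong_open_interval)
    fix t assume t: "a' < t" "t < b'"
    have "{a..b} = (if 0 \<le> p then {p * a' + q..p * b' + q} else {p * b' + q..p * a' + q})"
      using image_affinity_atLeastAtMost[of p q a' b'] im t by auto
    then have "p * t + q \<in> {a<..<b}"
      using t p \<gamma>(2) by (auto split: if_splits simp: Icc_eq_Icc)
    then show "speed \<rho> (\<lambda>t. \<gamma> (p * t + q)) t = \<bar>p\<bar> * speed \<rho> \<gamma> (p * t + q)"
      by (intro speed_affine[of "{a<..<b}"] smooth_path_on_subset[OF \<gamma>(1)]) auto
  qed
  ultimately show ?thesis by (simp add: len_def)
qed

lemma len_affine:
  assumes w: "conformal_weight M \<rho>" and "pw_smooth \<gamma> a b" and p: "p > 0"
  shows "len \<rho> (\<lambda>t. \<gamma> (p * t + q)) ((a - q) / p) ((b - q) / p) = len \<rho> \<gamma> a b"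
  using assms(2)
proof (induction rule: pw_smooth.induct)
  case (piece a b)
  show ?case
    by (rule len_affine_piece[OF w piece(2,1)])
      (use p piece(1) in \<open>auto simp: image_affinity_atLeastAtMost divide_right_mono\<close>)
next
  case (append a b c)
  then show ?case
    using len_append[OF w pw_smooth_affine[OF append(1) p] pw_smooth_affine[OF append(2) p]]
      len_append[OF w append(1,2)] by simp
qed

lemma len_reverse:
  assumes w: "conformal_weight M \<rho>" and "pw_smooth \<gamma> a b"
  shows "len \<rho> (\<lambda>t. \<gamma> (q - t)) (q - b) (q - a) = len \<rho> \<gamma> a b"
  using assms(2)
proof (induction rule: pw_smooth.induct)
  case (piece a b)
  have "len \<rho> (\<lambda>t. \<gamma> (-1 * t + q)) (q - b) (q - a) = len \<rho> \<gamma> a b"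
    by (rule len_affine_piece[OF w piece(2,1)]) (use piece(1) in \<open>auto simp only: image_affinity_atLeastAtMost, auto\<close>)
  then show ?case by simp
next
  case (append a b c)
  then show ?case
    using len_append[OF w pw_smooth_reverse[OF append(2), of q] pw_smooth_reverse[OF append(1), of q]]
      len_append[OF w append(1,2)] by simp
qed

lemma pw_smooth_cong:
  assumes "pw_smooth \<gamma> a b" "\<And>t. t \<in> {a..b} \<Longrightarrow> \<gamma> t = \<beta> t"
  shows "pw_smooth \<beta> a b"
  using assms(1) by (rule pw_smooth_map) (use assms(2) in \<open>auto intro!: smooth_path_on_cong[of _ \<gamma>]\<close>)

lemma len_cong:
  assumes "\<And>t. t \<in> {a..b} \<Longrightarrow> \<gamma> t = \<beta> t"
  shows "len \<rho> \<gamma> a b = len \<rho> \<beta> a b"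
  unfolding len_def
proof (rule integral_cong_open_interval)
  fix t assume "a < t" "t < b"
  then show "speed \<rho> \<gamma> t = speed \<rho> \<beta> t"
    using assms by (intro speed_cong) (auto simp: eventually_nhds intro!: exI[of _ "{a<..<b}"])
qed


section \<open>Distances measured by paths in a subset\<close>

definition paths_in :: "'a set \<Rightarrow> 'a \<Rightarrow> 'a \<Rightarrow> (real \<Rightarrow> 'a) set" where
  "paths_in S x y = {\<gamma>. pw_smooth \<gamma> 0 1 \<and> \<gamma> ` {0..1} \<subseteq> S \<and> \<gamma> 0 = x \<and> \<gamma> 1 = y}"

text \<open>With \<open>S\<close> the whole manifold this is the induced distance; with \<open>S\<close> a level set it is the induced
  distance of the level manifold, whose paths have the same length there and in \<open>M\<close>.\<close>

definition path_dist :: "('a \<Rightarrow> real) \<Rightarrow> 'a set \<Rightarrow> 'a \<Rightarrow> 'a \<Rightarrow> ennreal" where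
  "path_dist \<rho> S x y = (INF \<gamma>\<in>paths_in S x y. ennreal (len \<rho> \<gamma> 0 1))"

lemma path_dist_le: "\<gamma> \<in> paths_in S x y \<Longrightarrow> path_dist \<rho> S x y \<le> ennreal (len \<rho> \<gamma> 0 1)"
  unfolding path_dist_def by (rule INF_lower)

lemma path_dist_less:
  assumes "path_dist \<rho> S x y < e"
  obtains \<gamma> where "\<gamma> \<in> paths_in S x y" "ennreal (len \<rho> \<gamma> 0 1) < e"
  using assms unfolding path_dist_def INF_less_iff by blast

lemma path_dist_commute:
  assumes w: "conformal_weight M \<rho>"
  shows "path_dist \<rho> S x y = path_dist \<rho> S y x"
proof -
  have "path_dist \<rho> S y x \<le> path_dist \<rho> S x y" for x y
    unfolding path_dist_def[of \<rho> S x y]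
  proof (rule INF_greatest)
    fix \<gamma> assume "\<gamma> \<in> paths_in S x y"
    then have \<gamma>: "pw_smooth \<gamma> 0 1" "\<gamma> ` {0..1} \<subseteq> S" "\<gamma> 0 = x" "\<gamma> 1 = y" by (auto simp: paths_in_def)
    have "(\<lambda>t. \<gamma> (1 - t)) \<in> paths_in S y x"
      using pw_smooth_reverse[OF \<gamma>(1), of 1] \<gamma> by (auto simp: paths_in_def)
    then show "path_dist \<rho> S y x \<le> ennreal (len \<rho> \<gamma> 0 1)"
      using path_dist_le[of _ S y x \<rho>] len_reverse[OF w \<gamma>(1), of 1] by fastforce
  qed
  then show ?thesis by (simp add: antisym)
qed

lemma path_dist_triangle:
  assumes w: "conformal_weight M \<rho>"
  shows "path_dist \<rho> S x z \<le> path_dist \<rho> S x y + path_dist \<rho> S y z"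
proof -
  have *: "path_dist \<rho> S x z \<le> ennreal (len \<rho> \<gamma> 0 1) + ennreal (len \<rho> \<beta> 0 1)"
    if "\<gamma> \<in> paths_in S x y" "\<beta> \<in> paths_in S y z" for \<gamma> \<beta>
  proof -
    have \<gamma>: "pw_smooth \<gamma> 0 1" "\<gamma> ` {0..1} \<subseteq> S" "\<gamma> 0 = x" "\<gamma> 1 = y" and
      \<beta>: "pw_smooth \<beta> 0 1" "\<beta> ` {0..1} \<subseteq> S" "\<beta> 0 = y" "\<beta> 1 = z"
      using that by (auto simp: paths_in_def)
    define \<eta> where "\<eta> = (\<lambda>t. if t \<le> 1/2 then \<gamma> (2 * t + 0) else \<beta> (2 * t + - 1))"
    have 1: "\<gamma> (2 * t + 0) = \<eta> t" if "t \<in> {0..1/2}" for t using that by (auto simp: \<eta>_def)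
    have 2: "\<beta> (2 * t + - 1) = \<eta> t" if "t \<in> {1/2..1}" for t
    proof (cases "t = 1/2")
      case True
      show ?thesis unfolding True using \<gamma>(4) \<beta>(3) by (simp add: \<eta>_def)
    qed (use that in \<open>auto simp: \<eta>_def\<close>)
    have p1: "pw_smooth (\<lambda>t. \<gamma> (2 * t + 0)) 0 (1/2)" and l1: "len \<rho> (\<lambda>t. \<gamma> (2 * t + 0)) 0 (1/2) = len \<rho> \<gamma> 0 1"
      using pw_smooth_affine[OF \<gamma>(1), of 2 0] len_affine[OF w \<gamma>(1), of 2 0] by simp_all
    have p2: "pw_smooth (\<lambda>t. \<beta> (2 * t + - 1)) (1/2) 1" and l2: "len \<rho> (\<lambda>t. \<beta> (2 * t + - 1)) (1/2) 1 = len \<rho> \<beta> 0 1"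
      using pw_smooth_affine[OF \<beta>(1), of 2 "-1"] len_affine[OF w \<beta>(1), of 2 "-1"] by simp_all
    have q: "pw_smooth \<eta> 0 (1/2)" "pw_smooth \<eta> (1/2) 1"
      by (rule pw_smooth_cong[OF p1 1] pw_smooth_cong[OF p2 2]; assumption)+
    have "\<eta> ` {0..1} \<subseteq> S"
      using \<gamma>(2) \<beta>(2) by (auto simp: \<eta>_def image_subset_iff)
    then have "\<eta> \<in> paths_in S x z"
      using pw_smooth.append[OF q] \<gamma>(3) \<beta>(4) by (auto simp: paths_in_def \<eta>_def)
    moreover have "len \<rho> \<eta> 0 1 = len \<rho> \<gamma> 0 1 + len \<rho> \<beta> 0 1"
      using len_append[OF w q] len_cong[of 0 "1/2" "\<lambda>t. \<gamma> (2 * t + 0)" \<eta>] len_cong[of "1/2" 1 "\<lambda>t. \<beta> (2 * t + - 1)" \<eta>] 1 2 l1 l2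
      by metis
    ultimately show ?thesis
      using path_dist_le[of \<eta> S x z \<rho>] len_nonneg[OF w \<gamma>(1)] len_nonneg[OF w \<beta>(1)] by simp
  qed
  show ?thesis
  proof (rule ennreal_le_epsilon)
    fix e :: real assume e: "e > 0" and fin: "path_dist \<rho> S x y + path_dist \<rho> S y z < top"
    have "path_dist \<rho> S x y < path_dist \<rho> S x y + ennreal (e/2)" "path_dist \<rho> S y z < path_dist \<rho> S y z + ennreal (e/2)"
      using fin e by (auto intro!: ennreal_less_add)
    then obtain \<gamma> \<beta> where "\<gamma> \<in> paths_in S x y" "ennreal (len \<rho> \<gamma> 0 1) < path_dist \<rho> S x y + ennreal (e/2)"
      "\<beta> \<in> paths_in S y z" "ennreal (len \<rho> \<beta> 0 1) < path_dist \<rho> S y z + ennreal (e/2)"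
      by (metis path_dist_less)
    then have "path_dist \<rho> S x z \<le> (path_dist \<rho> S x y + ennreal (e/2)) + (path_dist \<rho> S y z + ennreal (e/2))"
      using * by (meson add_mono less_imp_le order_trans)
    also have "\<dots> = path_dist \<rho> S x y + path_dist \<rho> S y z + (ennreal (e/2) + ennreal (e/2))"
      by (simp add: ac_simps)
    also have "ennreal (e/2) + ennreal (e/2) = ennreal e" using e by (simp flip: ennreal_plus)
    finally show "path_dist \<rho> S x z \<le> path_dist \<rho> S x y + path_dist \<rho> S y z + ennreal e" .
  qed
qed

lemma path_dist_refl:
  assumes "x \<in> S" "S \<subseteq> pts M"
  shows "path_dist \<rho> S x x = 0"
proof -
  have x: "x \<in> pts M" using assms by blast
  have "pw_smooth (\<lambda>t. x) 0 1" by (rule pw_smooth.piece[OF zero_less_one constant_path[OF x]])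
  then have "(\<lambda>t. x) \<in> paths_in S x x" using assms by (auto simp: paths_in_def)
  moreover have "len \<rho> (\<lambda>t. x) 0 1 = 0"
  proof -
    have "(\<lambda>c. 0) \<in> tangent_space M x"
      using velocity_in_tangent_space[OF constant_path[OF x] open_UNIV UNIV_I] velocity_constant_path by metis
    from pseudo_riemannian_square[OF pseudo_riem x this this, of 0 0] this
    have "speed \<rho> (\<lambda>t. x) = (\<lambda>t. 0)" by (auto simp: speed_def velocity_constant_path)
    then show ?thesis by (simp add: len_def)
  qed
  ultimately show ?thesis using path_dist_le[of "\<lambda>t. x" S x x \<rho>] by simp
qed

text \<open>Reversing and concatenating paths gives symmetry and the triangle inequality. Finiteness and
  separation depend on the manifold.\<close>

lemma path_dist_metric:
  assumes w: "conformal_weight M \<rho>" and S: "S \<subseteq> pts M"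
    and fin: "\<And>x y. x \<in> S \<Longrightarrow> y \<in> S \<Longrightarrow> path_dist \<rho> S x y < \<infinity>"
    and zero: "\<And>x y. x \<in> S \<Longrightarrow> y \<in> S \<Longrightarrow> path_dist \<rho> S x y = 0 \<Longrightarrow> x = y"
  shows "Metric_space S (\<lambda>x y. enn2real (path_dist \<rho> S x y))"
proof
  fix x y z
  show "0 \<le> enn2real (path_dist \<rho> S x y)" by simp
  show "enn2real (path_dist \<rho> S x y) = enn2real (path_dist \<rho> S y x)"
    by (simp add: path_dist_commute[OF w])
  show "(enn2real (path_dist \<rho> S x y) = 0) = (x = y)" if "x \<in> S" "y \<in> S"
    using fin[OF that] zero[OF that] path_dist_refl[OF that(1) S] by (auto simp: enn2real_eq_0_iff)
  show "enn2real (path_dist \<rho> S x z) \<le> enn2real (path_dist \<rho> S x y) + enn2real (path_dist \<rho> S y z)"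
    if "x \<in> S" "y \<in> S" "z \<in> S"
  proof -
    have "enn2real (path_dist \<rho> S x z) \<le> enn2real (path_dist \<rho> S x y + path_dist \<rho> S y z)"
      using path_dist_triangle[OF w] fin that by (intro enn2real_mono) auto
    then show ?thesis using fin that by (simp add: enn2real_plus)
  qed
qed

end


section \<open>The metric of a homogeneous pair along paths\<close>

locale homogeneous_metric = smooth_action M m + riemannian M g
  for M :: "('a, 'e::euclidean_space) manifold" and m g +
  fixes \<alpha> :: real and f :: "'a \<Rightarrow> real"
  assumes pair: "homogeneous_pair M m \<alpha> g f"
begin

lemma metric_sym: "x \<in> pts M \<Longrightarrow> \<xi> \<in> tangent_space M x \<Longrightarrow> \<zeta> \<in> tangent_space M x \<Longrightarrow> g x \<xi> \<zeta> = g x \<zeta> \<xi>"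
  using pseudo_riem by (simp add: pseudo_riemannian_def)

lemma f_continuous: "continuous_map (mtop M) (top_of_set {0<..}) f"
  using pair by (simp add: homogeneous_pair_def smooth_map_def Rpos_def)

lemma f_pos: "x \<in> pts M \<Longrightarrow> f x > 0"
  using f_continuous by (auto simp: continuous_map_in_subtopology)

lemma f_smooth:
  assumes "c \<in> atlas M"
  shows "smooth_on (cmap c ` cdom c) (f \<circ> cinv c)"
proof -
  have "smooth_on (cmap c ` {x \<in> cdom c. f x \<in> {0<..}}) (f \<circ> cinv c)"
    using pair assms by (simp add: homogeneous_pair_def smooth_map_def Rpos_def o_def)
  moreover have "{x \<in> cdom c. f x \<in> {0<..}} = cdom c"
    using f_pos is_chart_subset[OF atlas_is_chart[OF assms]] by auto
  ultimately show ?thesis by simp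
qed

lemma f_action: "r > 0 \<Longrightarrow> x \<in> pts M \<Longrightarrow> f (m r x) = r powr \<alpha> * f x"
  using pair by (simp add: homogeneous_pair_def)

lemma alpha_nonzero: "\<alpha> \<noteq> 0"
  using pair by (simp add: homogeneous_pair_def)

abbreviation euler :: "'a \<Rightarrow> ('a, 'e) tvec" where
  "euler \<equiv> euler_field M m"

text \<open>Along a path, \<open>g(P, \<sqdot>) = df\<close> becomes a formula for the derivative of \<open>f\<close>.\<close>

lemma f_along_path:
  assumes "smooth_path_on M I \<gamma>" "open I" "t \<in> I"
  shows "((\<lambda>s. f (\<gamma> s)) has_real_derivative g (\<gamma> t) (euler (\<gamma> t)) (velocity M \<gamma> t)) (at t)"
proof -
  have "g (\<gamma> t) (euler (\<gamma> t)) (velocity M \<gamma> t) = differential M f (\<gamma> t) (velocity M \<gamma> t)"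
    using pair path_in_pts[OF assms(1,3)] velocity_in_tangent_space[OF assms] by (simp add: homogeneous_pair_def)
  then show ?thesis
    using function_along_path_has_vector_derivative[OF f_smooth assms]
    by (simp add: has_real_derivative_iff_has_vector_derivative)
qed

text \<open>Both sides are the derivative at \<open>s = 0\<close> of \<open>f (m (exp s) x) = exp (\<alpha> s) f x\<close>.\<close>

lemma euler_square:
  assumes x: "x \<in> pts M"
  shows "g x (euler x) (euler x) = \<alpha> * f x"
proof -
  have "((\<lambda>s. f (m (exp s) x)) has_real_derivative g x (euler x) (euler x)) (at 0)"
    using f_along_path[OF flow_path[OF x, of UNIV 1] open_UNIV UNIV_I, of 0]
    by (simp add: euler_field_def action_one[OF x])
  moreover have "(\<lambda>s. f (m (exp s) x)) = (\<lambda>s. exp (\<alpha> * s) * f x)"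
    by (simp add: f_action[OF _ x] powr_def)
  moreover have "((\<lambda>s. exp (\<alpha> * s) * f x) has_real_derivative \<alpha> * f x) (at 0)"
    by (auto intro!: derivative_eq_intros)
  ultimately show ?thesis using DERIV_unique by metis
qed

text \<open>Positivity of the metric on the Euler field determines the sign of the degree.\<close>

lemma alpha_pos:
  assumes x: "x \<in> pts M"
  shows "\<alpha> > 0"
proof -
  have "\<alpha> * f x \<ge> 0"
    using metric_nonneg[OF x euler_field_in_tangent_space[OF x]] euler_square[OF x] by simp
  then show ?thesis
    using f_pos[OF x] alpha_nonzero by (metis mult_neg_pos not_less order_less_le)
qed

text \<open>Positivity of \<open>g\<close> on a combination of \<open>P\<close> and \<open>\<xi>\<close> that is orthogonal to \<open>P\<close>.\<close>

lemma euler_cauchy_schwarz: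
  assumes x: "x \<in> pts M" and \<xi>: "\<xi> \<in> tangent_space M x"
  shows "(g x (euler x) \<xi>)\<^sup>2 \<le> \<alpha> * f x * g x \<xi> \<xi>"
proof -
  let ?P = "euler x" and ?h = "\<alpha> * f x"
  have P: "?P \<in> tangent_space M x" using euler_field_in_tangent_space[OF x] .
  have h: "?h > 0" using alpha_pos[OF x] f_pos[OF x] by simp
  note T = tangent_space_lincomb[OF P \<xi>, of "- g x ?P \<xi>" "?h"]
  have "0 \<le> (- g x ?P \<xi>)\<^sup>2 * ?h + 2 * (- g x ?P \<xi>) * ?h * g x ?P \<xi> + ?h\<^sup>2 * g x \<xi> \<xi>"
    using metric_nonneg[OF x T] pseudo_riemannian_square[OF pseudo_riem x P \<xi> T] euler_square[OF x] by simp
  also have "\<dots> = ?h * (?h * g x \<xi> \<xi> - (g x ?P \<xi>)\<^sup>2)"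
    by (simp add: power2_eq_square algebra_simps)
  finally show ?thesis using h by (simp add: zero_le_mult_iff)
qed

text \<open>A fixed group element multiplies \<open>g\<close> by \<open>r powr \<alpha>\<close>, and \<open>f\<close> by the same factor. Differentiating
  the latter along the path gives the second equation.\<close>

lemma frozen_speed:
  assumes g: "smooth_path_on M I \<gamma>" "open I" "t \<in> I" and r: "r > 0"
  defines "\<beta> \<equiv> \<lambda>s. m r (\<gamma> s)"
  shows "g (\<beta> t) (velocity M \<beta> t) (velocity M \<beta> t) = r powr \<alpha> * g (\<gamma> t) (velocity M \<gamma> t) (velocity M \<gamma> t)"
    and "g (\<beta> t) (euler (\<beta> t)) (velocity M \<beta> t) = r powr \<alpha> * g (\<gamma> t) (euler (\<gamma> t)) (velocity M \<gamma> t)"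
proof -
  have x: "\<gamma> t \<in> pts M" using path_in_pts g by blast
  have "pullback M M (m r) g (\<gamma> t) (velocity M \<gamma> t) (velocity M \<gamma> t) =
      r powr \<alpha> * g (\<gamma> t) (velocity M \<gamma> t) (velocity M \<gamma> t)"
    using pair x r velocity_in_tangent_space[OF g] by (simp add: homogeneous_pair_def)
  then show "g (\<beta> t) (velocity M \<beta> t) (velocity M \<beta> t) = r powr \<alpha> * g (\<gamma> t) (velocity M \<gamma> t) (velocity M \<gamma> t)"
    using velocity_pushforward[OF g r] by (simp add: pullback_def \<beta>_def)
  have \<beta>: "smooth_path_on M I \<beta>"
    unfolding \<beta>_def by (rule moved_path[OF g(1) smooth_on_const r])
  have "((\<lambda>s. r powr \<alpha> * f (\<gamma> s)) has_real_derivative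
      r powr \<alpha> * g (\<gamma> t) (euler (\<gamma> t)) (velocity M \<gamma> t)) (at t)"
    using DERIV_cmult[OF f_along_path[OF g]] .
  moreover have "\<forall>\<^sub>F s in nhds t. r powr \<alpha> * f (\<gamma> s) = f (\<beta> s)"
    unfolding eventually_nhds \<beta>_def using g f_action[OF r path_in_pts[OF g(1)]] by metis
  ultimately have "((\<lambda>s. f (\<beta> s)) has_real_derivative
      r powr \<alpha> * g (\<gamma> t) (euler (\<gamma> t)) (velocity M \<gamma> t)) (at t)"
    unfolding has_real_derivative_iff_has_vector_derivative by (rule has_vector_derivative_eventually_cong)
  then show "g (\<beta> t) (euler (\<beta> t)) (velocity M \<beta> t) = r powr \<alpha> * g (\<gamma> t) (euler (\<gamma> t)) (velocity M \<gamma> t)"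
    using f_along_path[OF \<beta> g(2,3)] DERIV_unique by blast
qed

text \<open>The group element is chosen such that its power \<open>\<alpha>\<close> is \<open>l / f x\<close>, the factor from \<open>f x\<close> to \<open>l\<close>.\<close>

definition level_proj :: "real \<Rightarrow> 'a \<Rightarrow> 'a" where
  "level_proj l x = m ((l / f x) powr (1 / \<alpha>)) x"

lemma level_proj_in_pts: "l > 0 \<Longrightarrow> x \<in> pts M \<Longrightarrow> level_proj l x \<in> pts M"
  and f_level_proj: "l > 0 \<Longrightarrow> x \<in> pts M \<Longrightarrow> f (level_proj l x) = l"
  and level_proj_id: "l > 0 \<Longrightarrow> x \<in> pts M \<Longrightarrow> f x = l \<Longrightarrow> level_proj l x = x"
  using f_pos[of x] alpha_nonzero action_one[of x] unfolding level_proj_def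
  by (auto simp: action_in_pts f_action powr_powr)

lemma level_proj_path:
  assumes g: "smooth_path_on M I \<gamma>" and l: "l > 0"
  shows "smooth_path_on M I (\<lambda>s. level_proj l (\<gamma> s))"
  unfolding level_proj_def
proof (rule moved_path[OF g])
  have f: "f (\<gamma> s) > 0" if "s \<in> I" for s using f_pos path_in_pts[OF g that] by blast
  have "smooth_on I ((\<lambda>y. (l * inverse y) powr (1 / \<alpha>)) \<circ> (\<lambda>s. f (\<gamma> s)))"
  proof (rule smooth_on_compose[OF smooth_on_function_along_path[OF f_smooth g]])
    have "Ck_on k {0<..} (\<lambda>y. (l * inverse y) powr (1 / \<alpha>))" for k
    proof (rule Ck_on_compose[OF _ _ _ _ Ck_on_powr])
      show "Ck_on k {0<..} (\<lambda>y. l * inverse y)"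
        by (intro Ck_on_mult Ck_on_const Ck_on_subset[OF Ck_on_inverse]) auto
    qed (use l in auto)
    then show "smooth_on {0<..} (\<lambda>y. (l * inverse y) powr (1 / \<alpha>))"
      by (intro smooth_onI_open[of "{0<..}"]) auto
  qed (use f in auto)
  then show "smooth_on I (\<lambda>s. (l / f (\<gamma> s)) powr (1 / \<alpha>))"
    by (simp add: o_def divide_inverse)
  show "(l / f (\<gamma> t)) powr (1 / \<alpha>) > 0" if "t \<in> I" for t using f[OF that] l by simp
qed

text \<open>Moving along the orbits kills the component of the velocity in the direction of the Euler
  field, which is orthogonal to the level sets, and rescales the rest.\<close>

lemma level_proj_speed:
  assumes g: "smooth_path_on M I \<gamma>" "open I" "t \<in> I" and l: "l > 0"
  defines "\<beta> \<equiv> \<lambda>s. level_proj l (\<gamma> s)"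
  shows "g (\<beta> t) (velocity M \<beta> t) (velocity M \<beta> t) \<le> l / f (\<gamma> t) * g (\<gamma> t) (velocity M \<gamma> t) (velocity M \<gamma> t)"
proof -
  define F where "F = f (\<gamma> t)"
  define F' where "F' = g (\<gamma> t) (euler (\<gamma> t)) (velocity M \<gamma> t)"
  define G where "G = g (\<gamma> t) (velocity M \<gamma> t) (velocity M \<gamma> t)"
  define r where "r = (\<lambda>s. (l / f (\<gamma> s)) powr (1 / \<alpha>))"
  define \<eta> where "\<eta> = (\<lambda>s. m (r t) (\<gamma> s))"
  have x: "\<gamma> t \<in> pts M" using path_in_pts g by blast
  have F: "F > 0" using f_pos[OF x] by (simp add: F_def)
  have a: "\<alpha> > 0" using alpha_pos[OF x] .
  have rt: "r t > 0" "r t powr \<alpha> = l / F" using F l a by (auto simp: r_def F_def powr_powr)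
  have "((\<lambda>s. f (\<gamma> s)) has_real_derivative F') (at t)"
    using f_along_path[OF g] by (simp add: F'_def)
  then have "((\<lambda>s. (l / f (\<gamma> s)) powr (1 / \<alpha>)) has_real_derivative
      (l / F) powr (1 / \<alpha>) * (0 * ln (l / F) + (- l * F' / F\<^sup>2) * (1 / \<alpha>) / (l / F))) (at t)"
    using F l by (auto intro!: derivative_eq_intros simp: F_def power2_eq_square powr_diff)
  then have r': "(r has_vector_derivative - (F' / (\<alpha> * F)) * r t) (at t)"
    unfolding has_real_derivative_iff_has_vector_derivative[symmetric] r_def F_def[symmetric]
    by (rule DERIV_cong) (use F l a in \<open>simp add: field_simps power2_eq_square\<close>)
  have \<eta>t: "\<eta> t = \<beta> t" and \<beta>r: "\<beta> = (\<lambda>s. m (r s) (\<gamma> s))"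
    by (auto simp: \<eta>_def \<beta>_def r_def level_proj_def)
  have y: "\<beta> t \<in> pts M" "f (\<beta> t) = l"
    using level_proj_in_pts[OF l x] f_level_proj[OF l x] by (auto simp: \<beta>_def)
  define b where "b = - (F' / (\<alpha> * F))"
  have V: "velocity M \<beta> t = (\<lambda>d. 1 *\<^sub>R velocity M \<eta> t d + b *\<^sub>R euler (\<beta> t) d)"
    using velocity_moved_path[OF g r' rt(1)] rt(1) \<eta>t by (simp add: \<beta>r \<eta>_def b_def)
  have \<eta>: "smooth_path_on M I \<eta>"
    unfolding \<eta>_def by (rule moved_path[OF g(1) smooth_on_const rt(1)])
  have T\<eta>: "velocity M \<eta> t \<in> tangent_space M (\<beta> t)"
    using velocity_in_tangent_space[OF \<eta> g(2,3)] \<eta>t by simp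
  have "velocity M \<beta> t \<in> tangent_space M (\<beta> t)"
    using velocity_in_tangent_space[OF level_proj_path[OF g(1) l] g(2,3)] by (simp add: \<beta>_def)
  then have "g (\<beta> t) (velocity M \<beta> t) (velocity M \<beta> t) =
      g (\<beta> t) (velocity M \<eta> t) (velocity M \<eta> t) + 2 * b * g (\<beta> t) (velocity M \<eta> t) (euler (\<beta> t)) + b\<^sup>2 * (\<alpha> * l)"
    unfolding V using pseudo_riemannian_square[OF pseudo_riem y(1) T\<eta> euler_field_in_tangent_space[OF y(1)], of 1 b]
      euler_square[OF y(1)] y(2) by simp
  also have "g (\<beta> t) (velocity M \<eta> t) (euler (\<beta> t)) = l / F * F'"
    using frozen_speed(2)[OF g rt(1)] metric_sym[OF y(1) T\<eta> euler_field_in_tangent_space[OF y(1)]]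
    by (simp add: \<eta>_def[symmetric] \<eta>t \<eta>t[unfolded \<eta>_def] rt(2) F'_def)
  also have "g (\<beta> t) (velocity M \<eta> t) (velocity M \<eta> t) = l / F * G"
    using frozen_speed(1)[OF g rt(1)] by (simp add: \<eta>_def[symmetric] \<eta>t \<eta>t[unfolded \<eta>_def] rt(2) G_def)
  also have "l / F * G + 2 * b * (l / F * F') + b\<^sup>2 * (\<alpha> * l) = l / F * G - l * F'\<^sup>2 / (\<alpha> * F\<^sup>2)"
    using F a by (simp add: b_def field_simps power2_eq_square)
  also have "\<dots> \<le> l / F * G" using l a by simp
  finally show ?thesis by (simp add: F_def G_def)
qed

end

section \<open>Comparison of the distances\<close>

context riemannian
begin

definition rpath_dist :: "('a \<Rightarrow> real) \<Rightarrow> 'a set \<Rightarrow> 'a \<Rightarrow> 'a \<Rightarrow> real" where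
  "rpath_dist \<rho> S x y = enn2real (path_dist \<rho> S x y)"

lemma path_dist_finite_iff: "path_dist \<rho> S x y < \<infinity> \<longleftrightarrow> paths_in S x y \<noteq> {}"
  by (auto simp: path_dist_def INF_less_iff)

lemma rpath_dist_le:
  assumes "conformal_weight M \<rho>" "\<gamma> \<in> paths_in S x y"
  shows "rpath_dist \<rho> S x y \<le> len \<rho> \<gamma> 0 1"
proof -
  have "len \<rho> \<gamma> 0 1 \<ge> 0" using assms len_nonneg by (auto simp: paths_in_def)
  then show ?thesis
    unfolding rpath_dist_def using enn2real_mono[OF path_dist_le[OF assms(2), of \<rho>]] by simp
qed

lemma rpath_dist_lessE:
  assumes "conformal_weight M \<rho>" "paths_in S x y \<noteq> {}" "rpath_dist \<rho> S x y < r"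
  obtains \<gamma> where "\<gamma> \<in> paths_in S x y" "len \<rho> \<gamma> 0 1 < r"
proof -
  have fin: "path_dist \<rho> S x y < \<infinity>" using assms(2) path_dist_finite_iff by blast
  have "0 \<le> rpath_dist \<rho> S x y" by (simp add: rpath_dist_def)
  with assms(3) have "r > 0" by linarith
  then have "path_dist \<rho> S x y < ennreal r"
    using assms(3) fin unfolding rpath_dist_def
    by (cases "path_dist \<rho> S x y") (auto simp: ennreal_less_iff)
  then obtain \<gamma> where \<gamma>: "\<gamma> \<in> paths_in S x y" "ennreal (len \<rho> \<gamma> 0 1) < ennreal r"
    by (rule path_dist_less)
  moreover have "len \<rho> \<gamma> 0 1 \<ge> 0" using assms(1) \<gamma>(1) len_nonneg by (auto simp: paths_in_def)
  ultimately show ?thesis using that by (simp add: ennreal_less_iff)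
qed

text \<open>Only paths of length below \<open>d\<close> compete for the infimum, so it suffices to compare these.\<close>

lemma rpath_dist_compare:
  assumes w: "conformal_weight M \<rho>" "conformal_weight M \<sigma>" and ne: "paths_in S x y \<noteq> {}"
    and d: "rpath_dist \<rho> S x y < d" and K: "K \<ge> 0"
    and path: "\<And>\<gamma>. \<gamma> \<in> paths_in S x y \<Longrightarrow> len \<rho> \<gamma> 0 1 < d \<Longrightarrow>
      \<exists>\<beta>\<in>paths_in T x y. len \<sigma> \<beta> 0 1 \<le> K * len \<rho> \<gamma> 0 1"
  shows "rpath_dist \<sigma> T x y \<le> K * rpath_dist \<rho> S x y"
proof (rule field_le_epsilon)
  fix e :: real assume e: "e > 0"
  \<comment> \<open>\<open>K + 1\<close> instead of \<open>K\<close>, as \<open>K\<close> may be \<open>0\<close>\<close>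
  have "rpath_dist \<rho> S x y < min d (rpath_dist \<rho> S x y + e / (K + 1))"
    using d e K by simp
  then obtain \<gamma> where \<gamma>: "\<gamma> \<in> paths_in S x y" "len \<rho> \<gamma> 0 1 < min d (rpath_dist \<rho> S x y + e / (K + 1))"
    using rpath_dist_lessE[OF w(1) ne] by blast
  then obtain \<beta> where \<beta>: "\<beta> \<in> paths_in T x y" "len \<sigma> \<beta> 0 1 \<le> K * len \<rho> \<gamma> 0 1"
    using path by auto
  have "rpath_dist \<sigma> T x y \<le> K * len \<rho> \<gamma> 0 1"
    using rpath_dist_le[OF w(2) \<beta>(1)] \<beta>(2) by simp
  also have "\<dots> \<le> K * (rpath_dist \<rho> S x y + e / (K + 1))"
    using \<gamma>(2) K by (intro mult_left_mono) auto
  also have "\<dots> \<le> K * rpath_dist \<rho> S x y + e"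
    using K e by (simp add: field_simps)
  finally show "rpath_dist \<sigma> T x y \<le> K * rpath_dist \<rho> S x y + e" .
qed

lemma paths_in_mono: "S \<subseteq> T \<Longrightarrow> paths_in S x y \<subseteq> paths_in T x y"
  by (auto simp: paths_in_def)

lemma conformal_weight_one: "conformal_weight M (\<lambda>_. 1)"
  by (simp add: conformal_weight_def)

end

context homogeneous_metric
begin

definition level :: "real \<Rightarrow> 'a set" where
  "level l = {x \<in> pts M. f x = l}"

lemma conformal_weight_f:
  assumes "continuous_on {0<..} v" "\<And>s. s > 0 \<Longrightarrow> v s > (0::real)"
  shows "conformal_weight M (v \<circ> f)"
proof -
  have "continuous_map (top_of_set {0<..}) euclideanreal v" using assms(1) by simp
  from continuous_map_compose[OF f_continuous this] show ?thesis
    using assms(2) f_pos by (simp add: conformal_weight_def)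
qed

text \<open>In the coordinate \<open>w \<circ> f\<close> with \<open>w' = sqrt (v / (\<alpha> s))\<close> the transversal part of the metric has
  unit length, so the change of this coordinate bounds the length of a path from below.\<close>

lemma radial_bound:
  assumes v: "continuous_on {0<..} v" "\<And>s. s > 0 \<Longrightarrow> v s > (0::real)"
    and w: "\<And>s. s > 0 \<Longrightarrow> (w has_real_derivative sqrt (v s / (\<alpha> * s))) (at s)"
    and \<gamma>: "pw_smooth \<gamma> a b"
  shows "\<bar>w (f (\<gamma> b)) - w (f (\<gamma> a))\<bar> \<le> len (v \<circ> f) \<gamma> a b"
  using \<gamma>
proof (induction rule: pw_smooth.induct)
  case (append a b c)
  then show ?case using len_append[OF conformal_weight_f[OF v] append.hyps(1,2)] by linarith
next
  case (piece a b)
  let ?I = "{a<..<b}"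
  define h' where "h' = (\<lambda>t. sqrt (v (f (\<gamma> t)) / (\<alpha> * f (\<gamma> t))) * g (\<gamma> t) (euler (\<gamma> t)) (velocity M \<gamma> t))"
  have I: "smooth_path_on M ?I \<gamma>" by (rule smooth_path_on_subset[OF piece(2)]) auto
  have fp: "f (\<gamma> t) > 0" if "t \<in> {a..b}" for t using f_pos path_in_pts[OF piece(2) that] by blast
  have der: "((\<lambda>s. w (f (\<gamma> s))) has_real_derivative h' t) (at t)" if "t \<in> ?I" for t
    unfolding h'_def
    by (rule DERIV_chain2[OF w f_along_path[OF I open_greaterThanLessThan that]]) (use fp that in auto)
  have "continuous_on {a..b} (\<lambda>s. f (\<gamma> s))"
    using smooth_on_imp_continuous_on[OF smooth_on_function_along_path[OF f_smooth piece(2)]] .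
  moreover have "continuous_on {0<..} w"
    using w by (auto intro!: continuous_at_imp_continuous_on DERIV_isCont)
  ultimately have cont: "continuous_on {a..b} (\<lambda>s. w (f (\<gamma> s)))"
    using continuous_on_compose2[of "{0<..}" w "{a..b}" "\<lambda>s. f (\<gamma> s)"] fp
    by (simp add: image_subset_iff)
  have int: "(h' has_integral (w (f (\<gamma> b)) - w (f (\<gamma> a)))) {a..b}"
    using der piece(1) by (intro fundamental_theorem_of_calculus_interior cont)
      (auto simp: has_real_derivative_iff_has_vector_derivative)
  have bound: "\<bar>h' t\<bar> \<le> speed (v \<circ> f) \<gamma> t" if t: "t \<in> ?I" for t
  proof -
    have x: "\<gamma> t \<in> pts M" using path_in_pts[OF I t] .
    have af: "\<alpha> * f (\<gamma> t) > 0" using alpha_pos[OF x] f_pos[OF x] by simp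
    let ?G = "g (\<gamma> t) (velocity M \<gamma> t) (velocity M \<gamma> t)"
    have "\<bar>h' t\<bar> = sqrt (v (f (\<gamma> t)) / (\<alpha> * f (\<gamma> t)) * (g (\<gamma> t) (euler (\<gamma> t)) (velocity M \<gamma> t))\<^sup>2)"
      using v(2)[OF f_pos[OF x]] alpha_pos[OF x] f_pos[OF x]
      by (simp add: h'_def real_sqrt_mult real_sqrt_divide abs_mult)
    also have "\<dots> \<le> sqrt (v (f (\<gamma> t)) / (\<alpha> * f (\<gamma> t)) * (\<alpha> * f (\<gamma> t) * ?G))"
      using euler_cauchy_schwarz[OF x velocity_in_tangent_space[OF I open_greaterThanLessThan t]]
        v(2)[OF f_pos[OF x]] af by (intro real_sqrt_le_mono mult_left_mono) auto
    also have "\<dots> = speed (v \<circ> f) \<gamma> t" using alpha_pos[OF x] f_pos[OF x] by (simp add: speed_def)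
    finally show ?thesis .
  qed
  have si: "speed (v \<circ> f) \<gamma> integrable_on {a..b}"
    using pw_smooth_speed_integrable[OF conformal_weight_f[OF v] pw_smooth.piece[OF piece]] .
  have "integral {a..b} h' \<le> integral {a..b} (speed (v \<circ> f) \<gamma>)"
    by (rule integral_le_open_interval) (use int si bound abs_le_D1 in auto)
  moreover have "integral {a..b} (\<lambda>t. - h' t) \<le> integral {a..b} (speed (v \<circ> f) \<gamma>)"
  proof (rule integral_le_open_interval)
    show "(\<lambda>t. - h' t) integrable_on {a..b}" using int by (auto intro: integrable_neg)
  qed (use si bound abs_le_D2 in auto)
  moreover have "integral {a..b} h' = w (f (\<gamma> b)) - w (f (\<gamma> a))"
    using int by (rule integral_unique)
  ultimately show ?case unfolding len_def integral_neg by linarith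
qed

lemma radial_coordinate:
  assumes v: "continuous_on {0<..} v" "\<And>s. s > 0 \<Longrightarrow> v s > (0::real)" and a: "\<alpha> > 0"
  obtains w where "\<And>s. s > 0 \<Longrightarrow> (w has_real_derivative sqrt (v s / (\<alpha> * s))) (at s)"
    "\<And>s t. 0 < s \<Longrightarrow> s < t \<Longrightarrow> w s < w t"
proof -
  have "isCont (\<lambda>s. sqrt (v s / (\<alpha> * s))) s" if "s > 0" for s
  proof -
    have "isCont v s" using v(1) that by (simp add: continuous_on_eq_continuous_at)
    then show ?thesis using that a by (intro continuous_intros) auto
  qed
  then obtain w where "\<forall>s::real. ereal 0 < ereal s \<longrightarrow> ereal s < \<infinity> \<longrightarrow> (w has_vector_derivative sqrt (v s / (\<alpha> * s))) (at s)"
    using einterval_antiderivative[of 0 \<infinity> "\<lambda>s. sqrt (v s / (\<alpha> * s))"] by (auto simp: zero_ereal_def)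
  then have w: "(w has_real_derivative sqrt (v s / (\<alpha> * s))) (at s)" if "s > 0" for s
    using that by (simp add: has_real_derivative_iff_has_vector_derivative)
  moreover have "w s < w t" if "0 < s" "s < t" for s t
  proof (rule DERIV_pos_imp_increasing[OF that(2)])
    fix x assume "s \<le> x"
    then have "x > 0" using that by simp
    then show "\<exists>y. (w has_real_derivative y) (at x) \<and> 0 < y"
      using w v(2) a by (intro exI[of _ "sqrt (v x / (\<alpha> * x))"]) auto
  qed
  ultimately show ?thesis using that by blast
qed

text \<open>The strictly increasing \<open>w\<close> of \<open>radial_coordinate\<close> separates \<open>l\<close> from \<open>l / 2\<close> and \<open>2 l\<close>, so by
  \<open>radial_bound\<close> it takes a definite length to leave the band.\<close>

lemma short_paths_in_band:
  assumes v: "continuous_on {0<..} v" "\<And>s. s > 0 \<Longrightarrow> v s > (0::real)" and a: "\<alpha> > 0" and l: "l > 0"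
  obtains d where "d > 0"
    "\<And>\<gamma> t. pw_smooth \<gamma> 0 1 \<Longrightarrow> f (\<gamma> 0) = l \<Longrightarrow> len (v \<circ> f) \<gamma> 0 1 < d \<Longrightarrow> t \<in> {0..1} \<Longrightarrow> f (\<gamma> t) \<in> {l/2..2*l}"
proof -
  obtain w where w: "\<And>s. s > 0 \<Longrightarrow> (w has_real_derivative sqrt (v s / (\<alpha> * s))) (at s)"
    "\<And>s t. 0 < s \<Longrightarrow> s < t \<Longrightarrow> w s < w t"
    using radial_coordinate[OF v a] by blast
  define d where "d = min (w (2 * l) - w l) (w l - w (l / 2))"
  have "d > 0" using w(2)[of l "2 * l"] w(2)[of "l/2" l] l by (simp add: d_def)
  moreover have "f (\<gamma> t) \<in> {l/2..2*l}"
    if \<gamma>: "pw_smooth \<gamma> 0 1" "f (\<gamma> 0) = l" "len (v \<circ> f) \<gamma> 0 1 < d" "t \<in> {0..1}" for \<gamma> t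
  proof (cases "t = 0")
    case True
    then show ?thesis using \<gamma>(2) l by simp
  next
    case False
    then have t: "0 < t" "t \<le> 1" using \<gamma>(4) by auto
    have "pw_smooth \<gamma> 0 t" using pw_smooth_restrict[OF \<gamma>(1), of t] \<gamma>(1) t by (cases "t = 1") auto
    from radial_bound[OF v w(1) this]
    have "\<bar>w (f (\<gamma> t)) - w l\<bar> < d"
      using len_initial_le[OF conformal_weight_f[OF v] \<gamma>(1) t] \<gamma>(2,3) by simp
    then have "w (f (\<gamma> t)) < w (2 * l)" "w (l / 2) < w (f (\<gamma> t))" by (auto simp: d_def)
    moreover have "f (\<gamma> t) > 0" using f_pos pw_smooth_in_pts[OF \<gamma>(1,4)] by blast
    ultimately have "\<not> 2 * l < f (\<gamma> t)" "\<not> f (\<gamma> t) < l / 2"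
      using w(2)[of "2 * l" "f (\<gamma> t)"] w(2)[of "f (\<gamma> t)" "l / 2"] l by auto
    then show ?thesis by simp
  qed
  ultimately show ?thesis using that by blast
qed

lemma band_bounds:
  fixes v :: "real \<Rightarrow> real"
  assumes v: "continuous_on {0<..} v" "\<And>s. s > 0 \<Longrightarrow> v s > 0" and l: "l > 0"
  obtains c C where "c > 0" "\<And>s. s \<in> {l/2..2*l} \<Longrightarrow> c \<le> v s \<and> v s \<le> C"
proof -
  have "continuous_on {l/2..2*l} v" using l by (intro continuous_on_subset[OF v(1)]) auto
  moreover have "compact {l/2..2*l}" "{l/2..2*l} \<noteq> {}" using l by auto
  ultimately obtain s\<^sub>0 s\<^sub>1 where "s\<^sub>0 \<in> {l/2..2*l}" "\<forall>s\<in>{l/2..2*l}. v s\<^sub>0 \<le> v s" "\<forall>s\<in>{l/2..2*l}. v s \<le> v s\<^sub>1"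
    using continuous_attains_inf[of "{l/2..2*l}" v] continuous_attains_sup[of "{l/2..2*l}" v] by blast
  then show ?thesis using that[of "v s\<^sub>0" "v s\<^sub>1"] v(2)[of s\<^sub>0] l by auto
qed

lemma level_proj_paths_in:
  assumes "\<gamma> \<in> paths_in (pts M) x y" "x \<in> level l" "y \<in> level l" "l > 0"
  shows "(\<lambda>t. level_proj l (\<gamma> t)) \<in> paths_in (level l) x y"
proof -
  have \<gamma>: "pw_smooth \<gamma> 0 1" "\<gamma> ` {0..1} \<subseteq> pts M" "\<gamma> 0 = x" "\<gamma> 1 = y"
    using assms(1) by (auto simp: paths_in_def)
  have "pw_smooth (\<lambda>t. level_proj l (\<gamma> t)) 0 1"
    by (rule pw_smooth_map[OF \<gamma>(1)]) (rule level_proj_path[OF _ assms(4)])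
  moreover have "level_proj l (\<gamma> t) \<in> level l" if "t \<in> {0..1}" for t
  proof -
    have "\<gamma> t \<in> pts M" using \<gamma>(2) that by blast
    then show ?thesis using level_proj_in_pts f_level_proj assms(4) by (simp add: level_def)
  qed
  ultimately show ?thesis
    using \<gamma>(3,4) assms level_proj_id by (auto simp: paths_in_def level_def)
qed

text \<open>Short paths stay in the band, where \<open>v\<close> has a positive lower bound \<open>c\<close>. The first estimate compares
  the two metrics on the same path. The second one projects the path to the level set, which costs a
  factor \<open>sqrt (l / f) \<le> sqrt 2\<close> by \<open>level_proj_speed\<close>.\<close>

lemma local_comparison:
  assumes v: "continuous_on {0<..} v" "\<And>s. s > 0 \<Longrightarrow> v s > (0::real)" and a: "\<alpha> > 0" and l: "l > 0"
  obtains d K where "d > 0" "K \<ge> 0"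
    "\<And>x y. x \<in> level l \<Longrightarrow> paths_in (pts M) x y \<noteq> {} \<Longrightarrow> rpath_dist (v \<circ> f) (pts M) x y < d \<Longrightarrow>
      rpath_dist (\<lambda>_. 1) (pts M) x y \<le> K * rpath_dist (v \<circ> f) (pts M) x y"
    "\<And>x y. x \<in> level l \<Longrightarrow> y \<in> level l \<Longrightarrow> paths_in (pts M) x y \<noteq> {} \<Longrightarrow> rpath_dist (v \<circ> f) (pts M) x y < d \<Longrightarrow>
      rpath_dist (\<lambda>_. 1) (level l) x y \<le> sqrt 2 * K * rpath_dist (v \<circ> f) (pts M) x y"
proof -
  obtain d where d: "d > 0" "\<And>\<gamma> t. pw_smooth \<gamma> 0 1 \<Longrightarrow> f (\<gamma> 0) = l \<Longrightarrow> len (v \<circ> f) \<gamma> 0 1 < d \<Longrightarrow>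
      t \<in> {0..1} \<Longrightarrow> f (\<gamma> t) \<in> {l/2..2*l}"
    using short_paths_in_band[OF v a l] by blast
  obtain c C where c: "c > 0" "\<And>s. s \<in> {l/2..2*l} \<Longrightarrow> c \<le> v s \<and> v s \<le> C"
    using band_bounds[OF v l] by blast
  define K where "K = 1 / sqrt c"
  note w = conformal_weight_f[OF v] and w1 = conformal_weight_one
  have K: "K \<ge> 0" using c(1) by (simp add: K_def)
  have len1: "len (\<lambda>_. 1) \<gamma> 0 1 \<le> K * len (v \<circ> f) \<gamma> 0 1"
    if \<gamma>: "pw_smooth \<gamma> 0 1" "f (\<gamma> 0) = l" "len (v \<circ> f) \<gamma> 0 1 < d" for \<gamma>
  proof (rule len_mono[OF w1 w \<gamma>(1,1)])
    fix I t assume I: "I \<subseteq> {0..1}" "open I" "smooth_path_on M I \<gamma>" "t \<in> I"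
    let ?G = "g (\<gamma> t) (velocity M \<gamma> t) (velocity M \<gamma> t)"
    have "v (f (\<gamma> t)) \<ge> c" using c(2) d(2)[OF \<gamma>] I(1,4) by blast
    then have "sqrt c * sqrt ?G \<le> sqrt (v (f (\<gamma> t)) * ?G)"
      using metric_nonneg[OF path_in_pts[OF I(3,4)] velocity_in_tangent_space[OF I(3,2,4)]]
      by (simp add: real_sqrt_mult[symmetric] mult_right_mono)
    then show "speed (\<lambda>_. 1) \<gamma> t \<le> K * speed (v \<circ> f) \<gamma> t"
      using c(1) by (simp add: speed_def K_def field_simps)
  qed
  have len2: "len (\<lambda>_. 1) (\<lambda>t. level_proj l (\<gamma> t)) 0 1 \<le> sqrt 2 * len (\<lambda>_. 1) \<gamma> 0 1"
    if \<gamma>: "pw_smooth \<gamma> 0 1" "f (\<gamma> 0) = l" "len (v \<circ> f) \<gamma> 0 1 < d" for \<gamma>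
  proof (rule len_mono[OF w1 w1 \<gamma>(1)])
    show "pw_smooth (\<lambda>t. level_proj l (\<gamma> t)) 0 1"
      by (rule pw_smooth_map[OF \<gamma>(1)]) (rule level_proj_path[OF _ l])
    fix I t assume I: "I \<subseteq> {0..1}" "open I" "smooth_path_on M I \<gamma>" "t \<in> I"
    let ?G = "g (\<gamma> t) (velocity M \<gamma> t) (velocity M \<gamma> t)"
    have "f (\<gamma> t) \<ge> l / 2" using d(2)[OF \<gamma>] I(1,4) by auto
    then have "l / f (\<gamma> t) \<le> 2" using l by (simp add: field_simps)
    then have "l / f (\<gamma> t) * ?G \<le> 2 * ?G"
      using metric_nonneg[OF path_in_pts[OF I(3,4)] velocity_in_tangent_space[OF I(3,2,4)]]
      by (rule mult_right_mono)
    with level_proj_speed[OF I(3,2,4) l]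
    show "speed (\<lambda>_. 1) (\<lambda>t. level_proj l (\<gamma> t)) t \<le> sqrt 2 * speed (\<lambda>_. 1) \<gamma> t"
      by (simp add: speed_def real_sqrt_mult[symmetric])
  qed
  show ?thesis
  proof (rule that[OF d(1) K])
    fix x y assume x: "x \<in> level l" and ne: "paths_in (pts M) x y \<noteq> {}"
      and small: "rpath_dist (v \<circ> f) (pts M) x y < d"
    show "rpath_dist (\<lambda>_. 1) (pts M) x y \<le> K * rpath_dist (v \<circ> f) (pts M) x y"
    proof (rule rpath_dist_compare[OF w w1 ne small K])
      fix \<gamma> assume "\<gamma> \<in> paths_in (pts M) x y" "len (v \<circ> f) \<gamma> 0 1 < d"
      then show "\<exists>\<beta>\<in>paths_in (pts M) x y. len (\<lambda>_. 1) \<beta> 0 1 \<le> K * len (v \<circ> f) \<gamma> 0 1"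
        using len1[of \<gamma>] x by (intro bexI[of _ \<gamma>]) (auto simp: paths_in_def level_def)
    qed
    assume y: "y \<in> level l"
    have K2: "sqrt 2 * K \<ge> 0" using K by simp
    show "rpath_dist (\<lambda>_. 1) (level l) x y \<le> sqrt 2 * K * rpath_dist (v \<circ> f) (pts M) x y"
    proof (rule rpath_dist_compare[OF w w1 ne small K2])
      fix \<gamma> assume \<gamma>: "\<gamma> \<in> paths_in (pts M) x y" and small: "len (v \<circ> f) \<gamma> 0 1 < d"
      then have \<gamma>': "pw_smooth \<gamma> 0 1" "f (\<gamma> 0) = l" using x by (auto simp: paths_in_def level_def)
      have "sqrt 2 * len (\<lambda>_. 1) \<gamma> 0 1 \<le> sqrt 2 * (K * len (v \<circ> f) \<gamma> 0 1)"
        using len1[OF \<gamma>' small] by simp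
      with len2[OF \<gamma>' small] level_proj_paths_in[OF \<gamma> x y l]
      show "\<exists>\<beta>\<in>paths_in (level l) x y. len (\<lambda>_. 1) \<beta> 0 1 \<le> sqrt 2 * K * len (v \<circ> f) \<gamma> 0 1"
        by (intro bexI[of _ "\<lambda>t. level_proj l (\<gamma> t)"]) (simp only: mult.assoc, assumption)
    qed
  qed
qed

lemma ambient_le_level:
  assumes v: "continuous_on {0<..} v" "\<And>s. s > 0 \<Longrightarrow> v s > (0::real)"
    and ne: "paths_in (level l) x y \<noteq> {}" and l: "l > 0"
  shows "rpath_dist (v \<circ> f) (pts M) x y \<le> sqrt (v l) * rpath_dist (\<lambda>_. 1) (level l) x y"
proof (rule rpath_dist_compare[OF conformal_weight_one conformal_weight_f[OF v] ne, where d="rpath_dist (\<lambda>_. 1) (level l) x y + 1"])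
  show "sqrt (v l) \<ge> 0" using v(2)[OF l] by simp
  fix \<gamma> assume \<gamma>: "\<gamma> \<in> paths_in (level l) x y"
  then have \<gamma>': "pw_smooth \<gamma> 0 1" "\<gamma> ` {0..1} \<subseteq> level l" by (auto simp: paths_in_def)
  have "len (v \<circ> f) \<gamma> 0 1 \<le> sqrt (v l) * len (\<lambda>_. 1) \<gamma> 0 1"
  proof (rule len_mono[OF conformal_weight_f[OF v] conformal_weight_one \<gamma>'(1,1)])
    fix I and t :: real assume "I \<subseteq> {0..1}" "t \<in> I"
    then have "f (\<gamma> t) = l" using \<gamma>'(2) by (auto simp: level_def)
    then show "speed (v \<circ> f) \<gamma> t \<le> sqrt (v l) * speed (\<lambda>_. 1) \<gamma> t"
      by (simp add: speed_def real_sqrt_mult)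
  qed
  moreover have "level l \<subseteq> pts M" by (auto simp: level_def)
  ultimately show "\<exists>\<beta>\<in>paths_in (pts M) x y. len (v \<circ> f) \<beta> 0 1 \<le> sqrt (v l) * len (\<lambda>_. 1) \<gamma> 0 1"
    using \<gamma> paths_in_mono by blast
qed simp_all

text \<open>On the orbit segment \<open>s \<mapsto> m (exp (a s)) x\<close> the velocity is \<open>a P\<close>, whose squared length
  \<open>a\<^sup>2 v \<alpha> f\<close> is bounded in the band; here \<open>a = ln (l / f x) / \<alpha>\<close>.\<close>

lemma level_proj_close:
  assumes v: "continuous_on {0<..} v" "\<And>s. s > 0 \<Longrightarrow> v s > (0::real)" and l: "l > 0"
  obtains K where
    "\<And>x. x \<in> pts M \<Longrightarrow> f x \<in> {l/2..2*l} \<Longrightarrow>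
      rpath_dist (v \<circ> f) (pts M) x (level_proj l x) \<le> \<bar>ln (l / f x) / \<alpha>\<bar> * K"
proof -
  obtain c C where c: "c > 0" "\<And>s. s \<in> {l/2..2*l} \<Longrightarrow> c \<le> v s \<and> v s \<le> C"
    using band_bounds[OF v l] by blast
  define K where "K = sqrt (C * (\<alpha> * (2 * l)))"
  note w = conformal_weight_f[OF v]
  have "rpath_dist (v \<circ> f) (pts M) x (level_proj l x) \<le> \<bar>ln (l / f x) / \<alpha>\<bar> * K"
    if x: "x \<in> pts M" and fx: "f x \<in> {l/2..2*l}" for x
  proof -
    define a where "a = ln (l / f x) / \<alpha>"
    define \<gamma> where "\<gamma> = (\<lambda>s. m (exp (a * s)) x)"
    have al: "\<alpha> > 0" using alpha_pos[OF x] .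
    have fp: "f x > 0" using f_pos[OF x] .
    have \<gamma>: "smooth_path_on M I \<gamma>" for I unfolding \<gamma>_def by (rule flow_path[OF x])
    have pw: "pw_smooth \<gamma> 0 1" by (rule pw_smooth.piece[OF zero_less_one \<gamma>])
    have "\<gamma> 0 = x" "\<gamma> 1 = level_proj l x"
      using action_one[OF x] fp l al by (auto simp: \<gamma>_def level_proj_def a_def powr_def)
    then have "\<gamma> \<in> paths_in (pts M) x (level_proj l x)"
      using pw path_in_pts[OF \<gamma>] by (auto simp: paths_in_def)
    then have "rpath_dist (v \<circ> f) (pts M) x (level_proj l x) \<le> len (v \<circ> f) \<gamma> 0 1"
      by (intro rpath_dist_le[OF w])
    also have "\<dots> \<le> integral {0..1} (\<lambda>t::real. \<bar>a\<bar> * K)"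
      unfolding len_def
    proof (rule integral_le_open_interval[OF pw_smooth_speed_integrable[OF w pw]])
      fix t :: real assume t: "0 < t" "t < 1"
      have y: "\<gamma> t \<in> pts M" using path_in_pts[OF \<gamma>] by blast
      have "f (\<gamma> t) = exp (ln (l / f x) * t) * f x"
        using al by (simp add: \<gamma>_def f_action[OF _ x] powr_def a_def)
      also have "\<dots> = exp ((1 - t) * ln (f x) + t * ln l)"
        using fp l by (simp add: ln_div exp_add exp_diff algebra_simps)
      finally have ft: "f (\<gamma> t) = exp ((1 - t) * ln (f x) + t * ln l)" .
      \<comment> \<open>along the orbit \<open>ln f\<close> is affine, so it stays between its end values\<close>
      have "ln (f x) \<le> ln (2 * l)" "ln (l / 2) \<le> ln (f x)" "ln l \<le> ln (2 * l)" "ln (l / 2) \<le> ln l"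
        using fx l fp by (auto simp del: ln_mult ln_div)
      then have "(1 - t) * ln (f x) + t * ln l \<le> ln (2 * l)" "ln (l / 2) \<le> (1 - t) * ln (f x) + t * ln l"
        using t convex_bound_le[of "ln (f x)" "ln (2 * l)" "ln l" "1 - t" t]
          convex_bound_le[of "- ln (f x)" "- ln (l / 2)" "- ln l" "1 - t" t] by auto
      then have band: "f (\<gamma> t) \<in> {l/2..2*l}"
        unfolding ft using l by (metis atLeastAtMost_iff exp_le_cancel_iff exp_ln half_gt_zero mult_pos_pos zero_less_numeral)
      have V: "velocity M \<gamma> t = (\<lambda>d. a *\<^sub>R euler (\<gamma> t) d)"
        using velocity_flow_path[OF x] by (simp add: \<gamma>_def)
      have E: "euler (\<gamma> t) \<in> tangent_space M (\<gamma> t)" by (rule euler_field_in_tangent_space[OF y])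
      have "g (\<gamma> t) (velocity M \<gamma> t) (velocity M \<gamma> t) = a\<^sup>2 * (\<alpha> * f (\<gamma> t))"
        using pseudo_riemannian_square[OF pseudo_riem y E E tangent_space_lincomb[OF E E], of a 0] euler_square[OF y]
        by (simp add: V)
      then have "speed (v \<circ> f) \<gamma> t = \<bar>a\<bar> * sqrt (v (f (\<gamma> t)) * (\<alpha> * f (\<gamma> t)))"
        by (simp add: speed_def real_sqrt_mult)
      also have "\<dots> \<le> \<bar>a\<bar> * K"
        unfolding K_def using c(2)[OF band] c(1) band al l
        by (intro mult_left_mono real_sqrt_le_mono mult_mono) auto
      finally show "speed (v \<circ> f) \<gamma> t \<le> \<bar>a\<bar> * K" .
    qed auto
    finally show ?thesis by (simp add: a_def)
  qed
  then show ?thesis using that by blast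
qed

end


section \<open>Straightening a level set\<close>

text \<open>For a function with positive derivative in the direction of the unit vector \<open>e\<close>, replacing the
  \<open>e\<close>-coordinate by the function is a local diffeomorphism. It only moves points in the direction
  of \<open>e\<close>, hence preserves every linear subspace that contains \<open>e\<close>.\<close>

definition straighten :: "('e::euclidean_space \<Rightarrow> real) \<Rightarrow> real \<Rightarrow> 'e \<Rightarrow> 'e \<Rightarrow> 'e" where
  "straighten F l e y = y + (F y - l - y \<bullet> e) *\<^sub>R e"

lemma straighten_inner: "norm e = 1 \<Longrightarrow> straighten F l e y \<bullet> e = F y - l"
  by (simp add: straighten_def inner_add_left dot_square_norm)

lemma straighten_mem_subspace:
  assumes "subspace V" "e \<in> V"
  shows "straighten F l e y \<in> V \<longleftrightarrow> y \<in> V"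
proof -
  have "(F y - l - y \<bullet> e) *\<^sub>R e \<in> V" using assms by (simp add: subspace_scale)
  then show ?thesis
    unfolding straighten_def using assms(1) by (metis add_diff_cancel_right' subspace_add subspace_diff)
qed

lemma straighten_Ck: "open U \<Longrightarrow> Ck_on k U F \<Longrightarrow> Ck_on k U (straighten F l e)"
  unfolding straighten_def[abs_def]
  by (intro Ck_on_add Ck_on_id Ck_on_scaleR Ck_on_diff Ck_on_const
      Ck_on_bounded_linear[OF bounded_linear_inner_left])

lemma straighten_local_diffeo:
  fixes F :: "'e::euclidean_space \<Rightarrow> real"
  assumes U: "open U" "y\<^sub>0 \<in> U" and F: "\<And>k. Ck_on k U F"
    and e: "norm e = 1" "frechet_derivative F (at y\<^sub>0) e > 0"
  obtains V G where "open V" "y\<^sub>0 \<in> V" "V \<subseteq> U" "inj_on (straighten F l e) V"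
    "\<And>T. open T \<Longrightarrow> T \<subseteq> V \<Longrightarrow> open (straighten F l e ` T)"
    "\<And>y. y \<in> V \<Longrightarrow> G (straighten F l e y) = y"
    "\<And>k. Ck_on k (straighten F l e ` V) G"
proof -
  let ?\<Psi> = "straighten F l e" and ?DF = "\<lambda>y. frechet_derivative F (at y)"
  have DF: "(F has_derivative ?DF y) (at y)" if "y \<in> U" for y
    using Ck_on_has_derivative[OF F that] .
  have CkDF: "Ck_on k U (\<lambda>y. ?DF y v)" for k v using F[of "Suc k"] by simp
  then have "continuous_on U (\<lambda>y. ?DF y e)" using Ck_on_imp_continuous_on by blast
  then have "open (U \<inter> (\<lambda>y. ?DF y e) -` {0<..})"
    by (metis Int_commute continuous_on_open_vimage[OF U(1)] open_greaterThan)
  then obtain r where r: "r > 0" "ball y\<^sub>0 r \<subseteq> U \<inter> (\<lambda>y. ?DF y e) -` {0<..}"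
    using U(2) e(2) by (metis (lifting) Int_iff greaterThan_iff open_contains_ball vimage_eq)
  define V where "V = ball y\<^sub>0 r"
  have V: "open V" "y\<^sub>0 \<in> V" "V \<subseteq> U" "convex V" and pos: "\<And>y. y \<in> V \<Longrightarrow> ?DF y e > 0"
    using r by (auto simp: V_def)
  \<comment> \<open>\<open>F\<close> is strictly increasing on segments in the direction \<open>e\<close>\<close>
  have neq: "F (y + s *\<^sub>R e) \<noteq> F y" if y: "y \<in> V" "y + s *\<^sub>R e \<in> V" "s > 0" for y s
  proof -
    have "F (y + 0 *\<^sub>R e) < F (y + s *\<^sub>R e)"
    proof (rule DERIV_pos_imp_increasing[OF y(3), of "\<lambda>t. F (y + t *\<^sub>R e)"])
      fix t assume t: "0 \<le> t" "t \<le> s"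
      have "y + t *\<^sub>R e = (1 - t/s) *\<^sub>R y + (t/s) *\<^sub>R (y + s *\<^sub>R e)"
        using y(3) by (simp add: algebra_simps)
      then have inV: "y + t *\<^sub>R e \<in> V"
        using convexD_alt[OF V(4) y(1,2), of "t/s"] t y(3) by simp
      have line: "((\<lambda>t. y + t *\<^sub>R e) has_vector_derivative e) (at t)"
        by (auto intro!: derivative_eq_intros simp: has_vector_derivative_def)
      have ev: "\<forall>\<^sub>F s in nhds t. y + s *\<^sub>R e \<in> UNIV" by simp
      have "y + t *\<^sub>R e \<in> U" using inV V(3) by blast
      from path_chain_within[OF DF[OF this] line refl ev]
      have "((\<lambda>t. F (y + t *\<^sub>R e)) has_vector_derivative ?DF (y + t *\<^sub>R e) e) (at t)" .
      then show "\<exists>d. ((\<lambda>t. F (y + t *\<^sub>R e)) has_real_derivative d) (at t) \<and> 0 < d"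
        using pos[OF inV] by (auto simp: has_real_derivative_iff_has_vector_derivative)
    qed
    then show ?thesis by simp
  qed
  have inj: "inj_on ?\<Psi> V"
  proof (rule inj_onI)
    fix y y' assume y: "y \<in> V" "y' \<in> V" "?\<Psi> y = ?\<Psi> y'"
    define s where "s = (F y - l - y \<bullet> e) - (F y' - l - y' \<bullet> e)"
    have s: "y' = y + s *\<^sub>R e" using y(3) by (simp add: straighten_def s_def algebra_simps)
    have Feq: "F y = F y'" using straighten_inner[OF e(1), of F l] y(3) by (metis diff_add_cancel)
    have "\<not> s > 0" using neq[of y s] y s Feq by auto
    moreover have "\<not> s < 0" using neq[of y' "- s"] y s Feq by auto
    ultimately show "y = y'" using s by simp
  qed
  have opn: "open (?\<Psi> ` T)" if "open T" "T \<subseteq> V" for T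
  proof (rule invariance_of_domain[OF _ that(1)])
    have "Ck_on 0 U ?\<Psi>" using straighten_Ck[OF U(1) F] .
    then show "continuous_on T ?\<Psi>" using that(2) V(3) by (auto intro: continuous_on_subset)
    show "inj_on ?\<Psi> T" using inj that(2) by (rule inj_on_subset)
  qed
  define G where "G = inv_into V ?\<Psi>"
  have G: "G (?\<Psi> y) = y" if "y \<in> V" for y using inj that by (simp add: G_def)
  \<comment> \<open>the inverse of the derivative \<open>v + (DF v - v \<bullet> e) e\<close>; it involves \<open>G\<close> itself, whence the induction on \<open>k\<close>\<close>
  let ?G' = "\<lambda>y v. v + ((v \<bullet> e - ?DF y v) * inverse (?DF y e)) *\<^sub>R e"
  have derG: "(G has_derivative ?G' (G z)) (at z)" if z: "z \<in> ?\<Psi> ` V" for z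
  proof -
    obtain y where y: "y \<in> V" "z = ?\<Psi> y" using z by blast
    let ?\<Psi>' = "\<lambda>v. v + (?DF y v - v \<bullet> e) *\<^sub>R e"
    have lin: "linear (?DF y)" using DF y V(3) has_derivative_linear by blast
    have "(?\<Psi> has_derivative ?\<Psi>') (at y)"
      unfolding straighten_def[abs_def] using DF y(1) V(3) by (auto intro!: derivative_eq_intros)
    moreover have "?\<Psi>' \<circ> ?G' y = id"
    proof
      fix v
      define k where "k = (v \<bullet> e - ?DF y v) * inverse (?DF y e)"
      have "k * ?DF y e = v \<bullet> e - ?DF y v" using pos[OF y(1)] by (simp add: k_def)
      then have "?DF y (v + k *\<^sub>R e) = v \<bullet> e" by (simp add: linear_add[OF lin] linear_scale[OF lin])
      moreover have "(v + k *\<^sub>R e) \<bullet> e = v \<bullet> e + k" using e(1) by (simp add: inner_add_left dot_square_norm)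
      ultimately show "(?\<Psi>' \<circ> ?G' y) v = id v" by (simp add: k_def[symmetric])
    qed
    moreover have "continuous_on V ?\<Psi>"
      using straighten_Ck[OF U(1) F, of 0 l e] V(3) by (auto intro: continuous_on_subset)
    ultimately have "(G has_derivative ?G' y) (at (?\<Psi> y))"
      using has_derivative_inverse_strong[of V y ?\<Psi> G, OF V(1) y(1)] G by blast
    then show ?thesis using y G by simp
  qed
  have oV: "open (?\<Psi> ` V)" using opn[OF V(1) order_refl] .
  have "Ck_on k (?\<Psi> ` V) G" for k
  proof (induction k)
    case 0
    then show ?case
      by (auto intro!: continuous_at_imp_continuous_on has_derivative_continuous[OF derG])
  next
    case (Suc k)
    show ?case
    proof (rule Ck_on_SucI[OF oV derG])
      fix v
      have sub: "G ` ?\<Psi> ` V \<subseteq> V" using G by auto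
      have DFG: "Ck_on k (?\<Psi> ` V) (\<lambda>z. ?DF (G z) v)" for v
        by (rule Ck_on_compose[OF oV V(1) sub Suc Ck_on_subset[OF CkDF V(3)]])
      have "Ck_on k (?\<Psi> ` V) (\<lambda>z. inverse (?DF (G z) e))"
        by (rule Ck_on_compose[OF oV _ _ DFG Ck_on_inverse]) (use pos G in \<open>auto simp: less_le\<close>)
      then show "Ck_on k (?\<Psi> ` V) (\<lambda>z. ?G' (G z) v)"
        by (intro Ck_on_add Ck_on_const Ck_on_scaleR Ck_on_mult Ck_on_diff oV DFG)
    qed
  qed
  with V inj opn G show ?thesis using that[of V G] by blast
qed

text \<open>Composing a chart with a local diffeomorphism of the ambient Euclidean space is only a chart
  again if the diffeomorphism preserves the subspace in which the chart takes its values.\<close>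

lemma (in smooth_mfd) chart_change:
  assumes d: "d \<in> atlas M" and V: "open V" and inj: "inj_on \<Psi> V"
    and opn: "\<And>T. open T \<Longrightarrow> T \<subseteq> V \<Longrightarrow> open (\<Psi> ` T)"
    and sp: "\<And>y. y \<in> V \<Longrightarrow> \<Psi> y \<in> cspace d \<longleftrightarrow> y \<in> cspace d"
    and G: "\<And>y. y \<in> V \<Longrightarrow> G (\<Psi> y) = y"
    and Ck: "\<And>k. Ck_on k V \<Psi>" "\<And>k. Ck_on k (\<Psi> ` V) G"
  shows "\<lparr>cdom = {z \<in> cdom d. cmap d z \<in> V}, cmap = \<Psi> \<circ> cmap d, cspace = cspace d\<rparr> \<in> max_atlas M"
    (is "?c \<in> _")
proof -
  note dh = atlas_is_chart[OF d]
  let ?D = "{z \<in> cdom d. cmap d z \<in> V}" and ?O = "cmap d ` cdom d"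
  let ?im = "(\<Psi> \<circ> cmap d) ` ?D"
  have oV: "open (\<Psi> ` V)" using opn[OF V order_refl] .
  have cont\<Psi>: "continuous_on V \<Psi>" and contG: "continuous_on (\<Psi> ` V) G"
    using Ck[of 0] by auto
  have top: "topspace (subtopology (mtop M) (cdom d)) = cdom d" using is_chart_subset[OF dh] by auto
  have oD: "openin (mtop M) ?D"
  proof -
    have "openin (subtopology (mtop M) (cdom d)) {z \<in> topspace (subtopology (mtop M) (cdom d)). cmap d z \<in> V}"
      by (rule openin_continuous_map_preimage[OF cmap_continuous[OF dh]]) (use V in simp)
    then show ?thesis
      unfolding top using openin_open_subtopology[OF is_chart_openin[OF dh]] by blast
  qed
  have oim: "openin (top_of_set (cspace d)) ?im"
  proof -
    obtain T where T: "open T" "?O = cspace d \<inter> T"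
      using is_chart_openin_image[OF dh] by (auto simp: openin_open)
    have "?im = \<Psi> ` (?O \<inter> V)" by auto
    also have "\<dots> = cspace d \<inter> \<Psi> ` (T \<inter> V)" using sp T(2) by auto
    finally show ?thesis
      using opn[of "T \<inter> V"] T(1) V by (auto simp: openin_open)
  qed
  have inv: "(cinv d \<circ> G) ((\<Psi> \<circ> cmap d) z) = z" if "z \<in> ?D" for z
    using that G cinv_cmap[OF dh] by simp
  have hom: "homeomorphic_maps (subtopology (mtop M) ?D) (top_of_set ?im) (\<Psi> \<circ> cmap d) (cinv d \<circ> G)"
    unfolding homeomorphic_maps_def
  proof (intro conjI ballI)
    have "continuous_map (subtopology (mtop M) ?D) (top_of_set V) (cmap d)"
      using continuous_map_from_subtopology_mono[OF cmap_continuous[OF dh], of ?D]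
      by (auto simp: continuous_map_in_subtopology)
    then have "continuous_map (subtopology (mtop M) ?D) euclidean (\<Psi> \<circ> cmap d)"
      by (rule continuous_map_compose) (use cont\<Psi> in simp)
    then show "continuous_map (subtopology (mtop M) ?D) (top_of_set ?im) (\<Psi> \<circ> cmap d)"
      by (auto simp: continuous_map_in_subtopology)
    have "continuous_map (top_of_set ?im) (top_of_set ?O) G"
      using contG G by (auto simp: continuous_map_in_subtopology intro: continuous_on_subset)
    then have "continuous_map (top_of_set ?im) (mtop M) (cinv d \<circ> G)"
      by (rule continuous_map_compose[OF _ cinv_continuous[OF dh]])
    then show "continuous_map (top_of_set ?im) (subtopology (mtop M) ?D) (cinv d \<circ> G)"
      by (rule continuous_map_into_subtopology) (use inv in auto)
  qed (use inv in auto)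
  then have hm: "homeomorphic_map (subtopology (mtop M) ?D) (top_of_set ?im) (\<Psi> \<circ> cmap d)"
    using homeomorphic_map_maps by blast
  have chart: "is_chart M ?c"
    using oD oim hm is_chart_subspace[OF dh] dh by (simp add: is_chart_def)
  have cinv: "cinv ?c ((\<Psi> \<circ> cmap d) z) = z" if "z \<in> ?D" for z
    using cinv_cmap[OF chart, of z] that by simp
  have "smooth_transition ?c a \<and> smooth_transition a ?c" if a: "a \<in> atlas M" for a
  proof
    have am: "a \<in> max_atlas M" using a atlas_subset_max_atlas by blast
    note ah = atlas_is_chart[OF a]
    have "smooth_on ((\<Psi> \<circ> cmap d) ` (?D \<inter> cdom a)) ((cmap a \<circ> cinv d) \<circ> G)"
    proof (rule smooth_on_compose[OF smooth_onI_open[OF oV _ Ck(2)] transition_smooth])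
      show "d \<in> max_atlas M \<and> a \<in> atlas M \<or> d \<in> atlas M \<and> a \<in> max_atlas M" using d am by simp
    qed (use G in auto)
    then have "smooth_on ((\<Psi> \<circ> cmap d) ` (?D \<inter> cdom a)) (cmap a \<circ> cinv ?c)"
      by (rule smooth_on_cong) (use inv cinv in auto)
    then show "smooth_transition ?c a" by (simp add: smooth_transition_def)
    have "smooth_on (cmap a ` (cdom a \<inter> ?D)) (\<Psi> \<circ> (cmap d \<circ> cinv a))"
    proof (rule smooth_on_compose[OF smooth_on_subset[OF transition_smooth] smooth_onI_open[OF V order_refl Ck(1)]])
      show "a \<in> max_atlas M \<and> d \<in> atlas M \<or> a \<in> atlas M \<and> d \<in> max_atlas M" using d am by simp
    qed (use cinv_cmap[OF ah] in auto)
    then show "smooth_transition a ?c" by (simp add: smooth_transition_def o_assoc)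
  qed
  with chart show ?thesis by (simp add: max_atlas_def)
qed


section \<open>Paths in the level manifold\<close>

context homogeneous_metric
begin

text \<open>The Euler field is transversal to the level sets, as \<open>df(P) = \<alpha> f > 0\<close>. Straightening \<open>f\<close> along the
  direction of \<open>P\<close> in a chart turns the level set into a hyperplane.\<close>

lemma slice_chart:
  assumes x: "x \<in> level l"
  obtains c W where "c \<in> max_atlas M" "x \<in> cdom c" "subspace W" "W \<subseteq> cspace c" "dim W = mdim M - 1"
    "cmap c ` (cdom c \<inter> level l) = cmap c ` cdom c \<inter> W"
proof -
  have xM: "x \<in> pts M" "f x = l" using x by (auto simp: level_def)
  obtain d where d: "d \<in> atlas M" "x \<in> cdom d" using chart_at xM by blast
  note dh = atlas_is_chart[OF d(1)]
  let ?y = "cmap d x" and ?O = "cmap d ` cdom d"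
  obtain U F where U: "open U" "?y \<in> U" "\<forall>k. Ck_on k U F" "\<forall>y\<in>?O \<inter> U. F y = (f \<circ> cinv d) y"
    using smooth_onD[OF f_smooth[OF d(1)], of ?y] d(2) by blast
  define p where "p = euler x d"
  have p: "p \<in> cspace d"
    using tangent_in_cspace[OF euler_field_in_tangent_space[OF xM(1)] d] by (simp add: p_def)
  have DFp: "frechet_derivative F (at ?y) p = \<alpha> * f x"
  proof -
    let ?k = "\<lambda>s. m (exp (1 * s)) x"
    have k: "smooth_path_on M UNIV ?k" by (rule flow_path[OF xM(1)])
    have k0: "?k 0 = x" using action_one[OF xM(1)] by simp
    have kder: "((\<lambda>s. cmap d (?k s)) has_vector_derivative p) (at 0)"
      using velocity_has_vector_derivative[OF k open_UNIV UNIV_I d(1), of 0] d(2) k0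
      by (simp add: p_def euler_field_def)
    have "(F has_derivative frechet_derivative F (at ?y)) (at ?y)"
      by (rule Ck_on_has_derivative[OF U(3)[rule_format] U(2)])
    from path_chain_within[OF this kder arg_cong[OF k0]]
    have "((\<lambda>s. F (cmap d (?k s))) has_vector_derivative frechet_derivative F (at ?y) p) (at 0)" by simp
    moreover have "\<forall>\<^sub>F s in nhds 0. F (cmap d (?k s)) = f (?k s)"
    proof -
      have "openin (subtopology (mtop M) (cdom d)) {z \<in> topspace (subtopology (mtop M) (cdom d)). cmap d z \<in> U}"
        by (rule openin_continuous_map_preimage[OF cmap_continuous[OF dh]]) (use U in simp)
      then have "openin (mtop M) {z \<in> cdom d. cmap d z \<in> U}"
        using openin_open_subtopology[OF is_chart_openin[OF dh]] is_chart_subset[OF dh]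
        by (simp add: Int_absorb1)
      from smooth_path_eventually_in[OF k open_UNIV UNIV_I this, of 0]
      show ?thesis
      proof (rule eventually_mono)
        show "?k 0 \<in> {z \<in> cdom d. cmap d z \<in> U}" using k0 d(2) U(2) by simp
      qed (use U(4) cinv_cmap[OF dh] in auto)
    qed
    ultimately have "((\<lambda>s. f (?k s)) has_real_derivative frechet_derivative F (at ?y) p) (at 0)"
      unfolding has_real_derivative_iff_has_vector_derivative by (rule has_vector_derivative_eventually_cong)
    moreover have "((\<lambda>s. f (?k s)) has_real_derivative \<alpha> * f x) (at 0)"
      using f_along_path[OF k open_UNIV UNIV_I, of 0] euler_square[OF xM(1)] k0 by (simp add: euler_field_def)
    ultimately show ?thesis by (rule DERIV_unique)
  qed
  have af: "\<alpha> * f x > 0" using alpha_pos[OF xM(1)] f_pos[OF xM(1)] by simp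
  have "linear (frechet_derivative F (at ?y))"
    using Ck_on_has_derivative[OF _ U(2)] U(3) has_derivative_linear by blast
  note lin = this
  then have "p \<noteq> 0" using DFp af linear_0 by fastforce
  define e where "e = (1 / norm p) *\<^sub>R p"
  have e: "norm e = 1" "e \<in> cspace d" "frechet_derivative F (at ?y) e > 0"
    using \<open>p \<noteq> 0\<close> p is_chart_subspace[OF dh] DFp af
    by (auto simp: e_def subspace_scale linear_scale[OF lin])
  let ?\<Psi> = "straighten F l e"
  obtain V G where V: "open V" "?y \<in> V" "V \<subseteq> U" "inj_on ?\<Psi> V"
    "\<And>T. open T \<Longrightarrow> T \<subseteq> V \<Longrightarrow> open (?\<Psi> ` T)" "\<And>y. y \<in> V \<Longrightarrow> G (?\<Psi> y) = y" "\<And>k. Ck_on k (?\<Psi> ` V) G"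
    using straighten_local_diffeo[OF U(1,2) U(3)[rule_format] e(1,3), of l] by blast
  define c where "c = \<lparr>cdom = {z \<in> cdom d. cmap d z \<in> V}, cmap = ?\<Psi> \<circ> cmap d, cspace = cspace d\<rparr>"
  define W where "W = {y \<in> cspace d. y \<bullet> e = 0}"
  have "c \<in> max_atlas M"
    unfolding c_def
  proof (rule chart_change[OF d(1) V(1,4,5) _ V(6) _ V(7)])
    show "?\<Psi> y \<in> cspace d \<longleftrightarrow> y \<in> cspace d" for y
      using straighten_mem_subspace[OF is_chart_subspace[OF dh] e(2)] .
    show "Ck_on k V ?\<Psi>" for k
      using straighten_Ck[OF V(1)] Ck_on_subset U(3) V(3) by blast
  qed
  moreover have "x \<in> cdom c" using d V by (simp add: c_def)
  moreover have "subspace W" "W \<subseteq> cspace c"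
    using is_chart_subspace[OF dh] by (auto simp: W_def c_def subspace_def inner_add_left)
  moreover have "dim W = mdim M - 1"
  proof -
    have "span {e} \<subseteq> cspace d" using e(2) is_chart_subspace[OF dh] by (simp add: span_minimal)
    then have "dim {y \<in> cspace d. \<forall>x\<in>span {e}. orthogonal x y} + dim (span {e}) = dim (cspace d)"
      by (intro dim_subspace_orthogonal_to_vectors subspace_span is_chart_subspace[OF dh])
    moreover have "{y \<in> cspace d. \<forall>x\<in>span {e}. orthogonal x y} = W"
      by (auto simp: W_def span_singleton orthogonal_def inner_commute)
    moreover have "dim (span {e}) = 1" using e(1) by (auto simp: dim_span dim_singleton)
    moreover have "dim (cspace d) = mdim M" using dh by (simp add: is_chart_def)
    ultimately show ?thesis by simp
  qed
  moreover have "cmap c ` (cdom c \<inter> level l) = cmap c ` cdom c \<inter> W"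
  proof -
    have key: "z \<in> level l \<longleftrightarrow> ?\<Psi> (cmap d z) \<in> W" if z: "z \<in> cdom d" "cmap d z \<in> V" for z
    proof -
      have "F (cmap d z) = f z" using U(4) V(3) z cinv_cmap[OF dh] by auto
      moreover have "cmap d z \<in> cspace d" using z openin_imp_subset[OF is_chart_openin_image[OF dh]] by blast
      moreover have "z \<in> pts M" using z is_chart_subset[OF dh] by blast
      ultimately show ?thesis
        using straighten_inner[OF e(1), of F l "cmap d z"]
          straighten_mem_subspace[OF is_chart_subspace[OF dh] e(2)]
        by (simp add: level_def W_def)
    qed
    show ?thesis using key by (auto simp: c_def)
  qed
  ultimately show ?thesis by (rule that)
qed

abbreviation level_mfd :: "real \<Rightarrow> ('a, 'e) manifold" where
  "level_mfd l \<equiv> level_manifold M f l"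

lemma level_mfd_top: "mtop (level_mfd l) = subtopology (mtop M) (level l)"
  by (simp add: level_manifold_def submanifold_def level_def)

lemma level_mfd_pts: "pts (level_mfd l) = level l"
  by (auto simp: level_mfd_top level_def)

lemma level_mfd_atlasI:
  assumes "c \<in> max_atlas M" "subspace W" "W \<subseteq> cspace c" "dim W = mdim M - 1"
    "cmap c ` (cdom c \<inter> level l) = cmap c ` cdom c \<inter> W"
  shows "\<lparr>cdom = cdom c \<inter> level l, cmap = cmap c, cspace = W\<rparr> \<in> atlas (level_mfd l)"
  using assms unfolding level_manifold_def submanifold_def level_def by auto

lemma level_mfd_atlasE:
  assumes "c' \<in> atlas (level_mfd l)"
  obtains c W where "c \<in> max_atlas M" "subspace W" "W \<subseteq> cspace c" "dim W = mdim M - 1"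
    "cmap c ` (cdom c \<inter> level l) = cmap c ` cdom c \<inter> W"
    "c' = \<lparr>cdom = cdom c \<inter> level l, cmap = cmap c, cspace = W\<rparr>"
  using assms unfolding level_manifold_def submanifold_def level_def by auto

text \<open>The charts of the level manifold are restrictions of charts of \<open>M\<close>, and by \<open>slice_chart\<close> they cover
  the level set.\<close>

lemma level_path_iff:
  "smooth_path_on (level_mfd l) I \<gamma> \<longleftrightarrow> smooth_path_on M I \<gamma> \<and> \<gamma> ` I \<subseteq> level l"
proof
  assume \<gamma>: "smooth_path_on (level_mfd l) I \<gamma>"
  then have cont: "continuous_map (top_of_set I) (mtop M) \<gamma>" and im: "\<gamma> ` I \<subseteq> level l"
    by (auto simp: smooth_path_on_def level_mfd_top continuous_map_in_subtopology)
  have "smooth_path_on M I \<gamma>"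
  proof (rule smooth_path_onI[OF cont])
    fix t assume t: "t \<in> I"
    then have "\<gamma> t \<in> level l" using im by blast
    from slice_chart[OF this] obtain c W where c: "c \<in> max_atlas M" "\<gamma> t \<in> cdom c" "subspace W" "W \<subseteq> cspace c"
      "dim W = mdim M - 1" "cmap c ` (cdom c \<inter> level l) = cmap c ` cdom c \<inter> W"
      by metis
    have "smooth_on {t\<in>I. \<gamma> t \<in> cdom c \<inter> level l} (cmap c \<circ> \<gamma>)"
      using \<gamma> level_mfd_atlasI[OF c(1,3-6)] unfolding smooth_path_on_def by fastforce
    moreover have "{t\<in>I. \<gamma> t \<in> cdom c \<inter> level l} = {t\<in>I. \<gamma> t \<in> cdom c}" using im by auto
    moreover have "openin (top_of_set I) {t\<in>I. \<gamma> t \<in> cdom c}"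
      by (rule openin_path_preimage[OF cont is_chart_openin[OF max_atlas_is_chart[OF c(1)]]])
    ultimately show "\<exists>c\<in>max_atlas M. \<exists>J. openin (top_of_set I) J \<and> t \<in> J \<and> \<gamma> ` J \<subseteq> cdom c \<and> smooth_on J (cmap c \<circ> \<gamma>)"
      using c(1,2) t by (intro bexI[of _ c] exI[of _ "{t\<in>I. \<gamma> t \<in> cdom c}"]) auto
  qed
  with im show "smooth_path_on M I \<gamma> \<and> \<gamma> ` I \<subseteq> level l" by simp
next
  assume \<gamma>: "smooth_path_on M I \<gamma> \<and> \<gamma> ` I \<subseteq> level l"
  show "smooth_path_on (level_mfd l) I \<gamma>"
    unfolding smooth_path_on_def
  proof (intro conjI ballI)
    show "continuous_map (top_of_set I) (mtop (level_mfd l)) \<gamma>"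
      using \<gamma> by (auto simp: smooth_path_on_def level_mfd_top continuous_map_in_subtopology)
    fix c' assume "c' \<in> atlas (level_mfd l)"
    then obtain c W where c: "c \<in> max_atlas M" "c' = \<lparr>cdom = cdom c \<inter> level l, cmap = cmap c, cspace = W\<rparr>"
      by (rule level_mfd_atlasE)
    have "smooth_on {t\<in>I. \<gamma> t \<in> cdom c} (cmap c \<circ> \<gamma>)" using smooth_path_on_chart \<gamma> c(1) by blast
    then show "smooth_on {t \<in> I. \<gamma> t \<in> cdom c'} (cmap c' \<circ> \<gamma>)"
      using c(2) by (auto elim: smooth_on_subset)
  qed
qed

text \<open>The differential of the inclusion is computed in an unspecified slice chart. There the chain rule
  along the path applies, with the model space cut down to the hyperplane \<open>W\<close>.\<close>

lemma level_velocity: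
  assumes \<gamma>: "smooth_path_on M I \<gamma>" "open I" "t \<in> I" and im: "\<gamma> ` I \<subseteq> level l"
  shows "pushforward (level_mfd l) M (\<lambda>x. x) (\<gamma> t) (velocity (level_mfd l) \<gamma> t) = velocity M \<gamma> t"
proof
  fix d
  let ?L = "level_mfd l"
  define c' where "c' = (SOME c. c \<in> atlas ?L \<and> \<gamma> t \<in> cdom c)"
  have gt: "\<gamma> t \<in> level l" using im \<gamma>(3) by blast
  have c': "c' \<in> atlas ?L \<and> \<gamma> t \<in> cdom c'"
    unfolding c'_def
  proof (rule someI_ex)
    from slice_chart[OF gt] obtain c W where c: "c \<in> max_atlas M" "\<gamma> t \<in> cdom c" "subspace W" "W \<subseteq> cspace c"
      "dim W = mdim M - 1" "cmap c ` (cdom c \<inter> level l) = cmap c ` cdom c \<inter> W"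
      by metis
    then show "\<exists>c. c \<in> atlas ?L \<and> \<gamma> t \<in> cdom c"
      using level_mfd_atlasI[OF c(1,3-6)] gt
      by (intro exI[of _ "\<lparr>cdom = cdom c \<inter> level l, cmap = cmap c, cspace = W\<rparr>"]) auto
  qed
  from c'[THEN conjunct1] obtain c W where c: "c \<in> max_atlas M" "subspace W" "W \<subseteq> cspace c" "dim W = mdim M - 1"
    "cmap c ` (cdom c \<inter> level l) = cmap c ` cdom c \<inter> W"
    and c'_eq: "c' = \<lparr>cdom = cdom c \<inter> level l, cmap = cmap c, cspace = W\<rparr>"
    by (rule level_mfd_atlasE)
  note ch = max_atlas_is_chart[OF c(1)]
  have gc: "\<gamma> t \<in> cdom c" using c' c'_eq by simp
  have cinv': "cinv c' (cmap c z) = z" if "z \<in> cdom c" "z \<in> level l" for z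
  proof -
    have "inj_on (cmap c) (cdom c \<inter> level l)"
      using is_chart_inj_on[OF ch] by (rule inj_on_subset) auto
    then show ?thesis using that by (simp add: cinv_def c'_eq)
  qed
  show "pushforward ?L M (\<lambda>x. x) (\<gamma> t) (velocity ?L \<gamma> t) d = velocity M \<gamma> t d"
  proof (cases "d \<in> atlas M \<and> \<gamma> t \<in> cdom d")
    case True
    note dh = atlas_is_chart[OF True[THEN conjunct1]]
    let ?w = "vector_derivative (cmap c \<circ> \<gamma>) (at t)"
    define A where "A = cmap c ` (cdom c \<inter> cdom d) \<inter> W"
    have A_eq: "A = cmap c ` (cdom c \<inter> cdom d \<inter> level l)"
      using c(5) is_chart_inj_on[OF ch] unfolding A_def inj_on_def by blast
    have oA: "openin (top_of_set W) A"
    proof -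
      have "openin (top_of_set (cspace c)) (cmap c ` (cdom c \<inter> cdom d))"
        using transition_domain c(1) True atlas_subset_max_atlas by blast
      then show ?thesis using c(3) unfolding A_def openin_open by blast
    qed
    have smA: "smooth_on A (cmap d \<circ> cinv c')"
    proof (rule smooth_on_cong)
      show "smooth_on A (cmap d \<circ> cinv c)"
        by (rule smooth_on_subset[OF transition_smooth]) (use c(1) True A_def in auto)
      show "(cmap d \<circ> cinv c) y = (cmap d \<circ> cinv c') y" if "y \<in> A" for y
        using that cinv' cinv_cmap[OF ch] unfolding A_eq by auto
    qed
    have oU: "openin (mtop M) (cdom c \<inter> cdom d)"
      using is_chart_openin[OF ch] is_chart_openin[OF dh] by (rule openin_Int)
    have evU: "\<forall>\<^sub>F s in nhds t. \<gamma> s \<in> cdom c \<inter> cdom d"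
      by (rule smooth_path_eventually_in[OF \<gamma> oU]) (use gc True in auto)
    have evI: "\<forall>\<^sub>F s in nhds t. s \<in> I" using \<gamma>(2,3) by (simp add: eventually_nhds_in_open)
    have ev: "\<forall>\<^sub>F s in nhds t. cmap c (\<gamma> s) \<in> A"
      using evU evI by eventually_elim (use im A_eq in blast)
    have "((\<lambda>s. (cmap d \<circ> cinv c') (cmap c (\<gamma> s))) has_vector_derivative
        dir_deriv (cmap d \<circ> cinv c') (cmap c (\<gamma> t)) ?w) (at t)"
      by (rule path_chain(2)[OF smA oA c(2) _ smooth_path_has_vector_derivative[OF \<gamma> c(1) gc] refl ev])
        (use eventually_nhds_x_imp_x[OF ev] in simp)
    then have "((\<lambda>s. cmap d (\<gamma> s)) has_vector_derivative
        dir_deriv (cmap d \<circ> cinv c') (cmap c (\<gamma> t)) ?w) (at t)"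
    proof (rule has_vector_derivative_eventually_cong)
      show "\<forall>\<^sub>F s in nhds t. (cmap d \<circ> cinv c') (cmap c (\<gamma> s)) = cmap d (\<gamma> s)"
        using evU evI by eventually_elim (use im cinv' in auto)
    qed
    then have "velocity M \<gamma> t d = dir_deriv (cmap d \<circ> cinv c') (cmap c (\<gamma> t)) ?w"
      using True by (simp add: velocity_def o_def vector_derivative_at)
    moreover have "velocity ?L \<gamma> t c' = ?w"
      using c' by (simp add: velocity_def c'_eq)
    ultimately show ?thesis
      using True by (simp add: pushforward_def differential_def c'_def[symmetric] Let_def o_def c'_eq)
  next
    case False
    then show ?thesis by (auto simp: pushforward_def velocity_def)
  qed
qed

text \<open>The break points are increasing, so the pieces cover \<open>[0, 1]\<close> and lie in it.\<close>

lemma piecewise_level_path_iff: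
  "piecewise_smooth_path (level_mfd l) \<gamma> \<longleftrightarrow> pw_smooth \<gamma> 0 1 \<and> \<gamma> ` {0..1} \<subseteq> level l"
proof -
  have cover: "\<exists>i<n. t \<in> {p i..p (Suc i)}"
    if "\<forall>i<n. p i < p (Suc i)" "t \<in> {p 0..p n}" "n > 0" for n :: nat and p :: "nat \<Rightarrow> real" and t
    using that
  proof (induction n)
    case (Suc n)
    show ?case
    proof (cases "n > 0 \<and> t \<le> p n")
      case True
      then have "\<exists>i<n. t \<in> {p i..p (Suc i)}" using Suc.prems by (intro Suc.IH) auto
      then show ?thesis by (auto intro: less_SucI)
    next
      case False
      then have "t \<in> {p n..p (Suc n)}" using Suc.prems(2) by auto
      then show ?thesis by (intro exI[of _ n]) simp
    qed
  qed simp
  have inside: "{p i..p (Suc i)} \<subseteq> {p 0..p n}"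
    if "\<forall>i<n. p i < p (Suc i)" "i < n" for n i :: nat and p :: "nat \<Rightarrow> real"
  proof -
    have "p j \<le> p k" if "j \<le> k" "k \<le> n" for j k
      using that
    proof (induction k)
      case (Suc k)
      moreover have "p k < p (Suc k)" using \<open>\<forall>i<n. p i < p (Suc i)\<close> Suc.prems(2) by simp
      ultimately show ?case by (cases "j = Suc k") auto
    qed simp
    from this[of 0 i] this[of "Suc i" n] show ?thesis using that(2) by auto
  qed
  show ?thesis
  proof
    assume "piecewise_smooth_path (level_mfd l) \<gamma>"
    then obtain n :: nat and p where p: "p 0 = 0" "p n = 1"
      "\<forall>i<n. p i < p (Suc i) \<and> smooth_path_on (level_mfd l) {p i..p (Suc i)} \<gamma>"
      unfolding piecewise_smooth_path_def by blast
    have "n > 0" using p(1,2) by (cases n) auto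
    have "\<gamma> t \<in> level l" if t: "t \<in> {0..1}" for t
    proof -
      obtain i where "i < n" "t \<in> {p i..p (Suc i)}"
        using cover[of n p t] p \<open>n > 0\<close> t by auto
      then show ?thesis using p(3) level_path_iff by blast
    qed
    moreover have "piecewise_smooth_path M \<gamma>"
      unfolding piecewise_smooth_path_def using p level_path_iff by blast
    ultimately show "pw_smooth \<gamma> 0 1 \<and> \<gamma> ` {0..1} \<subseteq> level l"
      using piecewise_smooth_path_iff by auto
  next
    assume \<gamma>: "pw_smooth \<gamma> 0 1 \<and> \<gamma> ` {0..1} \<subseteq> level l"
    then obtain n :: nat and p where p: "p 0 = 0" "p n = 1"
      "\<forall>i<n. p i < p (Suc i) \<and> smooth_path_on M {p i..p (Suc i)} \<gamma>"
      unfolding piecewise_smooth_path_iff[symmetric] piecewise_smooth_path_def by blast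
    have "smooth_path_on (level_mfd l) {p i..p (Suc i)} \<gamma>" if i: "i < n" for i
    proof -
      have "{p i..p (Suc i)} \<subseteq> {0..1}" using inside[of n p i] p i by simp
      then have "\<gamma> ` {p i..p (Suc i)} \<subseteq> level l" using \<gamma> by blast
      then show ?thesis using level_path_iff p(3) i by blast
    qed
    then show "piecewise_smooth_path (level_mfd l) \<gamma>"
      unfolding piecewise_smooth_path_def using p by blast
  qed
qed

lemma level_length:
  assumes "pw_smooth \<gamma> a b" "\<gamma> ` {a..b} \<subseteq> level l"
  shows "((\<lambda>t. sqrt (level_metric M f l g (\<gamma> t) (velocity (level_mfd l) \<gamma> t) (velocity (level_mfd l) \<gamma> t)))
    has_integral len (\<lambda>_. 1) \<gamma> a b) {a..b}"
  using assms
proof (induction rule: pw_smooth.induct)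
  case (piece a b)
  have "(speed (\<lambda>_. 1) \<gamma> has_integral len (\<lambda>_. 1) \<gamma> a b) (cbox a b)"
    using pw_smooth_speed_integrable[OF conformal_weight_one pw_smooth.piece[OF piece(1,2)]]
    by (simp add: len_def integrable_integral)
  then have "((\<lambda>t. sqrt (level_metric M f l g (\<gamma> t) (velocity (level_mfd l) \<gamma> t) (velocity (level_mfd l) \<gamma> t)))
    has_integral len (\<lambda>_. 1) \<gamma> a b) (cbox a b)"
  proof (rule has_integral_spike_interior)
    fix t assume t: "t \<in> box a b"
    have I: "smooth_path_on M {a<..<b} \<gamma>" by (rule smooth_path_on_subset[OF piece(2)]) auto
    have im: "\<gamma> ` {a<..<b} \<subseteq> level l" using piece(3) by (meson greaterThanLessThan_subseteq_atLeastAtMost_iff image_mono order_refl order_trans)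
    show "sqrt (level_metric M f l g (\<gamma> t) (velocity (level_mfd l) \<gamma> t) (velocity (level_mfd l) \<gamma> t)) = speed (\<lambda>_. 1) \<gamma> t"
      using level_velocity[OF I _ _ im, of t] t by (simp add: level_metric_def pullback_def speed_def box_real)
  qed
  then show ?case by simp
next
  case (append a b c)
  have ab: "a < b" "b < c" using append pw_smooth_less by auto
  then have "{a..b} \<subseteq> {a..c}" "{b..c} \<subseteq> {a..c}" by auto
  then have sub: "\<gamma> ` {a..b} \<subseteq> level l" "\<gamma> ` {b..c} \<subseteq> level l" using append.prems by blast+
  show ?case
    unfolding len_append[OF conformal_weight_one append.hyps(1,2)]
    by (rule has_integral_combine[OF _ _ append.IH(1)[OF sub(1)] append.IH(2)[OF sub(2)]]) (use ab in auto)
qed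

lemma level_pseudo_dist: "pseudo_dist (level_mfd l) (level_metric M f l g) = path_dist (\<lambda>_. 1) (level l)"
proof (intro ext)
  fix x y
  have "{\<gamma>. piecewise_smooth_path (level_mfd l) \<gamma> \<and> \<gamma> 0 = x \<and> \<gamma> 1 = y} = paths_in (level l) x y"
    by (auto simp: paths_in_def piecewise_level_path_iff)
  moreover have "path_length (level_mfd l) (level_metric M f l g) \<gamma> = len (\<lambda>_. 1) \<gamma> 0 1"
    if "\<gamma> \<in> paths_in (level l) x y" for \<gamma>
    using level_length[of \<gamma> 0 1 l] that by (auto simp: path_length_def paths_in_def integral_unique)
  ultimately show "pseudo_dist (level_mfd l) (level_metric M f l g) x y = path_dist (\<lambda>_. 1) (level l) x y"
    unfolding pseudo_dist_def path_dist_def by (auto intro!: INF_cong)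
qed

end

lemma (in riemannian) weighted_pseudo_dist:
  "pseudo_dist M (\<lambda>x \<xi> \<eta>. \<rho> x * g x \<xi> \<eta>) = path_dist \<rho> (pts M)"
proof (intro ext)
  fix x y
  have "{\<gamma>. piecewise_smooth_path M \<gamma> \<and> \<gamma> 0 = x \<and> \<gamma> 1 = y} = paths_in (pts M) x y"
    using pw_smooth_in_pts by (fastforce simp: paths_in_def piecewise_smooth_path_iff)
  then show "pseudo_dist M (\<lambda>x \<xi> \<eta>. \<rho> x * g x \<xi> \<eta>) x y = path_dist \<rho> (pts M) x y"
    by (simp add: pseudo_dist_def path_dist_def path_length_def len_def speed_def[abs_def])
qed


section \<open>Completions\<close>

context Metric_space
begin

lemma dist_Cauchy_convergent:
  assumes "MCauchy z" "MCauchy z'"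
  shows "convergent (\<lambda>k. d (z k) (z' k))"
proof -
  have in_M: "z k \<in> M" "z' k \<in> M" for k using assms by (auto simp: MCauchy_def)
  have "Cauchy (\<lambda>k. d (z k) (z' k))"
  proof (rule metric_CauchyI)
    fix e :: real assume e: "e > 0"
    obtain N where N: "\<And>n n'. N \<le> n \<Longrightarrow> N \<le> n' \<Longrightarrow> d (z n) (z n') < e/2"
      using assms(1) e unfolding MCauchy_def by (meson half_gt_zero)
    obtain N' where N': "\<And>n n'. N' \<le> n \<Longrightarrow> N' \<le> n' \<Longrightarrow> d (z' n) (z' n') < e/2"
      using assms(2) e unfolding MCauchy_def by (meson half_gt_zero)
    have "dist (d (z i) (z' i)) (d (z j) (z' j)) < e" if "max N N' \<le> i" "max N N' \<le> j" for i j
    proof -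
      have "d (z i) (z' i) \<le> d (z i) (z j) + (d (z j) (z' j) + d (z' j) (z' i))"
        using triangle[of "z i" "z j" "z' i"] triangle[of "z j" "z' j" "z' i"] in_M by smt
      moreover have "d (z j) (z' j) \<le> d (z j) (z i) + (d (z i) (z' i) + d (z' i) (z' j))"
        using triangle[of "z j" "z i" "z' j"] triangle[of "z i" "z' i" "z' j"] in_M by smt
      ultimately show ?thesis
        using N[of i j] N'[of i j] that commute[of "z j" "z i"] commute[of "z' j" "z' i"]
        by (simp add: dist_real_def abs_less_iff)
    qed
    then show "\<exists>K. \<forall>i\<ge>K. \<forall>j\<ge>K. dist (d (z i) (z' i)) (d (z j) (z' j)) < e" by blast
  qed
  then show ?thesis by (simp add: Cauchy_convergent_iff)
qed

lemma equiv_cauchy_rel: "equiv (cauchy_seqs M d) (cauchy_rel M d)"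
proof (rule equivI)
  show "cauchy_rel M d \<subseteq> cauchy_seqs M d \<times> cauchy_seqs M d" by (auto simp: cauchy_rel_def)
  show "refl_on (cauchy_seqs M d) (cauchy_rel M d)"
    by (auto simp: refl_on_def cauchy_rel_def cauchy_seqs_def MCauchy_def image_subset_iff)
  show "sym (cauchy_rel M d)" by (auto simp: sym_def cauchy_rel_def commute)
  show "trans (cauchy_rel M d)"
  proof (rule transI)
    fix x y z assume xy: "(x, y) \<in> cauchy_rel M d" and yz: "(y, z) \<in> cauchy_rel M d"
    have "(\<lambda>k. d (x k) (y k) + d (y k) (z k)) \<longlonglongrightarrow> 0"
      using tendsto_add[of "\<lambda>k. d (x k) (y k)" 0 sequentially "\<lambda>k. d (y k) (z k)" 0] xy yz
      by (simp add: cauchy_rel_def)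
    then have "(\<lambda>k. d (x k) (z k)) \<longlonglongrightarrow> 0"
    proof (rule tendsto_sandwich[rotated 3])
      show "\<forall>\<^sub>F k in sequentially. d (x k) (z k) \<le> d (x k) (y k) + d (y k) (z k)"
        using xy yz by (intro always_eventually allI triangle) (auto simp: cauchy_rel_def cauchy_seqs_def MCauchy_def)
    qed auto
    then show "(x, z) \<in> cauchy_rel M d" using xy yz by (simp add: cauchy_rel_def)
  qed
qed

lemma cauchy_class_eq_iff:
  "z \<in> cauchy_seqs M d \<Longrightarrow> z' \<in> cauchy_seqs M d \<Longrightarrow>
    cauchy_class M d z = cauchy_class M d z' \<longleftrightarrow> (\<lambda>k. d (z k) (z' k)) \<longlonglongrightarrow> 0"
  using eq_equiv_class_iff[OF equiv_cauchy_rel, of z z'] by (simp add: cauchy_class_def cauchy_rel_def)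

lemma completionE:
  assumes "Y \<in> completion M d"
  obtains z where "z \<in> cauchy_seqs M d" "Y = cauchy_class M d z"
  using assms by (auto simp: completion_def cauchy_class_def elim: quotientE)

lemma cauchy_class_in_completion: "z \<in> cauchy_seqs M d \<Longrightarrow> cauchy_class M d z \<in> completion M d"
  by (simp add: completion_def cauchy_class_def quotientI)

text \<open>The limit exists, as the distances form a real Cauchy sequence, and it is the same for all
  representatives; so the description in \<open>completion_dist\<close> denotes it.\<close>

lemma completion_dist_tendsto:
  assumes z: "z \<in> cauchy_seqs M d" "z' \<in> cauchy_seqs M d"
  shows "(\<lambda>k. d (z k) (z' k)) \<longlonglongrightarrow> completion_dist M d (cauchy_class M d z) (cauchy_class M d z')"
proof -
  obtain r where r: "(\<lambda>k. d (z k) (z' k)) \<longlonglongrightarrow> r"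
    using dist_Cauchy_convergent z unfolding cauchy_seqs_def convergent_def by blast
  have lim: "(\<lambda>k. d (w k) (w' k)) \<longlonglongrightarrow> r"
    if w: "w \<in> cauchy_class M d z" "w' \<in> cauchy_class M d z'" for w w'
  proof -
    have rel: "(z, w) \<in> cauchy_rel M d" "(z', w') \<in> cauchy_rel M d" using w by (auto simp: cauchy_class_def)
    have in_M: "z k \<in> M" "z' k \<in> M" "w k \<in> M" "w' k \<in> M" for k
      using rel by (auto simp: cauchy_rel_def cauchy_seqs_def MCauchy_def)
    have "(\<lambda>k. d (z k) (w k) + d (z' k) (w' k)) \<longlonglongrightarrow> 0"
      using tendsto_add[of "\<lambda>k. d (z k) (w k)" 0 sequentially "\<lambda>k. d (z' k) (w' k)" 0] rel
      by (simp add: cauchy_rel_def)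
    then have "(\<lambda>k. d (w k) (w' k) - d (z k) (z' k)) \<longlonglongrightarrow> 0"
    proof (rule tendsto_rabs_zero_cancel[OF tendsto_sandwich[rotated 3]])
      have "\<bar>d (w k) (w' k) - d (z k) (z' k)\<bar> \<le> d (z k) (w k) + d (z' k) (w' k)" for k
        using triangle[of "w k" "z k" "w' k"] triangle[of "z k" "z' k" "w' k"]
          triangle[of "z k" "w k" "z' k"] triangle[of "w k" "w' k" "z' k"] in_M[of k]
          commute[of "w k" "z k"] commute[of "w' k" "z' k"] by linarith
      then show "\<forall>\<^sub>F k in sequentially. \<bar>d (w k) (w' k) - d (z k) (z' k)\<bar> \<le> d (z k) (w k) + d (z' k) (w' k)"
        by simp
    qed auto
    from tendsto_add[OF this r] show ?thesis by simp
  qed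
  have self: "z \<in> cauchy_class M d z" "z' \<in> cauchy_class M d z'"
    using equiv_class_self[OF equiv_cauchy_rel] z by (auto simp: cauchy_class_def)
  have "completion_dist M d (cauchy_class M d z) (cauchy_class M d z') = r"
    unfolding completion_dist_def
    using z by (auto simp: cauchy_class_in_completion intro!: the_equality bexI[OF _ self(1)] bexI[OF _ self(2)] r
        dest: lim LIMSEQ_unique)
  with r show ?thesis by simp
qed

lemma completion_dist_eqI:
  "z \<in> cauchy_seqs M d \<Longrightarrow> z' \<in> cauchy_seqs M d \<Longrightarrow> (\<lambda>k. d (z k) (z' k)) \<longlonglongrightarrow> r \<Longrightarrow>
    completion_dist M d (cauchy_class M d z) (cauchy_class M d z') = r"
  using completion_dist_tendsto LIMSEQ_unique by blast

lemma completion_metric: "Metric_space (completion M d) (completion_dist M d)"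
proof
  fix X Y
  have *: "0 \<le> completion_dist M d X Y \<and> completion_dist M d X Y = completion_dist M d Y X \<and>
      (completion_dist M d X Y = 0 \<longleftrightarrow> X = Y)" if XY: "X \<in> completion M d" "Y \<in> completion M d" for X Y
  proof -
    obtain x where x: "x \<in> cauchy_seqs M d" "X = cauchy_class M d x" using XY(1) by (rule completionE)
    obtain y where y: "y \<in> cauchy_seqs M d" "Y = cauchy_class M d y" using XY(2) by (rule completionE)
    note t = completion_dist_tendsto[OF x(1) y(1)]
    have "0 \<le> completion_dist M d X Y"
      using LIMSEQ_le_const[OF t, of 0] x(2) y(2) by simp
    moreover have "completion_dist M d Y X = completion_dist M d X Y"
      unfolding x(2) y(2) by (rule completion_dist_eqI[OF y(1) x(1)]) (use t in \<open>simp add: commute\<close>)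
    moreover have "completion_dist M d X Y = 0 \<longleftrightarrow> X = Y"
      unfolding x(2) y(2) cauchy_class_eq_iff[OF x(1) y(1)]
    proof
      show "(\<lambda>k. d (x k) (y k)) \<longlonglongrightarrow> 0"
        if "completion_dist M d (cauchy_class M d x) (cauchy_class M d y) = 0"
        using t that by simp
    qed (rule completion_dist_eqI[OF x(1) y(1)])
    ultimately show ?thesis by simp
  qed
  show "0 \<le> completion_dist M d X Y"
    by (cases "X \<in> completion M d \<and> Y \<in> completion M d") (use * in \<open>auto simp: completion_dist_def\<close>)
  show "completion_dist M d X Y = completion_dist M d Y X"
    by (cases "X \<in> completion M d \<and> Y \<in> completion M d") (use * in \<open>auto simp: completion_dist_def\<close>)
  show "completion_dist M d X Y = 0 \<longleftrightarrow> X = Y" if "X \<in> completion M d" "Y \<in> completion M d"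
    using * that by blast
  fix Z assume XYZ: "X \<in> completion M d" "Y \<in> completion M d" "Z \<in> completion M d"
  obtain x where x: "x \<in> cauchy_seqs M d" "X = cauchy_class M d x" using XYZ(1) by (rule completionE)
  obtain y where y: "y \<in> cauchy_seqs M d" "Y = cauchy_class M d y" using XYZ(2) by (rule completionE)
  obtain z where z: "z \<in> cauchy_seqs M d" "Z = cauchy_class M d z" using XYZ(3) by (rule completionE)
  have "d (x k) (z k) \<le> d (x k) (y k) + d (y k) (z k)" for k
    using x y z by (intro triangle) (auto simp: cauchy_seqs_def MCauchy_def)
  then show "completion_dist M d X Z \<le> completion_dist M d X Y + completion_dist M d Y Z"
    unfolding x(2) y(2) z(2)
    by (intro LIMSEQ_le[OF completion_dist_tendsto[OF x(1) z(1)]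
          tendsto_add[OF completion_dist_tendsto[OF x(1) y(1)] completion_dist_tendsto[OF y(1) z(1)]]]) auto
qed

end

lemma continuous_map_locally_Lipschitz:
  assumes mX: "Metric_space X dX" and mY: "Metric_space Y dY" and h: "h ` X \<subseteq> Y" and e: "e > 0"
    and lip: "\<And>x x'. x \<in> X \<Longrightarrow> x' \<in> X \<Longrightarrow> dX x x' < e \<Longrightarrow> dY (h x) (h x') \<le> K * dX x x'"
  shows "continuous_map (Metric_space.mtopology X dX) (Metric_space.mtopology Y dY) h"
proof -
  interpret X: Metric_space X dX by fact
  show ?thesis
    unfolding X.metric_continuous_map[OF mY]
  proof (intro conjI ballI allI impI h)
    fix a and r :: real assume a: "a \<in> X" and r: "r > 0"
    have "dY (h a) (h x) < r" if x: "x \<in> X" "dX a x < min e (r / (\<bar>K\<bar> + 1))" for x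
    proof -
      have "dY (h a) (h x) \<le> K * dX a x" using lip a x by simp
      also have "\<dots> \<le> (\<bar>K\<bar> + 1) * dX a x" by (intro mult_right_mono) auto
      also have "\<dots> < r" using x(2) by (simp add: pos_less_divide_eq mult.commute add_nonneg_pos)
      finally show ?thesis .
    qed
    then show "\<exists>\<delta>>0. \<forall>x. x \<in> X \<and> dX a x < \<delta> \<longrightarrow> dY (h a) (h x) < r"
      using r e by (intro exI[of _ "min e (r / (\<bar>K\<bar> + 1))"]) (auto simp: add_nonneg_pos)
  qed
qed

lemma cauchy_seqs_locally_Lipschitz:
  assumes mX: "Metric_space X dX" and mY: "Metric_space Y dY" and e: "e > 0"
    and lip: "\<And>x x'. x \<in> Y \<Longrightarrow> x' \<in> Y \<Longrightarrow> dX x x' < e \<Longrightarrow> dY x x' \<le> K * dX x x'"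
    and y: "y \<in> cauchy_seqs X dX" "range y \<subseteq> Y"
  shows "y \<in> cauchy_seqs Y dY"
  unfolding cauchy_seqs_def mem_Collect_eq Metric_space.MCauchy_def[OF mY]
proof (intro conjI allI impI y(2))
  fix r :: real assume r: "r > 0"
  then have "min e (r / (\<bar>K\<bar> + 1)) > 0" using e by (simp add: add_nonneg_pos)
  then obtain N where N: "\<And>n n'. N \<le> n \<Longrightarrow> N \<le> n' \<Longrightarrow> dX (y n) (y n') < min e (r / (\<bar>K\<bar> + 1))"
    using y(1) unfolding cauchy_seqs_def mem_Collect_eq Metric_space.MCauchy_def[OF mX] by meson
  have "dY (y n) (y n') < r" if "N \<le> n" "N \<le> n'" for n n'
  proof -
    have "y n \<in> Y" "y n' \<in> Y" using y(2) by auto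
    then have "dY (y n) (y n') \<le> K * dX (y n) (y n')" using lip N[OF that] by simp
    also have "\<dots> \<le> (\<bar>K\<bar> + 1) * dX (y n) (y n')"
      using Metric_space.nonneg[OF mX] by (intro mult_right_mono) auto
    also have "\<dots> < r" using N[OF that] by (simp add: pos_less_divide_eq mult.commute add_nonneg_pos)
    finally show ?thesis .
  qed
  then show "\<exists>N. \<forall>n n'. N \<le> n \<longrightarrow> N \<le> n' \<longrightarrow> dY (y n) (y n') < r" by blast
qed

lemma homeomorphic_map_locally_bilipschitz:
  assumes mX: "Metric_space X dX" and "Metric_space Y dY" and bij: "bij_betw h X T" and T: "T \<subseteq> Y"
    and upper: "\<And>x x'. x \<in> X \<Longrightarrow> x' \<in> X \<Longrightarrow> dY (h x) (h x') \<le> A * dX x x'"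
    and e: "e > 0" and lower: "\<And>x x'. x \<in> X \<Longrightarrow> x' \<in> X \<Longrightarrow> dY (h x) (h x') < e \<Longrightarrow> dX x x' \<le> K * dY (h x) (h x')"
  shows "homeomorphic_map (Metric_space.mtopology X dX) (subtopology (Metric_space.mtopology Y dY) T) h"
proof -
  interpret X: Metric_space X dX by fact
  interpret Y: Metric_space Y dY by fact
  interpret T: Submetric Y dY T by unfold_locales (rule T)
  define k where "k = inv_into X h"
  have im: "h ` X \<subseteq> T" and kh: "\<And>x. x \<in> X \<Longrightarrow> k (h x) = x"
    using bij by (auto simp: k_def bij_betw_def inv_into_f_f)
  have hk: "h (k y) = y" "k y \<in> X" if "y \<in> T" for y
    using bij that by (auto simp: k_def bij_betw_def f_inv_into_f inv_into_into)
  have "continuous_map X.mtopology T.sub.mtopology h"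
    by (rule continuous_map_locally_Lipschitz[OF mX T.sub.Metric_space_axioms im zero_less_one upper])
  moreover have "dX (k y) (k y') \<le> K * dY y y'" if "y \<in> T" "y' \<in> T" "dY y y' < e" for y y'
    using lower[of "k y" "k y'"] hk that by simp
  then have "continuous_map T.sub.mtopology X.mtopology k"
    by (intro continuous_map_locally_Lipschitz[OF T.sub.Metric_space_axioms mX _ e]) (use hk in auto)
  ultimately have "homeomorphic_maps X.mtopology T.sub.mtopology h k"
    using kh hk by (simp add: homeomorphic_maps_def)
  then show ?thesis
    unfolding T.mtopology_submetric[symmetric] using homeomorphic_map_maps by blast
qed

text \<open>The two distances on \<open>S\<close> have the same Cauchy sequences and the same null sequences of
  distances, which identifies the completion of \<open>S\<close> with the classes of sequences that are
  asymptotic to sequences in \<open>S\<close>.\<close>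

lemma completion_embedding:
  assumes mX: "Metric_space X dX" and mS: "Metric_space S dS" and S: "S \<subseteq> X"
    and upper: "\<And>x y. x \<in> S \<Longrightarrow> y \<in> S \<Longrightarrow> dX x y \<le> A * dS x y"
    and e: "e > 0" and lower: "\<And>x y. x \<in> S \<Longrightarrow> y \<in> S \<Longrightarrow> dX x y < e \<Longrightarrow> dS x y \<le> K * dX x y"
    and PS: "\<And>y. range y \<subseteq> S \<Longrightarrow> P y"
    and proj: "\<And>x. x \<in> cauchy_seqs X dX \<Longrightarrow> P x \<Longrightarrow> \<exists>y. range y \<subseteq> S \<and> (\<lambda>k. dX (x k) (y k)) \<longlonglongrightarrow> 0"
  shows "\<exists>\<Phi>. (\<forall>y\<in>cauchy_seqs S dS. y \<in> cauchy_seqs X dX \<and> \<Phi> (cauchy_class S dS y) = cauchy_class X dX y)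
    \<and> homeomorphic_map (completion_topology S dS)
        (subtopology (completion_topology X dX) {cauchy_class X dX x | x. x \<in> cauchy_seqs X dX \<and> P x}) \<Phi>"
proof -
  interpret X: Metric_space X dX by fact
  interpret S: Metric_space S dS by fact
  have CSX: "y \<in> cauchy_seqs X dX" if y: "y \<in> cauchy_seqs S dS" for y
  proof -
    have yS: "range y \<subseteq> S" using y by (simp add: cauchy_seqs_def S.MCauchy_def)
    have "y \<in> cauchy_seqs S dX"
      by (rule cauchy_seqs_locally_Lipschitz[OF mS X.subspace[OF S] zero_less_one upper y yS])
    then show ?thesis
      using yS S by (auto simp: cauchy_seqs_def X.MCauchy_def Metric_space.MCauchy_def[OF X.subspace[OF S]])
  qed
  have CXS: "y \<in> cauchy_seqs S dS" if y: "y \<in> cauchy_seqs X dX" "range y \<subseteq> S" for y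
    by (rule cauchy_seqs_locally_Lipschitz[OF mX mS e lower y])
  have inS: "y k \<in> S" if "y \<in> cauchy_seqs S dS" for y k using that by (auto simp: cauchy_seqs_def S.MCauchy_def)
  \<comment> \<open>well defined because equivalent sequences in \<open>S\<close> are equivalent in \<open>X\<close>\<close>
  define \<Phi> where "\<Phi> = (\<lambda>Y. cauchy_class X dX (SOME y. y \<in> Y))"
  let ?DX = "completion_dist X dX" and ?DS = "completion_dist S dS"
  let ?cX = "cauchy_class X dX" and ?cS = "cauchy_class S dS"
  have up: "?DX (?cX y) (?cX y') \<le> A * ?DS (?cS y) (?cS y')"
    if y: "y \<in> cauchy_seqs S dS" "y' \<in> cauchy_seqs S dS" for y y'
    by (rule LIMSEQ_le[OF X.completion_dist_tendsto[OF CSX[OF y(1)] CSX[OF y(2)]]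
          tendsto_mult_left[OF S.completion_dist_tendsto[OF y]]]) (use upper inS y in auto)
  have low: "?DS (?cS y) (?cS y') \<le> K * ?DX (?cX y) (?cX y')"
    if y: "y \<in> cauchy_seqs S dS" "y' \<in> cauchy_seqs S dS" and small: "?DX (?cX y) (?cX y') < e" for y y'
  proof -
    note t = X.completion_dist_tendsto[OF CSX[OF y(1)] CSX[OF y(2)]]
    have "\<forall>\<^sub>F k in sequentially. dX (y k) (y' k) < e"
      using order_tendstoD(2)[OF t small] .
    then have "\<forall>\<^sub>F k in sequentially. dS (y k) (y' k) \<le> K * dX (y k) (y' k)"
      by eventually_elim (use lower inS y in blast)
    then show ?thesis
      using tendsto_le[OF sequentially_bot tendsto_mult_left[OF t, of K] S.completion_dist_tendsto[OF y]] by blast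
  qed
  have \<Phi>: "\<Phi> (?cS y) = ?cX y" if y: "y \<in> cauchy_seqs S dS" for y
  proof -
    define w where "w = (SOME w. w \<in> ?cS y)"
    have "w \<in> ?cS y"
      unfolding w_def using equiv_class_self[OF S.equiv_cauchy_rel y] by (intro someI[of "\<lambda>w. w \<in> ?cS y"]) (simp add: cauchy_class_def)
    then have w: "w \<in> cauchy_seqs S dS" "(\<lambda>k. dS (y k) (w k)) \<longlonglongrightarrow> 0"
      by (auto simp: cauchy_class_def cauchy_rel_def)
    then have eq: "?cS y = ?cS w" using S.cauchy_class_eq_iff y by blast
    have "?DS (?cS w) (?cS w) = 0"
      using Metric_space.zero[OF S.completion_metric] S.cauchy_class_in_completion[OF w(1)] by blast
    then have "?DX (?cX y) (?cX w) \<le> 0" using up[OF y w(1)] unfolding eq by simp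
    then have "?DX (?cX y) (?cX w) = 0"
      using Metric_space.nonneg[OF X.completion_metric] by (metis antisym)
    then have "?cX y = ?cX w"
      using Metric_space.zero[OF X.completion_metric] X.cauchy_class_in_completion CSX y w(1) by blast
    then show ?thesis by (simp add: \<Phi>_def w_def)
  qed
  let ?T = "{?cX x | x. x \<in> cauchy_seqs X dX \<and> P x}"
  have "bij_betw \<Phi> (completion S dS) ?T"
    unfolding bij_betw_def
  proof
    show "inj_on \<Phi> (completion S dS)"
    proof (rule inj_onI)
      fix Y Y' assume YY: "Y \<in> completion S dS" "Y' \<in> completion S dS" "\<Phi> Y = \<Phi> Y'"
      obtain y where y: "y \<in> cauchy_seqs S dS" "Y = ?cS y" using YY(1) by (rule S.completionE)
      obtain y' where y': "y' \<in> cauchy_seqs S dS" "Y' = ?cS y'" using YY(2) by (rule S.completionE)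
      have "?cX y = ?cX y'" using YY(3) \<Phi> y y' by simp
      then have "?DX (?cX y) (?cX y') = 0"
        using Metric_space.zero[OF X.completion_metric] X.cauchy_class_in_completion CSX y(1) y'(1) by blast
      then have "?DS (?cS y) (?cS y') \<le> 0" using low[OF y(1) y'(1)] e by simp
      then have "?DS (?cS y) (?cS y') = 0"
        using Metric_space.nonneg[OF S.completion_metric] by (metis antisym)
      then show "Y = Y'"
        using Metric_space.zero[OF S.completion_metric] YY(1,2) y(2) y'(2) by blast
    qed
    show "\<Phi> ` completion S dS = ?T"
    proof (intro subset_antisym subsetI)
      fix Z assume "Z \<in> \<Phi> ` completion S dS"
      then obtain y where y: "y \<in> cauchy_seqs S dS" "Z = \<Phi> (?cS y)" by (auto elim: S.completionE)
      moreover have "P y" using PS inS[OF y(1)] by blast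
      ultimately show "Z \<in> ?T" using \<Phi> CSX by auto
    next
      fix Z assume "Z \<in> ?T"
      then obtain x where x: "x \<in> cauchy_seqs X dX" "P x" "Z = ?cX x" by blast
      obtain y where y: "range y \<subseteq> S" "(\<lambda>k. dX (x k) (y k)) \<longlonglongrightarrow> 0" using proj[OF x(1,2)] by blast
      have xX: "x k \<in> X" and yX: "y k \<in> X" for k
        using x(1) y(1) S by (auto simp: cauchy_seqs_def X.MCauchy_def)
      have yC: "y \<in> cauchy_seqs X dX"
        unfolding cauchy_seqs_def mem_Collect_eq X.MCauchy_def
      proof (intro conjI allI impI)
        show "range y \<subseteq> X" using yX by blast
        fix r :: real assume r: "r > 0"
        obtain N where N: "\<And>n n'. N \<le> n \<Longrightarrow> N \<le> n' \<Longrightarrow> dX (x n) (x n') < r / 3"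
          using x(1) r unfolding cauchy_seqs_def mem_Collect_eq X.MCauchy_def by (meson divide_pos_pos zero_less_numeral)
        obtain N' where N': "\<And>n. N' \<le> n \<Longrightarrow> dX (x n) (y n) < r / 3"
          using order_tendstoD(2)[OF y(2), of "r / 3"] r by (auto simp: eventually_sequentially)
        have "dX (y n) (y n') < r" if "max N N' \<le> n" "max N N' \<le> n'" for n n'
          using X.triangle[of "y n" "x n" "y n'"] X.triangle[of "x n" "x n'" "y n'"] X.commute[of "x n" "y n"]
            xX yX N[of n n'] N'[of n] N'[of n'] that by simp
        then show "\<exists>N. \<forall>n n'. N \<le> n \<longrightarrow> N \<le> n' \<longrightarrow> dX (y n) (y n') < r" by blast
      qed
      then have "?cX x = ?cX y" using X.cauchy_class_eq_iff x(1) y(2) by blast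
      moreover have "y \<in> cauchy_seqs S dS" using CXS yC y(1) by blast
      ultimately show "Z \<in> \<Phi> ` completion S dS"
        using x(3) \<Phi> S.cauchy_class_in_completion by (intro image_eqI[of _ _ "?cS y"]) auto
    qed
  qed
  then have "homeomorphic_map (completion_topology S dS) (subtopology (completion_topology X dX) ?T) \<Phi>"
    unfolding completion_topology_def
  proof (rule homeomorphic_map_locally_bilipschitz[OF S.completion_metric X.completion_metric _ _ _ e])
    show "?T \<subseteq> completion X dX" using X.cauchy_class_in_completion by blast
    show "?DX (\<Phi> Y) (\<Phi> Y') \<le> A * ?DS Y Y'" if "Y \<in> completion S dS" "Y' \<in> completion S dS" for Y Y'
      using that up \<Phi> by (metis S.completionE)
    show "?DS Y Y' \<le> K * ?DX (\<Phi> Y) (\<Phi> Y')"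
      if "Y \<in> completion S dS" "Y' \<in> completion S dS" "?DX (\<Phi> Y) (\<Phi> Y') < e" for Y Y'
      using that low \<Phi> by (metis S.completionE)
  qed
  with \<Phi> CSX show ?thesis by (intro exI[of _ \<Phi>]) blast
qed


section \<open>The completion of a level set\<close>

context homogeneous_metric
begin

lemma induced_by_metric:
  assumes "induces_metric M g"
  shows "\<And>x y \<rho>. x \<in> pts M \<Longrightarrow> y \<in> pts M \<Longrightarrow> path_dist \<rho> (pts M) x y < \<infinity>"
    and "\<And>x y. x \<in> pts M \<Longrightarrow> y \<in> pts M \<Longrightarrow> rpath_dist (\<lambda>_. 1) (pts M) x y = 0 \<Longrightarrow> x = y"
proof -
  have pd: "pseudo_dist M g = path_dist (\<lambda>_. 1) (pts M)"
    using weighted_pseudo_dist[of "\<lambda>_. 1"] by simp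
  show "path_dist \<rho> (pts M) x y < \<infinity>" if "x \<in> pts M" "y \<in> pts M" for x y \<rho>
    using assms that unfolding induces_metric_def pd path_dist_finite_iff by blast
  have "Metric_space (pts M) (rdist M g)" using assms by (simp add: induces_metric_def)
  from Metric_space.zero[OF this]
  show "x = y" if "x \<in> pts M" "y \<in> pts M" "rpath_dist (\<lambda>_. 1) (pts M) x y = 0" for x y
    using that by (simp add: rdist_def pd rpath_dist_def)
qed

lemma level_subset: "level l \<subseteq> pts M"
  by (auto simp: level_def)

text \<open>For separation: at distance \<open>0\<close> there are arbitrarily short paths, and \<open>local_comparison\<close> at the
  level of \<open>x\<close> bounds the distance of \<open>g\<close> by a multiple of the distance of \<open>(v \<circ> f) g\<close>.\<close>

lemma weighted_induces_metric:
  assumes ind: "induces_metric M g"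
    and v: "continuous_on {0<..} v" "\<And>s. s > 0 \<Longrightarrow> v s > (0::real)"
  shows "induces_metric M (\<lambda>x \<xi> \<eta>. (v \<circ> f) x * g x \<xi> \<eta>)"
    "Metric_space (pts M) (rpath_dist (v \<circ> f) (pts M))"
proof -
  note fin = induced_by_metric(1)[OF ind]
  have zero: "x = y" if x: "x \<in> pts M" "y \<in> pts M" and d0: "path_dist (v \<circ> f) (pts M) x y = 0" for x y
  proof -
    have l: "f x > 0" "x \<in> level (f x)" using f_pos[OF x(1)] x(1) by (auto simp: level_def)
    obtain d K where "d > 0" "K \<ge> 0"
      "\<And>y. paths_in (pts M) x y \<noteq> {} \<Longrightarrow> rpath_dist (v \<circ> f) (pts M) x y < d \<Longrightarrow>
        rpath_dist (\<lambda>_. 1) (pts M) x y \<le> K * rpath_dist (v \<circ> f) (pts M) x y"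
      using local_comparison[OF v alpha_pos[OF x(1)] l(1)] l(2) by metis
    then have "rpath_dist (\<lambda>_. 1) (pts M) x y \<le> 0"
      using d0 fin[OF x] path_dist_finite_iff by (metis enn2real_0 mult_zero_right rpath_dist_def)
    then have "rpath_dist (\<lambda>_. 1) (pts M) x y = 0" by (simp add: rpath_dist_def antisym)
    then show ?thesis using induced_by_metric(2)[OF ind x] by blast
  qed
  show m: "Metric_space (pts M) (rpath_dist (v \<circ> f) (pts M))"
    using path_dist_metric[OF conformal_weight_f[OF v] order_refl fin zero] unfolding rpath_dist_def[abs_def] by blast
  have "rdist M (\<lambda>x \<xi> \<eta>. (v \<circ> f) x * g x \<xi> \<eta>) = rpath_dist (v \<circ> f) (pts M)"
    unfolding rdist_def[abs_def] weighted_pseudo_dist rpath_dist_def[abs_def] ..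
  then show "induces_metric M (\<lambda>x \<xi> \<eta>. (v \<circ> f) x * g x \<xi> \<eta>)"
    unfolding induces_metric_def weighted_pseudo_dist using m fin by simp
qed

text \<open>Finiteness: projecting a path of \<open>M\<close> connects the same two points inside the level set. Separation:
  paths in the level set are paths of \<open>M\<close>, so its distance dominates that of \<open>g\<close>.\<close>

lemma level_induces_metric:
  assumes ind: "induces_metric M g" and l: "l > 0"
  shows "induces_metric (level_mfd l) (level_metric M f l g)"
    "Metric_space (level l) (rpath_dist (\<lambda>_. 1) (level l))"
    "\<And>x y. x \<in> level l \<Longrightarrow> y \<in> level l \<Longrightarrow> paths_in (level l) x y \<noteq> {}"
proof -
  show ne: "paths_in (level l) x y \<noteq> {}" if "x \<in> level l" "y \<in> level l" for x y
  proof -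
    have "paths_in (pts M) x y \<noteq> {}"
      using induced_by_metric(1)[OF ind] level_subset that path_dist_finite_iff by blast
    then show ?thesis using level_proj_paths_in that l by blast
  qed
  have fin: "path_dist (\<lambda>_. 1) (level l) x y < \<infinity>" if "x \<in> level l" "y \<in> level l" for x y
    using ne that path_dist_finite_iff by blast
  have zero: "x = y" if x: "x \<in> level l" "y \<in> level l" and d0: "path_dist (\<lambda>_. 1) (level l) x y = 0" for x y
  proof -
    have "path_dist (\<lambda>_. 1) (pts M) x y \<le> path_dist (\<lambda>_. 1) (level l) x y"
      unfolding path_dist_def by (intro INF_superset_mono paths_in_mono level_subset) simp
    then have "rpath_dist (\<lambda>_. 1) (pts M) x y = 0" using d0 by (simp add: rpath_dist_def)
    then show ?thesis using induced_by_metric(2)[OF ind] level_subset x by blast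
  qed
  show m: "Metric_space (level l) (rpath_dist (\<lambda>_. 1) (level l))"
    using path_dist_metric[OF conformal_weight_one level_subset fin zero] unfolding rpath_dist_def[abs_def] by blast
  have "rdist (level_mfd l) (level_metric M f l g) = rpath_dist (\<lambda>_. 1) (level l)"
    unfolding rdist_def[abs_def] level_pseudo_dist rpath_dist_def[abs_def] ..
  then show "induces_metric (level_mfd l) (level_metric M f l g)"
    unfolding induces_metric_def level_pseudo_dist level_mfd_pts using m fin by simp
qed

text \<open>The orbit segments from \<open>x k\<close> to the level set have lengths at most of order \<open>|ln (l / f (x k))|\<close>.\<close>

lemma asymptotic_to_level:
  assumes v: "continuous_on {0<..} v" "\<And>s. s > 0 \<Longrightarrow> v s > (0::real)" and l: "l > 0"
    and x: "\<And>k. x k \<in> pts M" and lim: "(\<lambda>k. f (x k)) \<longlonglongrightarrow> l"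
  shows "(\<lambda>k. rpath_dist (v \<circ> f) (pts M) (x k) (level_proj l (x k))) \<longlonglongrightarrow> 0"
proof -
  obtain K where K: "\<And>x. x \<in> pts M \<Longrightarrow> f x \<in> {l/2..2*l} \<Longrightarrow>
      rpath_dist (v \<circ> f) (pts M) x (level_proj l x) \<le> \<bar>ln (l / f x) / \<alpha>\<bar> * K"
    using level_proj_close[OF v l] by blast
  have "\<forall>\<^sub>F k in sequentially. l/2 < f (x k)" "\<forall>\<^sub>F k in sequentially. f (x k) < 2 * l"
    using order_tendstoD(1)[OF lim, of "l/2"] order_tendstoD(2)[OF lim, of "2 * l"] l by auto
  then have bound: "\<forall>\<^sub>F k in sequentially. rpath_dist (v \<circ> f) (pts M) (x k) (level_proj l (x k)) \<le> \<bar>ln (l / f (x k)) / \<alpha>\<bar> * K"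
    by eventually_elim (use K x in auto)
  have "(\<lambda>k. \<bar>ln (l / f (x k)) / \<alpha>\<bar> * K) \<longlonglongrightarrow> \<bar>ln (l / l) / \<alpha>\<bar> * K"
    using l alpha_nonzero by (intro tendsto_intros lim) auto
  then have "(\<lambda>k. \<bar>ln (l / f (x k)) / \<alpha>\<bar> * K) \<longlonglongrightarrow> 0" using l by simp
  from tendsto_sandwich[OF _ bound tendsto_const this] show ?thesis
    by (simp add: rpath_dist_def)
qed

lemma level_completion:
  assumes ind: "induces_metric M g" and l: "l > 0"
    and v: "continuous_on {0<..} v" "\<And>s. s > 0 \<Longrightarrow> v s > (0::real)"
  defines "dX \<equiv> rpath_dist (v \<circ> f) (pts M)" and "dS \<equiv> rpath_dist (\<lambda>_. 1) (level l)"
  shows "\<exists>\<Phi>. (\<forall>y\<in>cauchy_seqs (level l) dS. y \<in> cauchy_seqs (pts M) dX \<and>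
      \<Phi> (cauchy_class (level l) dS y) = cauchy_class (pts M) dX y)
    \<and> homeomorphic_map (completion_topology (level l) dS)
        (subtopology (completion_topology (pts M) dX)
          {cauchy_class (pts M) dX x | x. x \<in> cauchy_seqs (pts M) dX \<and> (\<lambda>k. f (x k)) \<longlonglongrightarrow> l}) \<Phi>"
proof -
  have "\<exists>d>0. \<exists>K. \<forall>x\<in>level l. \<forall>y\<in>level l. dX x y < d \<longrightarrow> dS x y \<le> K * dX x y"
  proof (cases "level l = {}")
    case True
    then show ?thesis by (auto intro: exI[of _ 1])
  next
    case False
    then obtain z where "z \<in> pts M" using level_subset by blast
    then have a: "\<alpha> > 0" by (rule alpha_pos)
    obtain d K where d: "d > 0" "\<And>x y. x \<in> level l \<Longrightarrow> y \<in> level l \<Longrightarrow> paths_in (pts M) x y \<noteq> {} \<Longrightarrow>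
        dX x y < d \<Longrightarrow> dS x y \<le> sqrt 2 * K * dX x y"
      unfolding dX_def dS_def using local_comparison[OF v a l] by metis
    moreover have "paths_in (pts M) x y \<noteq> {}" if "x \<in> level l" "y \<in> level l" for x y
      using induced_by_metric(1)[OF ind] level_subset that path_dist_finite_iff by blast
    ultimately show ?thesis by (intro exI[of _ d] conjI exI[of _ "sqrt 2 * K"]) auto
  qed
  then obtain d K where d: "d > 0" "\<And>x y. x \<in> level l \<Longrightarrow> y \<in> level l \<Longrightarrow> dX x y < d \<Longrightarrow> dS x y \<le> K * dX x y"
    by blast
  show ?thesis
  proof (rule completion_embedding[OF _ _ level_subset _ d])
    show "Metric_space (pts M) dX" unfolding dX_def by (rule weighted_induces_metric(2)[OF ind v])
    show "Metric_space (level l) dS" unfolding dS_def by (rule level_induces_metric(2)[OF ind l])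
    show "dX x y \<le> sqrt (v l) * dS x y" if "x \<in> level l" "y \<in> level l" for x y
      unfolding dX_def dS_def using ambient_le_level[OF v level_induces_metric(3)[OF ind l that] l] .
    show "(\<lambda>k. f (y k)) \<longlonglongrightarrow> l" if "range y \<subseteq> level l" for y :: "nat \<Rightarrow> 'a"
    proof -
      have "f (y k) = l" for k using that by (auto simp: level_def)
      then show ?thesis by simp
    qed
    show "\<exists>y. range y \<subseteq> level l \<and> (\<lambda>k. dX (x k) (y k)) \<longlonglongrightarrow> 0"
      if x: "x \<in> cauchy_seqs (pts M) dX" and lim: "(\<lambda>k. f (x k)) \<longlonglongrightarrow> l" for x
    proof -
      have "x k \<in> pts M" for k
        using x Metric_space.MCauchy_def[OF weighted_induces_metric(2)[OF ind v]]
        by (auto simp: cauchy_seqs_def dX_def)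
      then show ?thesis
        using asymptotic_to_level[OF v l _ lim] level_proj_in_pts[OF l] f_level_proj[OF l]
        by (intro exI[of _ "\<lambda>k. level_proj l (x k)"]) (auto simp: level_def dX_def)
    qed
  qed
qed

end

theorem proposition3p25:
  fixes M :: "('a, 'e::euclidean_space) manifold"
    and m :: "real \<Rightarrow> 'a \<Rightarrow> 'a"
    and g :: "('a, 'e) metric_tensor"
    and f :: "'a \<Rightarrow> real"
    and v :: "real \<Rightarrow> real"
    and \<alpha> l :: real
    and d\<^sub>v d\<^sub>l :: "'a \<Rightarrow> 'a \<Rightarrow> real"
    and M\<^sub>l :: "'a set"
  assumes "smooth_manifold M"
    and "free_smooth_action M m"
    and "\<alpha> \<noteq> 0"
    and "homogeneous_pair M m \<alpha> g f"
    and "positive_definite M g"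
    and "induces_metric M g"
    and "smooth_map Rpos Rpos v"
    and "l > 0"
  defines "d\<^sub>v \<equiv> rdist M (\<lambda>x \<xi> \<eta>. (v \<circ> f) x * g x \<xi> \<eta>)"
    and "M\<^sub>l \<equiv> pts (level_manifold M f l)"
    and "d\<^sub>l \<equiv> rdist (level_manifold M f l) (level_metric M f l g)"
  shows "induces_metric M (\<lambda>x \<xi> \<eta>. (v \<circ> f) x * g x \<xi> \<eta>)
    \<and> induces_metric (level_manifold M f l) (level_metric M f l g)
    \<and> (\<exists>\<Phi>. (\<forall>y\<in>cauchy_seqs M\<^sub>l d\<^sub>l.
               y \<in> cauchy_seqs (pts M) d\<^sub>v \<and>
               \<Phi> (cauchy_class M\<^sub>l d\<^sub>l y) = cauchy_class (pts M) d\<^sub>v y)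
          \<and> homeomorphic_map
               (completion_topology M\<^sub>l d\<^sub>l)
               (subtopology (completion_topology (pts M) d\<^sub>v)
                  {cauchy_class (pts M) d\<^sub>v x | x.
                     x \<in> cauchy_seqs (pts M) d\<^sub>v \<and> (\<lambda>k. f (x k)) \<longlonglongrightarrow> l})
               \<Phi>)"
proof -
  interpret homogeneous_metric M m g \<alpha> f
    using assms(1,2,4,5) by unfold_locales (simp_all add: homogeneous_pair_def)
  have "continuous_map (top_of_set {0<..}) (top_of_set {0<..}) v"
    using assms(7) by (simp add: smooth_map_def Rpos_def)
  then have v: "continuous_on {0<..} v" "\<And>s. s > 0 \<Longrightarrow> v s > 0"
    by (auto simp: continuous_map_in_subtopology)
  have "d\<^sub>v = rpath_dist (v \<circ> f) (pts M)"
    unfolding d\<^sub>v_def rdist_def[abs_def] weighted_pseudo_dist rpath_dist_def[abs_def] ..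
  moreover have "d\<^sub>l = rpath_dist (\<lambda>_. 1) (level l)"
    unfolding d\<^sub>l_def rdist_def[abs_def] level_pseudo_dist rpath_dist_def[abs_def] ..
  moreover have "M\<^sub>l = level l"
    unfolding M\<^sub>l_def by (rule level_mfd_pts)
  ultimately show ?thesis
    using weighted_induces_metric(1)[OF assms(6) v] level_induces_metric(1)[OF assms(6,8)]
      level_completion[OF assms(6,8) v] by simp
qed


end
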